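(* Let $e\ge2$, let $k\in\{0,\dots,e-1\}$, and let $m$ denote the Mullineux map on $e$-regular partitions. Suppose $\mu$ is an $e$-regular partition. If $\mu$ and the conjugate partition $m(\mu)'$ are both $k$-empty, then $\mathfrak{L}_k(\mu)=\mathfrak{L}_k(m(\mu)')$.
   Context: **Partitions and the abacus.** A partition is a weakly decreasing sequence $\lambda=(\lambda_1,\lambda_2,\dots)$ of non-negative integers with finite sum $|\lambda|$. The conjugate $\lambda'$ is given by $\lambda'_i=|\{j:\lambda_j\ge i\}|$, so $\lambda'_1$ is the number of non-zero parts. $\lambda$ is $e$-regular if there is no $i\ge1$ with $\lambda_i=\lambda_{i+e-1}>0$. For $r\ge\lambda'_1$ the $r$-beta-set is $\mathfrak{B}_r(\lambda)=\{\lambda_i+r-i: 1\le i\le r\}$, which determines $\lambda$. The abacus has $e$ vertical runners numbered $0,\dots,e-1$, runner $i$ having positions $i,i+e,i+2e,\dots$ from the top down; the $r$-bead abacus display of $\lambda$ has a bead at each position in $\mathfrak{B}_r(\lambda)$. Positions with a bead are occupied, the others empty. **$k$-empty partitions and $\mathfrak{L}_k$.** Given $k\in\{0,\dots,e-1\}$ and $r\ge\lambda'_1$, let $d\in\{0,\dots,e-1\}$ be the residue of $k+r$ modulo $e$, and let $c$ be the number of beads on runner $d$ of the $r$-bead abacus display of $\lambda$. $\lambda$ is $k$-empty if these beads are at positions $d,d+e,\dots,d+(c-1)e$ (independent of $r$). For a finite multiset $B$ of non-negative integers, $X^e(B)$ is the multiset of non-negative integers in which $z$ has multiplicity equal to the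 number of elements of $B$ (with multiplicity) lying in $\{z,z+e,z+2e,\dots\}$. If $\lambda$ is $k$-empty, $\mathfrak{L}_k(\lambda)$ is the number of elements of $X^e(\mathfrak{B}_r(\lambda))$, with multiplicity, which are greater than $d+ce$ (independent of $r$). **The Mullineux map.** Let $\mu\ne\varnothing$ be $e$-regular and take its abacus display with $r\ge\mu'_1$ beads. Let $\beta$ be the last occupied position and $\gamma$ the first empty position. There is a unique sequence $b_1>c_1>\dots>b_t>c_t$ of non-negative integers such that: (1) each position $b_i$ is occupied and each $c_i$ is empty; (2) $b_1=\beta$; (3) for $1\le i<t$, $b_i\equiv c_i\pmod e$, all positions $b_i-e,b_i-2e,\dots,c_i+e$ are occupied, and all positions $c_i-1,c_i-2,\dots,b_{i+1}+1$ are empty; (4) either (a) $b_t\equiv c_t\pmod e$, all positions $b_t-e,\dots,c_t+e$ are occupied and all positions $c_t-1,c_t-2,\dots,\gamma$ are empty, or (b) all (non-negative) positions $b_t-e,b_t-2e,\dots$ are occupied and $c_t=\gamma$. Let $\mu^{\triangle}$ be the partition whose abacus display is obtained by moving the beads at $b_1,\dots,b_t$ to $c_1,\dots,c_t$, and let $\operatorname{rim}(\mu)=\sum_{i=1}^t(b_i-c_i)=|\mu|-|\mu^\triangle|$. Neither depends on $r$. The Mullineux map $m=m_e$, a bijection from the set of $e$-regular partitions of $n$ to itself for each $n$, is defined recursively by $m(\varnothing)=\varnothing$ and, for $\mu\neq\varnothing$: $m(\mu)$ is the unique $e$-regular partition with $(m(\mu))'_1=l$, $\operatorname{rim}(m(\mu))=\operatorname{rim}(\mu)$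 and $(m(\mu))^\triangle=m(\mu^\triangle)$, where $l=\operatorname{rim}(\mu)-\mu'_1$ if $e\mid\operatorname{rim}(\mu)$ and $l=\operatorname{rim}(\mu)-\mu'_1+1$ otherwise. *)

theory Defs
  imports Complex_Main "HOL-Library.Multiset"
begin

section \<open>Partitions\<close>

text \<open>Sequences are indexed from 0: the part \<open>\<lambda>\<^sub>i\<close> (\<open>i \<ge> 1\<close>) is \<open>p (i - 1)\<close>.\<close>

definition is_partition :: "(nat \<Rightarrow> nat) \<Rightarrow> bool" where
  "is_partition p \<longleftrightarrow> antimono p \<and> finite {i. p i \<noteq> 0}"

definition empty_partition :: "nat \<Rightarrow> nat" where
  "empty_partition = (\<lambda>_. 0)"

definition conjugate :: "(nat \<Rightarrow> nat) \<Rightarrow> nat \<Rightarrow> nat" where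
  "conjugate p = (\<lambda>i. card {j. p j \<ge> Suc i})"

definition num_parts :: "(nat \<Rightarrow> nat) \<Rightarrow> nat" where
  "num_parts p = conjugate p 0"

definition regular :: "nat \<Rightarrow> (nat \<Rightarrow> nat) \<Rightarrow> bool" where
  "regular e p \<longleftrightarrow> \<not> (\<exists>i. p i = p (i + e - 1) \<and> p i > 0)"


section \<open>Beta-sets and \<open>k\<close>-empty partitions\<close>

definition beta_set :: "nat \<Rightarrow> (nat \<Rightarrow> nat) \<Rightarrow> nat set" where
  "beta_set r p = (\<lambda>i. p i + (r - Suc i)) ` {..<r}"

definition runner_beads :: "nat \<Rightarrow> nat \<Rightarrow> nat set \<Rightarrow> nat set" where
  "runner_beads e d A = {x \<in> A. x mod e = d}"

text \<open>The notions below do not depend on the number \<open>r \<ge> num_parts p\<close> of beads;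
  \<open>r = num_parts p\<close> is used throughout.\<close>

definition k_empty :: "nat \<Rightarrow> nat \<Rightarrow> (nat \<Rightarrow> nat) \<Rightarrow> bool" where
  "k_empty e k p \<longleftrightarrow>
    (let r = num_parts p; d = (k + r) mod e; R = runner_beads e d (beta_set r p)
     in R = (\<lambda>j. d + j * e) ` {..<card R})"

definition X_mset :: "nat \<Rightarrow> nat multiset \<Rightarrow> nat multiset" where
  "X_mset e B = Abs_multiset (\<lambda>z. size {#b \<in># B. \<exists>j. b = z + j * e#})"

lemma count_X_mset: "count (X_mset e B) z = size {#b \<in># B. \<exists>j. b = z + j * e#}"
proof -
  have "finite {z. 0 < size {#b \<in># B. \<exists>j. b = z + j * e#}}"
  proof (rule finite_subset)
    show "{z. 0 < size {#b \<in># B. \<exists>j. b = z + j * e#}} \<subseteq> (\<Union>b\<in>set_mset B. {..b})"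
    proof
      fix z
      assume "z \<in> {z. 0 < size {#b \<in># B. \<exists>j. b = z + j * e#}}"
      then have "{#b \<in># B. \<exists>j. b = z + j * e#} \<noteq> {#}"
        unfolding mem_Collect_eq nonempty_has_size .
      then obtain b where "b \<in># {#b \<in># B. \<exists>j. b = z + j * e#}"
        by (rule multiset_nonemptyE)
      then obtain j where "b \<in># B" and "b = z + j * e"
        by auto
      then have "b \<in># B" and "z \<in> {..b}"
        by simp_all
      then show "z \<in> (\<Union>b\<in>set_mset B. {..b})"
        by (rule UN_I)
    qed
  qed simp
  then show ?thesis
    unfolding X_mset_def by (subst Abs_multiset_inverse) simp_all
qed

definition L_stat :: "nat \<Rightarrow> nat \<Rightarrow> (nat \<Rightarrow> nat) \<Rightarrow> nat" where
  "L_stat e k p =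
    (let r = num_parts p; d = (k + r) mod e; c = card (runner_beads e d (beta_set r p))
     in size {#z \<in># X_mset e (mset_set (beta_set r p)). z > d + c * e#})"


section \<open>The Mullineux map\<close>

text \<open>The list \<open>[(b\<^sub>1, c\<^sub>1), \<dots>, (b\<^sub>t, c\<^sub>t)]\<close> of bead moves for a set \<open>A\<close> of occupied
  positions. For \<open>b > c\<close> congruent modulo \<open>e\<close>, the positions \<open>b - e, b - 2e, \<dots>, c + e\<close> are
  those \<open>x\<close> with \<open>c < x < b\<close> and \<open>x mod e = b mod e\<close>. The two disjuncts at the end are the
  two ways in which the sequence may stop.\<close>

definition is_rim_seq :: "nat \<Rightarrow> nat set \<Rightarrow> (nat \<times> nat) list \<Rightarrow> bool" where
  "is_rim_seq e A ps \<longleftrightarrow>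
    (let \<beta> = Max A; \<gamma> = (LEAST x. x \<notin> A); t = length ps;
         b = (\<lambda>i. fst (ps ! i)); c = (\<lambda>i. snd (ps ! i))
     in t \<ge> 1 \<and>
        (\<forall>i<t. b i > c i) \<and> (\<forall>i. Suc i < t \<longrightarrow> c i > b (Suc i)) \<and>
        (\<forall>i<t. b i \<in> A \<and> c i \<notin> A) \<and>
        b 0 = \<beta> \<and>
        (\<forall>i. Suc i < t \<longrightarrow>
           b i mod e = c i mod e \<and>
           (\<forall>x. c i < x \<and> x < b i \<and> x mod e = b i mod e \<longrightarrow> x \<in> A) \<and>
           (\<forall>x. b (Suc i) < x \<and> x < c i \<longrightarrow> x \<notin> A)) \<and>
        ((b (t - 1) mod e = c (t - 1) mod e \<and>
          (\<forall>x. c (t - 1) < x \<and> x < b (t - 1) \<and> x mod e = b (t - 1) mod e \<longrightarrow> x \<in> A) \<and>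
          (\<forall>x. \<gamma> \<le> x \<and> x < c (t - 1) \<longrightarrow> x \<notin> A)) \<or>
         ((\<forall>x. x < b (t - 1) \<and> x mod e = b (t - 1) mod e \<longrightarrow> x \<in> A) \<and>
          c (t - 1) = \<gamma>)))"

definition rim_seq :: "nat \<Rightarrow> (nat \<Rightarrow> nat) \<Rightarrow> (nat \<times> nat) list" where
  "rim_seq e p = (THE ps. is_rim_seq e (beta_set (num_parts p) p) ps)"

definition rim :: "nat \<Rightarrow> (nat \<Rightarrow> nat) \<Rightarrow> nat" where
  "rim e p = (\<Sum>(b, c)\<leftarrow>rim_seq e p. b - c)"

definition triangle :: "nat \<Rightarrow> (nat \<Rightarrow> nat) \<Rightarrow> nat \<Rightarrow> nat" where
  "triangle e p =
    (let r = num_parts p; ps = rim_seq e p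
     in THE q. is_partition q \<and> num_parts q \<le> r \<and>
          beta_set r q = beta_set r p - fst ` set ps \<union> snd ` set ps)"

text \<open>Graph of the recursion defining the Mullineux map. The requirement that the image of a
  nonempty partition be nonempty only makes explicit that \<open>rim\<close> and \<open>triangle\<close> are meant for
  nonempty partitions. The number \<open>l\<close> of parts is \<open>rim e \<mu> - num_parts \<mu>\<close>, plus one
  if \<open>e\<close> does not divide \<open>rim e \<mu>\<close>; adding \<open>num_parts \<mu>\<close> to both sides avoids truncated
  subtraction.\<close>

inductive mullineux_graph :: "nat \<Rightarrow> (nat \<Rightarrow> nat) \<Rightarrow> (nat \<Rightarrow> nat) \<Rightarrow> bool" for e where
  empty: "mullineux_graph e empty_partition empty_partition"
| step: "mullineux_graph e \<mu> \<nu>"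
  if "is_partition \<mu>" and "regular e \<mu>" and "\<mu> \<noteq> empty_partition"
    and "mullineux_graph e (triangle e \<mu>) \<rho>"
    and "is_partition \<nu>" and "regular e \<nu>" and "\<nu> \<noteq> empty_partition"
    and "num_parts \<nu> + num_parts \<mu> = (if e dvd rim e \<mu> then rim e \<mu> else rim e \<mu> + 1)"
    and "rim e \<nu> = rim e \<mu>"
    and "triangle e \<nu> = \<rho>"

definition mullineux :: "nat \<Rightarrow> (nat \<Rightarrow> nat) \<Rightarrow> nat \<Rightarrow> nat" where
  "mullineux e \<mu> = (THE \<nu>. mullineux_graph e \<mu> \<nu>)"

end

theory Submission
  imports Defs
begin

text \<open>
  Read a partition as a set of beads on the integers, \<open>\<lambda> \<mapsto> {\<lambda>\<^sub>i - i}\<close>. No number of beads has to be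
  chosen, runners are residue classes, and conjugation turns the line around while exchanging
  beads and gaps. If \<open>\<lambda>\<close> is \<open>k\<close>-empty and \<open>p\<close> is the first gap on its runner, then
  \<open>\<LL>\<^sub>k(\<lambda>)\<close> is the sum, over the beads \<open>b > p\<close>, of the number of positions of this runner in
  \<open>[p, b)\<close>, that is, of \<open>f\<^sup>+(b) = max 0 (f b)\<close> where \<open>f x\<close> is \<open>(x - p) / e\<close> rounded up
  (\<open>k_empty_empty_runner\<close>).

  Let \<open>\<gamma>\<close> be the first gap of \<open>\<mu>\<close>, let \<open>a\<close> be the size of its rim, and let \<open>z\<close> be the last bead of
  \<open>m(\<mu>)'\<close>. The number of parts prescribed for \<open>m(\<mu>)\<close> says that \<open>z\<close> is \<open>\<gamma> + a - 1\<close> if \<open>e\<close> divides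
  \<open>a\<close>, and \<open>\<gamma> + a\<close> otherwise. For any function with constant increment per \<open>e\<close> steps the moves
  \<open>b\<^sub>i \<mapsto> c\<^sub>i\<close> act like one move from \<open>\<gamma> + a\<close> to \<open>\<gamma>\<close>, for \<open>\<mu>\<close> as well as for \<open>m(\<mu>)'\<close>. So sums of such
  functions over the beads of \<open>\<mu>\<close> and of \<open>m(\<mu>)'\<close> agree (\<open>wsum_mullineux\<close>). In particular both have
  equally many beads on each runner, hence the same \<open>p\<close>.

  The function \<open>f\<^sup>+\<close> is not of this kind, and the theorem is proved by following the recursion
  (\<open>mullineux_wsum_runner_pos\<close>). All beads above \<open>\<gamma>\<close> lie in the intervals \<open>(c\<^sub>i, b\<^sub>i]\<close>. The positions of the
  runner below \<open>p\<close> are beads of \<open>\<mu>\<close>, so each of them above \<open>\<gamma>\<close> is jumped over by exactly one move,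
  and the sum of \<open>f\<^sup>+\<close> drops by \<open>f(\<gamma> + a)\<close>. The positions at or above \<open>p\<close> are gaps of \<open>m(\<mu>)'\<close>, so
  each of them below \<open>z\<close> is jumped over by exactly one move there, and the sum drops by
  \<open>f\<^sup>+(z)\<close>. These numbers agree. The argument fails only when the last move changes runners and
  starts or ends on the given one. In the first case \<open>z = p - e\<close>, and counting shows that neither
  partition has a bead above \<open>p\<close>, so both sums vanish. In the second case the first
  applies to \<open>m(\<mu>)\<close>, and neither \<open>\<mu>\<close> nor \<open>m(\<mu>)'\<close> has a gap at or below \<open>p - e\<close>; then the sums of
  \<open>f\<^sup>+\<close> agree because those of \<open>f\<close> do.

  All this presupposes that the recursion defines a map. The moves are encoded as a finite set of
  disjoint intervals (\<open>rim_moves\<close>), produced by a greedy procedure. The same procedure run upwards inverts \<open>\<mu> \<mapsto> \<mu>\<^sup>\<triangle>\<close> once the new first gap and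
  the size of the rim modulo \<open>e\<close> are given (\<open>moves_reversible\<close>, \<open>moves_injective\<close>). The size itself
  is pinned down by comparing the rims of \<open>\<mu>\<close> and \<open>\<mu>\<^sup>\<triangle>\<close>: a counter scanning the display from the
  top yields \<open>z\<close>, and running it on both displays at once confines the drop of \<open>z\<close> to \<open>e\<close>
  consecutive values (\<open>rim_end_bounds\<close>). The first gap obeys the same bounds
  (\<open>first_gap_moved_bounds\<close>), and this symmetry is what lets the recursion continue on the side of
  the image.
\<close>

section \<open>Partitions as sets of beads on the integers\<close>

text \<open>The abacus without a choice of the number of beads: the display with \<open>r\<close> beads is this set
  translated by \<open>r\<close> and cut off below \<open>0\<close>. So the runner of residue \<open>k + r\<close> there is the
  set of integers congruent to \<open>k\<close> here, whatever \<open>r\<close> is.\<close>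

definition maya :: "(nat \<Rightarrow> nat) \<Rightarrow> int set" where
  "maya p = range (\<lambda>i. int (p i) - int i - 1)"

definition first_gap :: "int set \<Rightarrow> int \<Rightarrow> bool" where
  "first_gap M \<gamma> \<longleftrightarrow> \<gamma> \<notin> M \<and> (\<forall>x<\<gamma>. x \<in> M)"

text \<open>The bead form of \<open>e\<close>-regularity: \<open>e\<close> equal positive parts are \<open>e\<close> consecutive beads
  above the first gap.\<close>

definition run_free :: "nat \<Rightarrow> int set \<Rightarrow> int \<Rightarrow> bool" where
  "run_free e M \<gamma> \<longleftrightarrow> (\<forall>x>\<gamma>. \<exists>y. x \<le> y \<and> y < x + int e \<and> y \<notin> M)"

text \<open>Conjugation: turn the line around and exchange beads and gaps.\<close>

definition flip :: "int set \<Rightarrow> int set" where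
  "flip M = {x. - 1 - x \<notin> M}"

lemma first_gap_unique: "first_gap M \<gamma> \<Longrightarrow> first_gap M \<gamma>' \<Longrightarrow> \<gamma> = \<gamma>'"
  unfolding first_gap_def by (metis linorder_neqE)

lemma partition_antimono: "is_partition p \<Longrightarrow> i \<le> j \<Longrightarrow> p j \<le> p i"
  unfolding is_partition_def antimono_def by blast

lemma partition_tail: "is_partition p \<Longrightarrow> \<exists>m. \<forall>i\<ge>m. p i = 0"
proof -
  assume "is_partition p"
  then have "finite {i. p i \<noteq> 0}" unfolding is_partition_def by blast
  then obtain m where "\<forall>i\<in>{i. p i \<noteq> 0}. i < m"
    using finite_nat_set_iff_bounded by blast
  then show ?thesis by (intro exI[of _ m]) (metis mem_Collect_eq leD)
qed

lemma maya_strict: "is_partition p \<Longrightarrow> i < j \<Longrightarrow> int (p j) - int j - 1 < int (p i) - int i - 1"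
  using partition_antimono[of p i j] by simp

lemma maya_index_less_iff:
  assumes "is_partition p"
  shows "int (p j) - int j - 1 < int (p i) - int i - 1 \<longleftrightarrow> i < j"
  using maya_strict[OF assms, of i j] maya_strict[OF assms, of j i]
  by (cases i j rule: linorder_cases) auto

lemma conjugate_eqI:
  assumes "is_partition p" "\<And>m. m < i \<Longrightarrow> j < p m" "p i \<le> j"
  shows "conjugate p j = i"
proof -
  have "{m. Suc j \<le> p m} = {..<i}"
    using assms(2,3) partition_antimono[OF assms(1), of i]
    by (auto simp: Suc_le_eq) (metis leD le_less_trans linorder_not_le order_trans)
  then show ?thesis unfolding conjugate_def by simp
qed

text \<open>Both sides say that the Young diagram has a cell in row \<open>i\<close> and column \<open>j\<close>. Every fact about
  conjugates and numbers of parts below is read off from this.\<close>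

lemma conjugate_greater_iff:
  assumes "is_partition p"
  shows "i < conjugate p j \<longleftrightarrow> j < p i"
proof -
  obtain m where m: "\<forall>i\<ge>m. p i = 0" using partition_tail[OF assms] by blast
  define l where "l = (LEAST l. p l \<le> j)"
  have l: "p l \<le> j" unfolding l_def by (rule LeastI[of _ m]) (use m in simp)
  have l': "j < p i" if "i < l" for i using not_less_Least[of i] that unfolding l_def by force
  have "conjugate p j = l" by (rule conjugate_eqI[OF assms]) (use l l' in auto)
  then show ?thesis using l l' partition_antimono[OF assms, of l i]
    by (metis leD le_less_trans linorder_not_le)
qed

lemma num_parts_greater_iff: "is_partition p \<Longrightarrow> i < num_parts p \<longleftrightarrow> 0 < p i"
  unfolding num_parts_def by (rule conjugate_greater_iff)

lemma num_parts_le_iff: "is_partition p \<Longrightarrow> num_parts p \<le> r \<longleftrightarrow> (\<forall>i\<ge>r. p i = 0)"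
  by (metis num_parts_greater_iff leD linorder_not_le neq0_conv order_trans order_refl less_le_trans)

lemma first_gap_maya: "is_partition p \<Longrightarrow> first_gap (maya p) (- int (num_parts p))"
  unfolding first_gap_def
proof (intro conjI allI impI)
  assume p: "is_partition p"
  show "- int (num_parts p) \<notin> maya p"
  proof
    assume "- int (num_parts p) \<in> maya p"
    then obtain i where "- int (num_parts p) = int (p i) - int i - 1" unfolding maya_def by blast
    then show False using num_parts_greater_iff[OF p, of i] by (cases "i < num_parts p") auto
  qed
  fix x assume x: "x < - int (num_parts p)"
  have "p (nat (- x - 1)) = 0" using num_parts_greater_iff[OF p, of "nat (-x-1)"] x by auto
  then have "x = int (p (nat (- x - 1))) - int (nat (- x - 1)) - 1" using x by auto
  then show "x \<in> maya p" unfolding maya_def by blast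
qed

lemma maya_less:
  assumes "is_partition p" "x \<in> maya p"
  shows "x < int (p 0)"
proof -
  obtain i where "x = int (p i) - int i - 1" using assms(2) unfolding maya_def by blast
  then show ?thesis using partition_antimono[OF assms(1), of 0 i] by simp
qed

lemma finite_maya_above: "is_partition p \<Longrightarrow> finite {x \<in> maya p. l \<le> x}"
  by (rule finite_subset[of _ "{l..<int (p 0)}"]) (auto simp: maya_less)

lemma beta_set_iff_maya:
  assumes "is_partition p" "num_parts p \<le> r"
  shows "n \<in> beta_set r p \<longleftrightarrow> int n - int r \<in> maya p"
proof
  assume "n \<in> beta_set r p"
  then obtain i where "i < r" "n = p i + (r - Suc i)" unfolding beta_set_def by blast
  then have "int n - int r = int (p i) - int i - 1" by simp
  then show "int n - int r \<in> maya p" unfolding maya_def by blast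
next
  assume "int n - int r \<in> maya p"
  then obtain i where i: "int n - int r = int (p i) - int i - 1" unfolding maya_def by blast
  have "i < r"
  proof (rule ccontr)
    assume "\<not> i < r"
    then have "p i = 0" using assms num_parts_le_iff by force
    then show False using i \<open>\<not> i < r\<close> by simp
  qed
  moreover from this i have "n = p i + (r - Suc i)" by linarith
  ultimately show "n \<in> beta_set r p" unfolding beta_set_def by blast
qed

text \<open>The parts are recovered from the beads because the enumeration is strictly decreasing: at the
  first index where two enumerations differ, the larger value is missed by the other one.\<close>

lemma maya_inj:
  assumes "is_partition p" "is_partition q" "maya p = maya q"
  shows "p = q"
proof (rule ccontr)
  assume "p \<noteq> q"
  then obtain i0 where "p i0 \<noteq> q i0" by blast
  define i where "i = (LEAST i. p i \<noteq> q i)"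
  have i: "p i \<noteq> q i" unfolding i_def by (rule LeastI) fact
  have eq: "p j = q j" if "j < i" for j using not_less_Least that unfolding i_def by blast
  have *: False if "is_partition p" "is_partition q" "maya p = maya q" "p i < q i"
    "\<And>j. j < i \<Longrightarrow> p j = q j" for p q
  proof -
    have "int (q i) - int i - 1 \<in> maya p" unfolding that(3) unfolding maya_def by blast
    then obtain j where j: "int (q i) - int i - 1 = int (p j) - int j - 1" unfolding maya_def by blast
    have "j < i" using maya_index_less_iff[OF that(1), of i j] j that(4) by auto
    then have "int (q i) - int i - 1 = int (q j) - int j - 1" using that(5) j by simp
    then show False using maya_strict[OF that(2) \<open>j < i\<close>] by simp
  qed
  show False using *[of p q] *[of q p] assms i eq by (metis linorder_neqE_nat)
qed

text \<open>The cell criterion makes \<open>p i + conjugate p j = i + j + 1\<close> impossible, so no bead of the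
  conjugate comes from a bead of \<open>p\<close>. Conversely, a gap \<open>y\<close> is located by the first index \<open>i\<close>
  whose bead lies below it, and then column \<open>y + i\<close> of the diagram has length \<open>i\<close>.\<close>

lemma maya_conjugate:
  assumes "is_partition p"
  shows "maya (conjugate p) = flip (maya p)"
proof (intro set_eqI iffI)
  fix x assume "x \<in> maya (conjugate p)"
  then obtain j where j: "x = int (conjugate p j) - int j - 1" unfolding maya_def by blast
  show "x \<in> flip (maya p)" unfolding flip_def
  proof (clarify)
    assume "- 1 - x \<in> maya p"
    then obtain i where "- 1 - x = int (p i) - int i - 1" unfolding maya_def by blast
    then show False using j conjugate_greater_iff[OF assms, of i j] by linarith
  qed
next
  fix x assume "x \<in> flip (maya p)"
  define y where "y = - 1 - x"
  have y: "y \<notin> maya p" using \<open>x \<in> _\<close> unfolding flip_def y_def by simp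
  obtain m where m: "\<forall>i\<ge>m. p i = 0" using partition_tail[OF assms] by blast
  define i where "i = (LEAST i. int (p i) - int i - 1 \<le> y)"
  have i: "int (p i) - int i - 1 \<le> y" unfolding i_def
    by (rule LeastI[of _ "max m (nat (- y))"]) (use m in auto)
  have i': "int (p l) - int l - 1 > y" if "l < i" for l
    using not_less_Least[of l] that unfolding i_def by force
  have ne: "int (p i) - int i - 1 \<noteq> y" using y unfolding maya_def by blast
  define j where "j = nat (y + int i)"
  have j: "int j = y + int i" using i ne unfolding j_def by linarith
  have "conjugate p j = i"
  proof (rule conjugate_eqI[OF assms])
    show "p i \<le> j" using i ne j by linarith
    fix l assume l: "l < i"
    then have "int (p (i - 1)) - int (i - 1) - 1 > y" by (intro i') simp
    then have "j < p (i - 1)" using j l by linarith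
    also have "p (i - 1) \<le> p l" using l by (intro partition_antimono[OF assms]) simp
    finally show "j < p l" .
  qed
  then have "x = int (conjugate p j) - int j - 1" using j y_def by simp
  then show "x \<in> maya (conjugate p)" unfolding maya_def by blast
qed

lemma is_partition_conjugate:
  assumes "is_partition p"
  shows "is_partition (conjugate p)"
  unfolding is_partition_def
proof
  show "antimono (conjugate p)"
  proof (rule antimonoI, rule ccontr)
    fix i j :: nat assume "i \<le> j" "\<not> conjugate p j \<le> conjugate p i"
    then show False using conjugate_greater_iff[OF assms, of "conjugate p i"]
      by (metis le_less_trans less_irrefl linorder_not_le)
  qed
  have "{i. conjugate p i \<noteq> 0} \<subseteq> {..<p 0}"
    using conjugate_greater_iff[OF assms, of 0] by auto
  then show "finite {i. conjugate p i \<noteq> 0}" using finite_subset by blast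
qed

text \<open>A strictly decreasing enumeration takes \<open>e\<close> consecutive values exactly at \<open>e\<close> consecutive
  indices, and there the parts agree.\<close>

lemma regular_iff_run_free:
  assumes p: "is_partition p" and e: "1 \<le> e"
  shows "regular e p \<longleftrightarrow> run_free e (maya p) (- int (num_parts p))"
proof
  assume reg: "regular e p"
  show "run_free e (maya p) (- int (num_parts p))"
    unfolding run_free_def
  proof (intro allI impI, rule ccontr)
    fix x assume x: "- int (num_parts p) < x" and "\<nexists>y. x \<le> y \<and> y < x + int e \<and> y \<notin> maya p"
    then have run: "\<And>y. x \<le> y \<Longrightarrow> y < x + int e \<Longrightarrow> y \<in> maya p" by blast
    define ix where "ix y = (SOME i. y = int (p i) - int i - 1)" for y
    have ix: "y = int (p (ix y)) - int (ix y) - 1" if "x \<le> y" "y < x + int e" for y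
      using run[OF that] unfolding maya_def ix_def by (auto intro: someI)
    let ?i = "ix (x + int e - 1)" and ?j = "ix x"
    have hi: "x + int e - 1 = int (p ?i) - int ?i - 1" and lo: "x = int (p ?j) - int ?j - 1"
      using ix e by auto
    have "inj_on ix {x..<x + int e}" by (rule inj_onI) (metis ix atLeastLessThan_iff)
    moreover have "ix ` {x..<x + int e} \<subseteq> {?i..?j}"
    proof
      fix l assume "l \<in> ix ` {x..<x + int e}"
      then obtain y where y: "l = ix y" "x \<le> y" "y < x + int e" by auto
      have "\<not> l < ?i" using maya_index_less_iff[OF p, of ?i l] hi y ix[OF y(2,3)] by auto
      moreover have "\<not> ?j < l" using maya_index_less_iff[OF p, of l ?j] lo y ix[OF y(2,3)] by auto
      ultimately show "l \<in> {?i..?j}" by auto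
    qed
    ultimately have "card {x..<x + int e} \<le> card {?i..?j}" using card_inj_on_le by blast
    then have "e \<le> Suc ?j - ?i" by simp
    then have le: "?i + e \<le> ?j + 1" using e by linarith
    then have "p ?j \<le> p ?i" using e by (intro partition_antimono[OF p]) simp
    with hi lo le have "?j = ?i + e - 1" and "p ?i = p ?j" by linarith+
    moreover have "0 < p ?j"
    proof (rule ccontr)
      assume "\<not> 0 < p ?j"
      then have "num_parts p \<le> ?j" using num_parts_greater_iff[OF p, of ?j] by simp
      then show False using lo \<open>\<not> 0 < p ?j\<close> x by simp
    qed
    ultimately show False using reg unfolding regular_def by metis
  qed
next
  assume rf: "run_free e (maya p) (- int (num_parts p))"
  show "regular e p" unfolding regular_def
  proof (clarify)
    fix i assume eq: "p i = p (i + e - 1)" and pos: "0 < p i"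
    let ?x = "int (p i) - int (i + e - 1) - 1"
    have "i + e - 1 < num_parts p" using num_parts_greater_iff[OF p, of "i + e - 1"] eq pos by simp
    then have "- int (num_parts p) < ?x" using pos by linarith
    then obtain y where y: "?x \<le> y" "y < ?x + int e" "y \<notin> maya p"
      using rf unfolding run_free_def by blast
    define l where "l = nat (int (p i) - 1 - y)"
    have l: "int l = int (p i) - 1 - y" "i \<le> l" "l \<le> i + e - 1" using y e unfolding l_def by linarith+
    have "p l = p i" using partition_antimono[OF p l(2)] partition_antimono[OF p l(3)] eq by simp
    then have "y = int (p l) - int l - 1" using l by simp
    then show False using y(3) unfolding maya_def by blast
  qed
qed

lemma partition_of_beta_set:
  assumes "finite B"
  obtains q where "is_partition q" "num_parts q \<le> card B" "beta_set (card B) q = B"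
proof -
  define r where "r = card B"
  define xs where "xs = sorted_list_of_set B"
  have len: "length xs = r" unfolding xs_def r_def by simp
  have sxs: "set xs = B" unfolding xs_def using assms by simp
  have srt: "xs ! i < xs ! j" if "i < j" "j < r" for i j
    using that len strict_sorted_list_of_set[of B] unfolding xs_def by (simp add: sorted_wrt_iff_nth_less)
  have step: "xs ! i + (j - i) \<le> xs ! j" if "i \<le> j" "j < r" for i j
    using that
  proof (induction j rule: dec_induct)
    case (step n)
    then show ?case using srt[of n "Suc n"] by force
  qed simp
  have ge: "i \<le> xs ! i" if "i < r" for i using step[of 0 i] that by simp
  define q where "q i = (if i < r then xs ! (r - Suc i) - (r - Suc i) else 0)" for i
  have part: "is_partition q" unfolding is_partition_def
  proof
    show "antimono q"
    proof (rule antimonoI)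
      fix i j :: nat assume "i \<le> j"
      show "q j \<le> q i"
      proof (cases "j < r")
        case True
        then have "xs ! (r - Suc j) + (j - i) \<le> xs ! (r - Suc i)" "r - Suc j \<le> xs ! (r - Suc j)"
          using step[of "r - Suc j" "r - Suc i"] ge[of "r - Suc j"] \<open>i \<le> j\<close> by auto
        then show ?thesis using True \<open>i \<le> j\<close> unfolding q_def by simp
      qed (simp add: q_def)
    qed
    have "{i. q i \<noteq> 0} \<subseteq> {..<r}" unfolding q_def by auto
    then show "finite {i. q i \<noteq> 0}" using finite_subset by blast
  qed
  have "beta_set r q = (\<lambda>i. xs ! (r - Suc i)) ` {..<r}"
    unfolding beta_set_def
  proof (rule image_cong)
    fix i assume "i \<in> {..<r}"
    then show "q i + (r - Suc i) = xs ! (r - Suc i)" using ge[of "r - Suc i"] by (simp add: q_def)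
  qed simp
  also have "\<dots> = (!) xs ` ((\<lambda>i. r - Suc i) ` {..<r})" by (simp add: image_image)
  also have "(\<lambda>i. r - Suc i) ` {..<r} = {..<r}"
  proof (intro equalityI subsetI)
    fix i assume "i \<in> {..<r}"
    then show "i \<in> (\<lambda>i. r - Suc i) ` {..<r}" by (intro image_eqI[of _ _ "r - Suc i"]) auto
  qed auto
  also have "(!) xs ` {..<r} = B" using len sxs by (auto simp: set_conv_nth)
  finally have "beta_set r q = B" .
  moreover have "num_parts q \<le> r" using num_parts_le_iff[OF part] unfolding q_def by simp
  ultimately show thesis using that part unfolding r_def by blast
qed

lemma beta_set_inj:
  assumes "is_partition p" "is_partition q" "num_parts p \<le> r" "num_parts q \<le> r"
    "beta_set r p = beta_set r q"
  shows "p = q"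
proof (rule maya_inj[OF assms(1,2)], rule set_eqI)
  fix x
  show "x \<in> maya p \<longleftrightarrow> x \<in> maya q"
  proof (cases "x < - int r")
    case True
    then show ?thesis using first_gap_maya[OF assms(1)] first_gap_maya[OF assms(2)] assms(3,4)
      unfolding first_gap_def by auto
  next
    case False
    then have "x = int (nat (x + int r)) - int r" by simp
    then show ?thesis using beta_set_iff_maya assms by metis
  qed
qed

lemma card_beta_set:
  assumes "is_partition p"
  shows "card (beta_set r p) = r"
proof -
  have "inj_on (\<lambda>i. p i + (r - Suc i)) {..<r}"
  proof (rule linorder_inj_onI')
    fix i j assume "i \<in> {..<r}" "j \<in> {..<r}" "i < j"
    then show "p i + (r - Suc i) \<noteq> p j + (r - Suc j)" using partition_antimono[OF assms, of i j] by simp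
  qed
  then show ?thesis unfolding beta_set_def by (metis card_image card_lessThan)
qed

text \<open>Moving finitely many beads to as many gaps keeps the number of beads in every long enough
  display, so the result is again the bead set of a partition. This produces both the partition
  \<open>triangle e p\<close> and the preimages under it.\<close>

lemma partition_of_moved_maya:
  assumes p: "is_partition p" and fin: "finite X" "finite Y"
    and X: "X \<subseteq> maya p" and Y: "Y \<inter> maya p = {}" and card: "card X = card Y"
  obtains q where "is_partition q" "maya q = maya p - X \<union> Y"
proof -
  have "finite (X \<union> Y \<union> {- int (num_parts p)})" using fin by simp
  then obtain l where l: "\<forall>x\<in>X \<union> Y \<union> {- int (num_parts p)}. l \<le> x"
    by (metis Min_le)
  define r where "r = nat (- l)"
  have np: "num_parts p \<le> r" using l unfolding r_def by force
  have ge: "- int r \<le> x" if "x \<in> X \<union> Y" for x using l that unfolding r_def by force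
  let ?s = "\<lambda>n. int n - int r"
  define X' Y' where "X' = ?s -` X" and "Y' = ?s -` Y"
  have in_range: "X \<union> Y \<subseteq> range ?s"
  proof
    fix x assume "x \<in> X \<union> Y"
    from ge[OF this] have "x = ?s (nat (x + int r))" by simp
    then show "x \<in> range ?s" by blast
  qed
  then have im: "?s ` X' = X" "?s ` Y' = Y" unfolding X'_def Y'_def by auto
  have inj: "inj ?s" by (simp add: inj_on_def)
  have fin': "finite X'" "finite Y'" unfolding X'_def Y'_def using fin inj by (auto intro: finite_vimageI)
  have card': "card X' = card Y'" using card im card_image[OF inj_on_subset[OF inj]] by (metis subset_UNIV)
  let ?A = "beta_set r p"
  have A: "n \<in> ?A \<longleftrightarrow> ?s n \<in> maya p" for n using beta_set_iff_maya[OF p np] .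
  have finA: "finite ?A" unfolding beta_set_def by simp
  have XA: "X' \<subseteq> ?A" and YA: "Y' \<inter> ?A = {}" using A X Y unfolding X'_def Y'_def by auto
  have "card (?A - X' \<union> Y') = card (?A - X') + card Y'"
    using YA finA fin' by (intro card_Un_disjoint) auto
  also have "\<dots> = card ?A" using XA finA fin' card' card_mono[OF finA XA] by (simp add: card_Diff_subset)
  also have "\<dots> = r" by (rule card_beta_set[OF p])
  finally have cr: "card (?A - X' \<union> Y') = r" .
  have "finite (?A - X' \<union> Y')" using finA fin' by simp
  from partition_of_beta_set[OF this] obtain q where
    q: "is_partition q" "num_parts q \<le> r" "beta_set r q = ?A - X' \<union> Y'" unfolding cr by blast
  have "maya q = maya p - X \<union> Y"
  proof (rule set_eqI)
    fix x
    show "x \<in> maya q \<longleftrightarrow> x \<in> maya p - X \<union> Y"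
    proof (cases "x < - int r")
      case True
      then show ?thesis using first_gap_maya[OF p] first_gap_maya[OF q(1)] np q(2) ge[of x]
        unfolding first_gap_def by auto
    next
      case False
      then have "x = ?s (nat (x + int r))" by simp
      then obtain n where n: "x = ?s n" by blast
      then show ?thesis using beta_set_iff_maya[OF q(1,2), of n] q(3) A[of n]
        unfolding X'_def Y'_def by auto
    qed
  qed
  then show thesis using that q(1) by blast
qed

section \<open>The rim as a set of disjoint intervals\<close>

text \<open>The sequence \<open>b\<^sub>1 > c\<^sub>1 > \<dots> > b\<^sub>t > c\<^sub>t\<close> seen as the set of its pairs. The demand that beads
  above the first gap \<open>\<gamma>\<close> lie in the intervals \<open>(c, b]\<close> replaces everything that the sequence
  says about empty stretches, and the order of the pairs is implied by disjointness. A move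
  that leaves its runner must end at \<open>\<gamma>\<close>; the beads required below it are then automatic,
  because all positions below \<open>\<gamma>\<close> are occupied.\<close>

definition rim_moves :: "nat \<Rightarrow> int set \<Rightarrow> int \<Rightarrow> (int \<times> int) set \<Rightarrow> bool" where
  "rim_moves e M \<gamma> P \<longleftrightarrow> finite P \<and>
    (\<forall>b c. (b, c) \<in> P \<longrightarrow> \<gamma> \<le> c \<and> c < b \<and> b \<in> M \<and> c \<notin> M \<and> (int e dvd b - c \<or> c = \<gamma>) \<and>
       (\<forall>x. c < x \<and> x < b \<and> int e dvd b - x \<longrightarrow> x \<in> M)) \<and>
    (\<forall>b c b' c'. (b, c) \<in> P \<longrightarrow> (b', c') \<in> P \<longrightarrow> (b, c) = (b', c') \<or> b < c' \<or> b' < c) \<and>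
    (\<forall>x\<in>M. \<gamma> < x \<longrightarrow> (\<exists>(b, c)\<in>P. c < x \<and> x \<le> b))"

definition moved :: "int set \<Rightarrow> (int \<times> int) set \<Rightarrow> int set" where
  "moved M P = M - fst ` P \<union> snd ` P"

definition rim_length :: "(int \<times> int) set \<Rightarrow> int" where
  "rim_length P = (\<Sum>(b, c)\<in>P. b - c)"

lemma rim_movesD:
  assumes "rim_moves e M \<gamma> P" "(b, c) \<in> P"
  shows "\<gamma> \<le> c" "c < b" "b \<in> M" "c \<notin> M" "int e dvd b - c \<or> c = \<gamma>"
    "\<And>x. c < x \<Longrightarrow> x < b \<Longrightarrow> int e dvd b - x \<Longrightarrow> x \<in> M"
  using assms unfolding rim_moves_def by blast+

lemma rim_moves_finite: "rim_moves e M \<gamma> P \<Longrightarrow> finite P"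
  unfolding rim_moves_def by blast

lemma rim_moves_disjoint:
  "rim_moves e M \<gamma> P \<Longrightarrow> (b, c) \<in> P \<Longrightarrow> (b', c') \<in> P \<Longrightarrow> (b, c) = (b', c') \<or> b < c' \<or> b' < c"
  unfolding rim_moves_def by blast

lemma rim_moves_cover:
  assumes "rim_moves e M \<gamma> P" "x \<in> M" "\<gamma> < x"
  obtains b c where "(b, c) \<in> P" "c < x" "x \<le> b"
  using assms unfolding rim_moves_def by blast

lemma rim_moves_meet:
  assumes "rim_moves e M \<gamma> P" "(b, c) \<in> P" "(b', c') \<in> P" "c \<le> x" "x \<le> b" "c' \<le> x" "x \<le> b'"
  shows "b = b'" "c = c'"
  using rim_moves_disjoint[OF assms(1,2,3)] assms(4-) by auto

lemma rim_moves_snd_inj: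
  assumes "rim_moves e M \<gamma> P" "(b, c) \<in> P" "(b', c) \<in> P"
  shows "b = b'"
  using rim_moves_meet(1)[OF assms, of c] rim_movesD(2)[OF assms(1)] assms(2,3) by force

lemma rim_moves_fst_inj:
  assumes "rim_moves e M \<gamma> P" "(b, c) \<in> P" "(b, c') \<in> P"
  shows "c = c'"
  using rim_moves_meet(2)[OF assms, of b] rim_movesD(2)[OF assms(1)] assms(2,3) by force

lemma inj_on_fst_rim_moves: "rim_moves e M \<gamma> P \<Longrightarrow> inj_on fst P"
  by (rule inj_onI) (metis rim_moves_fst_inj prod.collapse)

lemma inj_on_snd_rim_moves: "rim_moves e M \<gamma> P \<Longrightarrow> inj_on snd P"
  by (rule inj_onI) (metis rim_moves_snd_inj prod.collapse)

lemma moved_snd: "(b, x) \<in> P \<Longrightarrow> x \<in> moved M P"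
  unfolding moved_def by force

lemma moved_iff: "x \<in> moved M P \<longleftrightarrow> (x \<in> M \<and> (\<forall>c. (x, c) \<notin> P)) \<or> (\<exists>b. (b, x) \<in> P)"
  unfolding moved_def by force

lemma moved_fst:
  assumes "rim_moves e M \<gamma> P" "(b, c) \<in> P"
  shows "b \<notin> moved M P"
  using assms rim_movesD(3,4)[OF assms(1)] unfolding moved_iff by blast

text \<open>Intervals are disjoint, so strictly inside one of them no bead is moved.\<close>

lemma moved_inside:
  assumes "rim_moves e M \<gamma> P" "(b, c) \<in> P" "c < x" "x < b"
  shows "x \<in> moved M P \<longleftrightarrow> x \<in> M"
proof -
  have "(x, c') \<notin> P" for c'
    using rim_moves_meet(1)[OF assms(1,2), of x c' x] rim_movesD(2)[OF assms(1), of x c'] assms(3,4) by force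
  moreover have "(b', x) \<notin> P" for b'
    using rim_moves_meet(2)[OF assms(1,2), of b' x x] rim_movesD(2)[OF assms(1), of b' x] assms(3,4) by force
  ultimately show ?thesis unfolding moved_iff by blast
qed

lemma moved_outside:
  assumes "rim_moves e M \<gamma> P" "\<And>b c. (b, c) \<in> P \<Longrightarrow> \<not> (c \<le> x \<and> x \<le> b)"
  shows "x \<in> moved M P \<longleftrightarrow> x \<in> M"
proof -
  have "(x, c') \<notin> P" for c' using assms(2)[of x c'] rim_movesD(2)[OF assms(1), of x c'] by force
  moreover have "(b', x) \<notin> P" for b' using assms(2)[of b' x] rim_movesD(2)[OF assms(1), of b' x] by force
  ultimately show ?thesis unfolding moved_iff by blast
qed

lemma moved_below:
  assumes "rim_moves e M \<gamma> P" "x < \<gamma>"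
  shows "x \<in> moved M P \<longleftrightarrow> x \<in> M"
  using moved_outside[OF assms(1)] rim_movesD(1)[OF assms(1)] assms(2) by force

text \<open>The moves for a finite set of beads, with no first gap to stop at. Forward moves arise from it
  by truncation at the first gap, backward moves by reversing the direction of the line.\<close>

definition greedy :: "nat \<Rightarrow> int set \<Rightarrow> (int \<times> int) set \<Rightarrow> bool" where
  "greedy e B P \<longleftrightarrow> finite P \<and>
    (\<forall>b c. (b, c) \<in> P \<longrightarrow> c < b \<and> b \<in> B \<and> c \<notin> B \<and> int e dvd b - c \<and>
       (\<forall>x. c < x \<and> x < b \<and> int e dvd b - x \<longrightarrow> x \<in> B)) \<and>
    (\<forall>b c b' c'. (b, c) \<in> P \<longrightarrow> (b', c') \<in> P \<longrightarrow> (b, c) = (b', c') \<or> b < c' \<or> b' < c) \<and>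
    (\<forall>x\<in>B. \<exists>(b, c)\<in>P. c < x \<and> x \<le> b)"

lemma greedyD:
  assumes "greedy e B P"
  shows "finite P"
    and "(b, c) \<in> P \<Longrightarrow> c < b \<and> b \<in> B \<and> c \<notin> B \<and> int e dvd b - c \<and>
       (\<forall>x. c < x \<and> x < b \<and> int e dvd b - x \<longrightarrow> x \<in> B)"
    and "(b, c) \<in> P \<Longrightarrow> (b', c') \<in> P \<Longrightarrow> (b, c) = (b', c') \<or> b < c' \<or> b' < c"
    and "x \<in> B \<Longrightarrow> \<exists>(b, c)\<in>P. c < x \<and> x \<le> b"
  using assms unfolding greedy_def by blast+

text \<open>Take the highest bead, slide it down its runner to the first gap \<open>c\<close>, and continue with the
  beads below \<open>c\<close>.\<close>

lemma greedy_intervals: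
  fixes B :: "int set"
  assumes "finite B" "1 \<le> e"
  shows "\<exists>P. greedy e B P"
  using assms(1)
proof (induction B rule: finite_psubset_induct)
  case (psubset B)
  show ?case
  proof (cases "B = {}")
    case True
    then show ?thesis by (intro exI[of _ "{}"]) (simp add: greedy_def)
  next
    case False
    define b where "b = Max B"
    have b: "b \<in> B" "\<And>x. x \<in> B \<Longrightarrow> x \<le> b" unfolding b_def using psubset(1) False by auto
    define j where "j = (LEAST j. b - int e * int j \<notin> B)"
    have "\<exists>j. b - int e * int j \<notin> B"
    proof (rule ccontr)
      assume "\<nexists>j. b - int e * int j \<notin> B"
      then have "range (\<lambda>j. b - int e * int j) \<subseteq> B" by blast
      moreover have "inj (\<lambda>j. b - int e * int j)" using assms(2) by (auto simp: inj_on_def)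
      ultimately show False using psubset(1) by (meson finite_imageD finite_subset infinite_UNIV_nat)
    qed
    then have j: "b - int e * int j \<notin> B" unfolding j_def by (rule LeastI_ex)
    define c where "c = b - int e * int j"
    have "j \<noteq> 0" using j b(1) by (cases j) auto
    then have c: "c < b" "c \<notin> B" "int e dvd b - c" using j assms(2) unfolding c_def by auto
    have between: "x \<in> B" if x: "c < x" "x < b" "int e dvd b - x" for x
    proof -
      obtain k where k: "b - x = int e * k" using x(3) by blast
      then have "0 < int e * k" "int e * k < int e * int j" using x unfolding c_def by auto
      then have "0 < k" "k < int j" using assms(2) by (auto simp: zero_less_mult_iff)
      then have "nat k < j" "x = b - int e * int (nat k)" using k by auto
      then show "x \<in> B" using not_less_Least[of "nat k" "\<lambda>j. b - int e * int j \<notin> B"] unfolding j_def by auto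
    qed
    have "b \<notin> B \<inter> {..<c}" using c(1) by simp
    then have "B \<inter> {..<c} \<subset> B" using b(1) by blast
    from psubset(2)[OF this] obtain P where "greedy e (B \<inter> {..<c}) P" by blast
    note P = greedyD[OF this]
    show ?thesis unfolding greedy_def
    proof (intro exI[of _ "insert (b, c) P"] conjI allI impI ballI)
      show "finite (insert (b, c) P)" using P(1) by simp
      fix b1 c1 assume m: "(b1, c1) \<in> insert (b, c) P"
      show "c1 < b1" using m c(1) P(2) by auto
      show "b1 \<in> B" using m b(1) P(2) by auto
      show "c1 \<notin> B" using m c P(2)[of b1 c1] by auto
      show "int e dvd b1 - c1" using m c P(2) by auto
      show "x \<in> B" if "c1 < x \<and> x < b1 \<and> int e dvd b1 - x" for x
      proof (cases "(b1, c1) \<in> P")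
        case True
        then show ?thesis using P(2)[OF True] that by blast
      next
        case False
        then have "b1 = b" "c1 = c" using m by auto
        then show ?thesis using between that by blast
      qed
      fix b2 c2 assume m2: "(b2, c2) \<in> insert (b, c) P"
      show "(b1, c1) = (b2, c2) \<or> b1 < c2 \<or> b2 < c1"
      proof (cases "(b1, c1) \<in> P")
        case True
        then have "b1 < c" using P(2)[of b1 c1] by simp
        then show ?thesis using True m2 P(3)[of b1 c1 b2 c2] by blast
      next
        case False
        then have "(b1, c1) = (b, c)" using m by blast
        moreover have "b2 < c" if "(b2, c2) \<in> P" using P(2)[OF that] by simp
        ultimately show ?thesis using m2 by blast
      qed
    next
      fix x assume "x \<in> B"
      then show "\<exists>(b, c)\<in>insert (b, c) P. c < x \<and> x \<le> b"
        using b(2)[of x] c(2) P(4)[of x] by (cases x c rule: linorder_cases) auto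
    qed
  qed
qed

text \<open>Apply the greedy procedure to the beads above \<open>\<gamma>\<close> alone. Only the lowest interval can
  overshoot \<open>\<gamma>\<close>; cutting it there gives the move that changes runners.\<close>

lemma rim_moves_exists:
  assumes fg: "first_gap M \<gamma>" and fin: "finite {x \<in> M. \<gamma> < x}" and e: "1 \<le> e"
  shows "\<exists>P. rim_moves e M \<gamma> P"
proof -
  define B where "B = {x \<in> M. \<gamma> < x}"
  obtain P0 where "greedy e B P0" using greedy_intervals[of B e] fin e unfolding B_def[symmetric] by blast
  note P0 = greedyD[OF this]
  define f where "f = (\<lambda>(b :: int, c). (b, max c \<gamma>))"
  show ?thesis unfolding rim_moves_def
  proof (intro exI[of _ "f ` P0"] conjI allI impI ballI)
    show "finite (f ` P0)" using P0(1) by simp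
    fix b c assume "(b, c) \<in> f ` P0"
    then obtain c0 where m: "(b, c0) \<in> P0" "c = max c0 \<gamma>" unfolding f_def by auto
    note D = P0(2)[OF m(1)]
    show "\<gamma> \<le> c" using m by simp
    show "c < b" using D m unfolding B_def by auto
    show "b \<in> M" using D unfolding B_def by auto
    show "c \<notin> M" using D m fg unfolding B_def first_gap_def by (auto simp: max_def)
    show "int e dvd b - c \<or> c = \<gamma>" using D m by (auto simp: max_def)
    show "x \<in> M" if "c < x \<and> x < b \<and> int e dvd b - x" for x
      using D that m unfolding B_def by auto
    fix b' c' assume "(b', c') \<in> f ` P0"
    then obtain c0' where m': "(b', c0') \<in> P0" "c' = max c0' \<gamma>" unfolding f_def by auto
    show "(b, c) = (b', c') \<or> b < c' \<or> b' < c"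
      using P0(3)[OF m(1) m'(1)] m m' by (auto simp: max_def)
  next
    fix x assume "x \<in> M" "\<gamma> < x"
    then have "\<exists>(b, c)\<in>P0. c < x \<and> x \<le> b" using P0(4) unfolding B_def by auto
    then show "\<exists>(b, c)\<in>f ` P0. c < x \<and> x \<le> b" using \<open>\<gamma> < x\<close> unfolding f_def by force
  qed
qed

lemma rim_moves_subset:
  assumes P: "rim_moves e M \<gamma> P" and Q: "rim_moves e M \<gamma> Q"
    and agree: "\<And>b c. b > u \<Longrightarrow> (b, c) \<in> P \<longleftrightarrow> (b, c) \<in> Q"
    and u: "(u, c) \<in> P"
  shows "(u, c) \<in> Q"
proof -
  note D = rim_movesD[OF P u]
  have "u > \<gamma>" using D by simp
  obtain b' c' where Q': "(b', c') \<in> Q" "c' < u" "u \<le> b'"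
    using rim_moves_cover[OF Q D(3) \<open>u > \<gamma>\<close>] .
  have "b' = u"
  proof (rule ccontr)
    assume "b' \<noteq> u"
    then have "(b', c') \<in> P" using Q' agree by auto
    then show False using rim_moves_meet(1)[OF P u, of b' c' u] Q' D(2) \<open>b' \<noteq> u\<close> by auto
  qed
  note D' = rim_movesD[OF Q Q'(1)[unfolded this]]
  have "c = c'"
  proof (rule ccontr)
    assume "c \<noteq> c'"
    have *: False if c: "\<gamma> \<le> c" "c \<notin> M" "int e dvd u - c \<or> c = \<gamma>" "c < u" and c': "c' < u" "\<gamma> \<le> c'"
        "c' \<notin> M" "int e dvd u - c' \<or> c' = \<gamma>"
        "\<And>x. c' < x \<Longrightarrow> x < u \<Longrightarrow> int e dvd u - x \<Longrightarrow> x \<in> M" "c' < c"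
      for c c'
      using that by (metis leD)
    show False using *[of c c'] *[of c' c] D D' \<open>c \<noteq> c'\<close> by (metis linorder_neqE)
  qed
  then show ?thesis using Q' \<open>b' = u\<close> by simp
qed

text \<open>Look at the highest bead at which two sets of moves differ. It lies in an interval of either
  set, and both intervals have to end at the first gap on its runner, or at \<open>\<gamma>\<close>.\<close>

lemma rim_moves_unique:
  assumes P: "rim_moves e M \<gamma> P" and Q: "rim_moves e M \<gamma> Q"
  shows "P = Q"
proof (rule ccontr)
  assume "P \<noteq> Q"
  define D where "D = fst ` (P - Q \<union> (Q - P))"
  have "finite D" "D \<noteq> {}" unfolding D_def using \<open>P \<noteq> Q\<close> rim_moves_finite[OF P] rim_moves_finite[OF Q] by auto
  then have u: "Max D \<in> D" "\<And>b. b > Max D \<Longrightarrow> b \<notin> D" by (auto simp: leD)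
  have agree: "(b, c) \<in> P \<longleftrightarrow> (b, c) \<in> Q" if "b > Max D" for b c
    using u(2)[OF that] unfolding D_def by force
  obtain c where "(Max D, c) \<in> P - Q \<union> (Q - P)" using u(1) unfolding D_def by force
  then show False
    using rim_moves_subset[OF P Q agree] rim_moves_subset[OF Q P agree[symmetric]] by blast
qed

lemma shift_mult:
  fixes f :: "int \<Rightarrow> int"
  assumes "\<And>x. f (x + int e) = f x + w"
  shows "f (x + int e * int m) = f x + w * int m"
proof (induction m)
  case (Suc m)
  have "f (x + int e * int (Suc m)) = f ((x + int e * int m) + int e)" by (simp add: algebra_simps)
  also have "\<dots> = f x + w * int (Suc m)" unfolding assms Suc by (simp add: algebra_simps)
  finally show ?case .
qed simp

text \<open>Along moves that stay on their runner, a function with constant increment \<open>w\<close> per \<open>e\<close> steps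
  changes in proportion to the distance.\<close>

lemma sum_dvd_moves:
  fixes f :: "int \<Rightarrow> int"
  assumes "finite P" "\<And>b c. (b, c) \<in> P \<Longrightarrow> c < b \<and> int e dvd b - c"
    and f: "\<And>x. f (x + int e) = f x + w"
  shows "\<exists>m. (\<Sum>(b, c)\<in>P. b - c) = int e * int m \<and> (\<Sum>(b, c)\<in>P. f b - f c) = w * int m"
proof -
  show ?thesis using assms(1,2)
  proof (induction P rule: finite_induct)
    case empty
    then show ?case by (intro exI[of _ 0]) simp
  next
    case (insert p P)
    obtain b c where p: "p = (b, c)" by force
    obtain m where m: "(\<Sum>(b, c)\<in>P. b - c) = int e * int m" "(\<Sum>(b, c)\<in>P. f b - f c) = w * int m"
      using insert by blast
    have bc: "c < b" "int e dvd b - c" using insert(4) p by auto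
    then obtain k where k: "b - c = int e * k" by blast
    then have "0 \<le> k" using bc(1) by (metis diff_gt_0_iff_gt linorder_not_le mult_nonneg_nonpos of_nat_0_le_iff order_less_imp_le)
    then have b: "b = c + int e * int (nat k)" using k by simp
    have "f b - f c = w * int (nat k)" unfolding b using shift_mult[of f e w c "nat k", OF f] by linarith
    moreover have "b - c = int e * int (nat k)" using b by simp
    ultimately show ?case using insert(1,2) m
      by (intro exI[of _ "m + nat k"]) (simp add: p algebra_simps)
  qed
qed

lemma rim_closed_sum:
  fixes f :: "int \<Rightarrow> int"
  assumes P: "rim_moves e M \<gamma> P" and closed: "\<And>b c. (b, c) \<in> P \<Longrightarrow> int e dvd b - c"
  shows "int e dvd rim_length P"
    and "(\<And>x. f (x + int e) = f x + w) \<Longrightarrow> (\<Sum>(b, c)\<in>P. f b - f c) = f (x + rim_length P) - f x"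
proof -
  have *: "\<And>b c. (b, c) \<in> P \<Longrightarrow> c < b \<and> int e dvd b - c" using closed rim_movesD(2)[OF P] by blast
  show "int e dvd rim_length P"
    using sum_dvd_moves[OF rim_moves_finite[OF P] *, of "\<lambda>x. x" "int e"] unfolding rim_length_def by auto
  assume f: "\<And>x. f (x + int e) = f x + w"
  obtain m where m: "rim_length P = int e * int m" "(\<Sum>(b, c)\<in>P. f b - f c) = w * int m"
    using sum_dvd_moves[OF rim_moves_finite[OF P] *, of f w] f unfolding rim_length_def by blast
  then show "(\<Sum>(b, c)\<in>P. f b - f c) = f (x + rim_length P) - f x"
    using m shift_mult[of f, OF f] by simp
qed

lemma rim_cut_sum:
  fixes f :: "int \<Rightarrow> int"
  assumes P: "rim_moves e M \<gamma> P" and b0: "(b0, \<gamma>) \<in> P" "\<not> int e dvd b0 - \<gamma>"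
  shows "int e dvd \<gamma> + rim_length P - b0" "\<not> int e dvd rim_length P"
    and "(\<And>x. f (x + int e) = f x + w) \<Longrightarrow> (\<Sum>(b, c)\<in>P. f b - f c) = f (\<gamma> + rim_length P) - f \<gamma>"
proof -
  let ?P = "P - {(b0, \<gamma>)}"
  have fin: "finite ?P" using rim_moves_finite[OF P] by simp
  have "int e dvd b - c" if "(b, c) \<in> ?P" for b c
    using rim_movesD(5)[OF P, of b c] rim_moves_snd_inj[OF P, of b0 \<gamma> b] b0 that by auto
  then have *: "\<And>b c. (b, c) \<in> ?P \<Longrightarrow> c < b \<and> int e dvd b - c" using rim_movesD(2)[OF P] by blast
  have sum: "(\<Sum>(b, c)\<in>P. g b - g c) = (g b0 - g \<gamma>) + (\<Sum>(b, c)\<in>?P. g b - g c)" for g :: "int \<Rightarrow> int"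
    using sum.remove[OF rim_moves_finite[OF P] b0(1), of "\<lambda>(b, c). g b - g c"] by simp
  have len: "rim_length P = (b0 - \<gamma>) + (\<Sum>(b, c)\<in>?P. b - c)"
    using sum[of "\<lambda>x. x"] unfolding rim_length_def .
  show d: "int e dvd \<gamma> + rim_length P - b0"
    using sum_dvd_moves[OF fin *, of "\<lambda>x. x" "int e"] len by auto
  show "\<not> int e dvd rim_length P"
  proof
    assume "int e dvd rim_length P"
    then have "int e dvd rim_length P - (\<gamma> + rim_length P - b0)" using d dvd_diff by blast
    then show False using b0(2) by simp
  qed
  assume f: "\<And>x. f (x + int e) = f x + w"
  obtain m where m: "(\<Sum>(b, c)\<in>?P. b - c) = int e * int m" "(\<Sum>(b, c)\<in>?P. f b - f c) = w * int m"
    using sum_dvd_moves[OF fin *, of f w] f by blast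
  have "\<gamma> + rim_length P = b0 + int e * int m" using len m(1) by simp
  then have "f (\<gamma> + rim_length P) = f b0 + w * int m" using shift_mult[of f, OF f] by simp
  then show "(\<Sum>(b, c)\<in>P. f b - f c) = f (\<gamma> + rim_length P) - f \<gamma>" using sum[of f] m(2) by simp
qed

text \<open>Whether \<open>e\<close> divides the size of the rim tells which of the two endings of the sequence
  occurs: at most one move changes runners, namely one that ends at \<open>\<gamma>\<close>.\<close>

lemma rim_length_dvd_iff:
  assumes "rim_moves e M \<gamma> P"
  shows "int e dvd rim_length P \<longleftrightarrow> (\<forall>b c. (b, c) \<in> P \<longrightarrow> int e dvd b - c)"
  using rim_closed_sum(1)[OF assms] rim_cut_sum(2)[OF assms] rim_movesD(5)[OF assms] by metis

lemma rim_not_dvdE: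
  assumes "rim_moves e M \<gamma> P" "\<not> int e dvd rim_length P"
  obtains b0 where "(b0, \<gamma>) \<in> P" "\<not> int e dvd b0 - \<gamma>" "int e dvd \<gamma> + rim_length P - b0"
  using assms rim_length_dvd_iff[OF assms(1)] rim_movesD(5)[OF assms(1)] rim_cut_sum(1)[OF assms(1)] by metis

text \<open>For functions with constant increment per \<open>e\<close> steps the whole rim acts like the single move
  from \<open>\<gamma> + rim_length P\<close> to \<open>\<gamma>\<close>.\<close>

lemma rim_sum:
  fixes f :: "int \<Rightarrow> int"
  assumes P: "rim_moves e M \<gamma> P" and f: "\<And>x. f (x + int e) = f x + w"
  shows "(\<Sum>(b, c)\<in>P. f b - f c) = f (\<gamma> + rim_length P) - f \<gamma>"
proof (cases "int e dvd rim_length P")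
  case True
  show ?thesis by (rule rim_closed_sum(2)[OF P]) (use True rim_length_dvd_iff[OF P] f in blast)+
next
  case False
  obtain b0 where b0: "(b0, \<gamma>) \<in> P" "\<not> int e dvd b0 - \<gamma>" using rim_not_dvdE[OF P False] .
  show ?thesis by (rule rim_cut_sum(3)[OF P b0]) (rule f)
qed

section \<open>Sequences of moves and sets of moves\<close>

text \<open>The middle inequality alone would not be transitive; the outer two make it so.\<close>

definition descends :: "nat \<times> nat \<Rightarrow> nat \<times> nat \<Rightarrow> bool" where
  "descends p q \<longleftrightarrow> snd p < fst p \<and> fst q < snd p \<and> snd q < fst q"

definition shift :: "nat \<Rightarrow> nat \<times> nat \<Rightarrow> int \<times> int" where
  "shift r = (\<lambda>(b, c). (int b - int r, int c - int r))"

lemma inj_shift: "inj (shift r)"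
  unfolding shift_def by (auto simp: inj_on_def)

lemma descends_transp: "transp descends"
  unfolding descends_def by (rule transpI) auto

lemma sorted_wrt_set_unique:
  assumes asym: "\<And>x y. R x y \<Longrightarrow> \<not> R y x"
  shows "sorted_wrt R xs \<Longrightarrow> sorted_wrt R ys \<Longrightarrow> set xs = set ys \<Longrightarrow> xs = ys"
proof (induction xs arbitrary: ys)
  case (Cons x xs)
  then obtain y ys' where ys: "ys = y # ys'" by (cases ys) auto
  have xy: "x = y"
  proof (rule ccontr)
    assume "x \<noteq> y"
    then have "y \<in> set xs" "x \<in> set ys'" using Cons(4) ys by auto
    then show False using Cons(2,3) ys asym[of x y] by auto
  qed
  have "x \<notin> set xs" "x \<notin> set ys'" using Cons(2,3) ys xy asym[of x x] by auto
  then have "set xs = set ys'" using Cons(4) ys xy by auto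
  then show ?case using Cons ys xy by auto
qed simp

lemma distinct_sorted_wrt:
  assumes "\<And>x. \<not> R x x"
  shows "sorted_wrt R xs \<Longrightarrow> distinct xs"
  using assms by (induction xs) auto

lemma dvd_iff_mod_eq: "int e dvd int b - int c \<longleftrightarrow> b mod e = c mod e"
  by (metis mod_eq_dvd_iff of_nat_eq_iff zmod_int)

lemma zero_gap_beta_set:
  assumes p: "is_partition p"
  shows "0 \<notin> beta_set (num_parts p) p"
  using beta_set_iff_maya[OF p order_refl, of 0] first_gap_maya[OF p] unfolding first_gap_def by simp

text \<open>The gap conditions give the covering property: a bead above \<open>\<gamma>\<close> belongs to the interval of
  the last \<open>b\<^sub>i\<close> that is not below it.\<close>

lemma is_rim_seq_rim_moves:
  assumes p: "is_partition p" and r: "r = num_parts p" and seq: "is_rim_seq e (beta_set r p) ps"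
  shows "ps \<noteq> []" "sorted_wrt descends ps" "rim_moves e (maya p) (- int r) (shift r ` set ps)"
proof -
  let ?A = "beta_set r p"
  define b c where "b i = fst (ps ! i)" and "c i = snd (ps ! i)" for i
  define t where "t = length ps"
  have A: "n \<in> ?A \<longleftrightarrow> int n - int r \<in> maya p" for n
    using beta_set_iff_maya[OF p, of r] r by simp
  have g: "(LEAST x. x \<notin> ?A) = 0" using zero_gap_beta_set[OF p] r by (simp add: Least_eq_0)
  note seq' = seq[unfolded is_rim_seq_def Let_def g, folded b_def c_def t_def]
  note t = seq'[THEN conjunct1]
  note rest1 = seq'[THEN conjunct2]
  note cb = rest1[THEN conjunct1, rule_format]
  note rest2 = rest1[THEN conjunct2]
  note bc = rest2[THEN conjunct1, rule_format]
  note rest3 = rest2[THEN conjunct2]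
  note occ = rest3[THEN conjunct1, rule_format, THEN conjunct1]
    and emp = rest3[THEN conjunct1, rule_format, THEN conjunct2]
  note rest4 = rest3[THEN conjunct2]
  note top = rest4[THEN conjunct1]
  note rest5 = rest4[THEN conjunct2, THEN conjunct1, rule_format]
    and last = rest4[THEN conjunct2, THEN conjunct2]
  have cont: "b i mod e = c i mod e" if "Suc i < t" for i
    using rest5[OF that] by blast
  have run: "x \<in> ?A" if "Suc i < t" "c i < x" "x < b i" "x mod e = b i mod e" for i x
    using rest5[OF that(1)] that by blast
  have gaps: "x \<notin> ?A" if "Suc i < t" "b (Suc i) < x" "x < c i" for i x
    using rest5[OF that(1)] that by blast
  show "ps \<noteq> []" using t t_def by auto
  show srt: "sorted_wrt descends ps"
    unfolding sorted_wrt_iff_nth_Suc_transp[OF descends_transp] descends_def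
    using cb bc unfolding b_def c_def t_def by auto
  have ord: "b j < c i" if "i < j" "j < t" for i j
    using sorted_wrt_nth_less[OF srt that(1)] that(2) unfolding descends_def b_def c_def t_def by simp
  have nth: "\<exists>i<t. b' = int (b i) - int r \<and> c' = int (c i) - int r" if m: "(b', c') \<in> shift r ` set ps" for b' c'
  proof -
    obtain q where q: "q \<in> set ps" "(b', c') = shift r q" using m by blast
    then obtain i where "i < t" "ps ! i = q" unfolding t_def by (auto simp: in_set_conv_nth)
    then show ?thesis using q(2) unfolding shift_def b_def c_def by (auto simp: split_beta)
  qed
  have mem: "(int (b i) - int r, int (c i) - int r) \<in> shift r ` set ps" if "i < t" for i
    using that unfolding shift_def b_def c_def t_def by (intro image_eqI[of _ _ "ps ! i"]) (auto simp: split_beta)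
  have type: "b i mod e = c i mod e \<or> c i = 0" if "i < t" for i
  proof (cases "Suc i < t")
    case False
    then have i: "i = t - 1" using that by simp
    show ?thesis unfolding i using last by (elim disjE conjE) simp_all
  qed (use cont in blast)
  have run': "x \<in> ?A" if "i < t" "c i < x" "x < b i" "x mod e = b i mod e" for i x
  proof (cases "Suc i < t")
    case False
    then have "i = t - 1" using that by simp
    then show ?thesis using last that by blast
  qed (use run that in blast)
  show "rim_moves e (maya p) (- int r) (shift r ` set ps)"
    unfolding rim_moves_def
  proof (intro conjI allI impI ballI)
    show "finite (shift r ` set ps)" by simp
    fix b' c' assume m: "(b', c') \<in> shift r ` set ps"
    then obtain i where i: "i < t" "b' = int (b i) - int r" "c' = int (c i) - int r" using nth by blast
    show "- int r \<le> c'" "c' < b'" using i cb by auto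
    show "b' \<in> maya p" "c' \<notin> maya p" using i occ emp A by auto
    show "int e dvd b' - c' \<or> c' = - int r"
      using type[OF i(1)] dvd_iff_mod_eq[of e "b i" "c i"] i by auto
    show "x \<in> maya p" if x: "c' < x \<and> x < b' \<and> int e dvd b' - x" for x
    proof -
      define n where "n = nat (x + int r)"
      have n: "x = int n - int r" unfolding n_def using x i by simp
      have "b' - x = int (b i) - int n" using n i(2) by simp
      then have "b i mod e = n mod e" using dvd_iff_mod_eq[of e "b i" n] x by simp
      then show ?thesis using run'[OF i(1), of n] x i n A[of n] by auto
    qed
    fix b'' c'' assume "(b'', c'') \<in> shift r ` set ps"
    then obtain j where j: "j < t" "b'' = int (b j) - int r" "c'' = int (c j) - int r" using nth by blast
    show "(b', c') = (b'', c'') \<or> b' < c'' \<or> b'' < c'"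
      using ord[of i j] ord[of j i] i j by (cases i j rule: linorder_cases) auto
  next
    fix x assume x: "x \<in> maya p" "- int r < x"
    define n where "n = nat (x + int r)"
    have n: "x = int n - int r" "0 < n" unfolding n_def using x by auto
    then have nA: "n \<in> ?A" using A x by simp
    have "finite ?A" unfolding beta_set_def by simp
    then have "n \<le> b 0" using nA top by simp
    define i where "i = Max {i. i < t \<and> n \<le> b i}"
    have fin: "finite {i. i < t \<and> n \<le> b i}" by simp
    have ne: "{i. i < t \<and> n \<le> b i} \<noteq> {}" using \<open>n \<le> b 0\<close> t by (auto intro!: exI[of _ 0])
    have i: "i < t" "n \<le> b i" using Max_in[OF fin ne] unfolding i_def by auto
    have i': "\<not> n \<le> b j" if "i < j" "j < t" for j
    proof
      assume "n \<le> b j"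
      then have "j \<le> i" using Max_ge[OF fin, of j] that(2) unfolding i_def by simp
      then show False using that(1) by simp
    qed
    have "c i < n"
    proof (rule ccontr)
      assume "\<not> c i < n"
      then have "n < c i" using nA emp[OF i(1)] by (cases "n = c i") auto
      show False
      proof (cases "Suc i < t")
        case True
        then show False using gaps[OF True, of n] i'[of "Suc i"] nA \<open>n < c i\<close> by simp
      next
        case False
        then have "i = t - 1" using i by simp
        then show False using last \<open>n < c i\<close> nA by auto
      qed
    qed
    then show "\<exists>(b', c')\<in>shift r ` set ps. c' < x \<and> x \<le> b'"
      using mem[OF i(1)] i n by (intro bexI[OF _ mem[OF i(1)]]) auto
  qed
qed

text \<open>Conversely, a position between consecutive intervals is covered by none of them and is
  therefore a gap.\<close>

lemma rim_moves_is_rim_seq: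
  assumes p: "is_partition p" and r: "r = num_parts p" and ne: "ps \<noteq> []"
    and srt: "sorted_wrt descends ps" and P: "rim_moves e (maya p) (- int r) (shift r ` set ps)"
  shows "is_rim_seq e (beta_set r p) ps"
proof -
  let ?A = "beta_set r p"
  define b c where "b i = fst (ps ! i)" and "c i = snd (ps ! i)" for i
  define t where "t = length ps"
  have A: "n \<in> ?A \<longleftrightarrow> int n - int r \<in> maya p" for n
    using beta_set_iff_maya[OF p, of r] r by simp
  have g: "(LEAST x. x \<notin> ?A) = 0" using zero_gap_beta_set[OF p] r by (simp add: Least_eq_0)
  have z: "0 \<notin> ?A" using zero_gap_beta_set[OF p] r by simp
  have t: "1 \<le> t" using ne unfolding t_def by (cases ps) auto
  have ord: "b j < c i" if "i < j" "j < t" for i j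
    using sorted_wrt_nth_less[OF srt that(1)] that(2) unfolding descends_def b_def c_def t_def by simp
  have mem: "(int (b i) - int r, int (c i) - int r) \<in> shift r ` set ps" if "i < t" for i
    using that unfolding shift_def b_def c_def t_def by (intro image_eqI[of _ _ "ps ! i"]) (auto simp: split_beta)
  note D = rim_movesD[OF P mem]
  have cb: "c i < b i" if "i < t" for i using D(2)[OF that] by simp
  have occ: "b i \<in> ?A" "c i \<notin> ?A" if "i < t" for i using D(3,4)[OF that] A by auto
  have type: "b i mod e = c i mod e \<or> c i = 0" if "i < t" for i
    using D(5)[OF that] dvd_iff_mod_eq[of e "b i" "c i"] by auto
  have run: "x \<in> ?A" if "i < t" "c i < x" "x < b i" "x mod e = b i mod e" for i x
    using D(6)[OF that(1), of "int x - int r"] dvd_iff_mod_eq[of e "b i" x] that A by auto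
  have cover: "\<exists>i<t. c i < n \<and> n \<le> b i" if "n \<in> ?A" for n
  proof -
    have "0 < n" using z that by (cases n) auto
    then have "- int r < int n - int r" "int n - int r \<in> maya p" using A that by auto
    from rim_moves_cover[OF P this(2,1)] obtain b' c' where
      bc: "(b', c') \<in> shift r ` set ps" "c' < int n - int r" "int n - int r \<le> b'" .
    obtain q where q: "q \<in> set ps" "(b', c') = shift r q" using bc(1) by blast
    then obtain i where "i < t" "ps ! i = q" unfolding t_def by (auto simp: in_set_conv_nth)
    then show ?thesis using q(2) bc(2,3) unfolding shift_def b_def c_def
      by (intro exI[of _ i]) (auto simp: split_beta)
  qed
  have le_b0: "b i \<le> b 0" if "i < t" for i
    using ord[of 0 i] cb[of 0] that t by (cases i) auto
  have top: "b 0 = Max ?A"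
  proof (rule Max_eqI[symmetric])
    show "finite ?A" unfolding beta_set_def by simp
    show "b 0 \<in> ?A" using occ t by simp
    show "n \<le> b 0" if "n \<in> ?A" for n using cover[OF that] le_b0 by fastforce
  qed
  have gaps: "x \<notin> ?A" if "x < c i" "i < t" "\<And>j. i < j \<Longrightarrow> j < t \<Longrightarrow> b j < x" for i x
  proof
    assume "x \<in> ?A"
    then obtain j where j: "j < t" "c j < x" "x \<le> b j" using cover by blast
    have "\<not> i < j" using that(3)[of j] j by auto
    then have "i = j \<or> j < i" by auto
    then show False using ord[of j i] cb[of i] j that(1,2) by auto
  qed
  have gaps_Suc: "x \<notin> ?A" if i: "Suc i < t" "b (Suc i) < x" "x < c i" for i x
  proof (rule gaps[OF i(3)])
    fix j assume "i < j" "j < t"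
    then show "b j < x" using ord[of "Suc i" j] cb[of "Suc i"] i by (cases "j = Suc i") auto
  qed (use i in simp)
  have type_Suc: "b i mod e = c i mod e" if "Suc i < t" for i
    using type[of i] ord[of i "Suc i"] that by auto
  have last: "(b (t - 1) mod e = c (t - 1) mod e \<and>
          (\<forall>x. c (t - 1) < x \<and> x < b (t - 1) \<and> x mod e = b (t - 1) mod e \<longrightarrow> x \<in> ?A) \<and>
          (\<forall>x. 0 \<le> x \<and> x < c (t - 1) \<longrightarrow> x \<notin> ?A)) \<or>
         ((\<forall>x. x < b (t - 1) \<and> x mod e = b (t - 1) mod e \<longrightarrow> x \<in> ?A) \<and> c (t - 1) = 0)"
  proof (cases "b (t - 1) mod e = c (t - 1) mod e")
    case True
    then show ?thesis using run[of "t - 1"] gaps[of _ "t - 1"] t by auto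
  next
    case False
    then have c0: "c (t - 1) = 0" using type[of "t - 1"] t by auto
    have "x \<in> ?A" if "x < b (t - 1)" "x mod e = b (t - 1) mod e" for x
      using run[of "t - 1" x] that c0 False t by (cases "x = 0") auto
    then show ?thesis using c0 by blast
  qed
  show ?thesis unfolding is_rim_seq_def Let_def g
    unfolding b_def[symmetric] c_def[symmetric] t_def[symmetric]
  proof (intro conjI)
    show "1 \<le> t" by (rule t)
    show "\<forall>i<t. c i < b i" using cb by blast
    show "\<forall>i. Suc i < t \<longrightarrow> b (Suc i) < c i" using ord by blast
    show "\<forall>i<t. b i \<in> ?A \<and> c i \<notin> ?A" using occ by blast
    show "b 0 = Max ?A" by (rule top)
    show "\<forall>i. Suc i < t \<longrightarrow> b i mod e = c i mod e \<and>
      (\<forall>x. c i < x \<and> x < b i \<and> x mod e = b i mod e \<longrightarrow> x \<in> ?A) \<and>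
      (\<forall>x. b (Suc i) < x \<and> x < c i \<longrightarrow> x \<notin> ?A)"
      using type_Suc run gaps_Suc Suc_lessD by blast
  qed (rule last)
qed

lemma descending_list_of_set:
  fixes P :: "(nat \<times> nat) set"
  assumes "finite P" "\<And>b c. (b, c) \<in> P \<Longrightarrow> c < b"
    "\<And>b c b' c'. (b, c) \<in> P \<Longrightarrow> (b', c') \<in> P \<Longrightarrow> (b, c) = (b', c') \<or> b < c' \<or> b' < c"
  shows "\<exists>ps. sorted_wrt descends ps \<and> set ps = P"
  using assms
proof (induction "card P" arbitrary: P)
  case 0
  then show ?case by (intro exI[of _ "[]"]) simp
next
  case (Suc n)
  have fin: "finite (fst ` P)" "fst ` P \<noteq> {}" using Suc(2,3) by auto
  obtain b c where bc: "(b, c) \<in> P" "b = Max (fst ` P)" using Max_in[OF fin] by force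
  have max: "b' \<le> b" if "(b', c') \<in> P" for b' c' using Max_ge[OF fin(1), of b'] that bc by force
  have "\<exists>ps. sorted_wrt descends ps \<and> set ps = P - {(b, c)}"
  proof (rule Suc(1))
    show "n = card (P - {(b, c)})" using Suc(2,3) bc(1) by simp
    show "finite (P - {(b, c)})" using Suc(3) by simp
    show "c < b" if "(b, c) \<in> P - {(b', c')}" for b c b' c' using Suc(4) that by blast
    show "(b', c') = (b'', c'') \<or> b' < c'' \<or> b'' < c'"
      if "(b', c') \<in> P - {(b, c)}" "(b'', c'') \<in> P - {(b, c)}" for b' c' b'' c''
      using Suc(5)[of b' c' b'' c''] that by blast
  qed
  then obtain ps where ps: "sorted_wrt descends ps" "set ps = P - {(b, c)}" by blast
  have "descends (b, c) (b', c')" if "(b', c') \<in> set ps" for b' c'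
    using Suc(4)[OF bc(1)] Suc(4)[of b' c'] Suc(5)[OF bc(1), of b' c'] max[of b' c'] that ps(2)
    unfolding descends_def by auto
  then have "sorted_wrt descends ((b, c) # ps)" using ps(1) by auto
  moreover have "set ((b, c) # ps) = P" using ps(2) bc(1) by auto
  ultimately show ?case by blast
qed

lemma partition_empty_iff: "is_partition p \<Longrightarrow> p = empty_partition \<longleftrightarrow> num_parts p = 0"
  using num_parts_le_iff[of p 0] unfolding empty_partition_def by (auto simp: fun_eq_iff)

lemma bead_above_first_gap:
  assumes p: "is_partition p" "p \<noteq> empty_partition"
  obtains x where "x \<in> maya p" "- int (num_parts p) < x"
proof -
  have "0 < num_parts p" using partition_empty_iff p by blast
  then have "0 < p 0" using num_parts_greater_iff[OF p(1)] by blast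
  then have "int (p 0) - int 0 - 1 \<in> maya p" "- int (num_parts p) < int (p 0) - int 0 - 1"
    using \<open>0 < num_parts p\<close> unfolding maya_def by (blast, simp)
  then show thesis using that by blast
qed

lemma rim_moves_maya_exists:
  assumes "is_partition p" "1 \<le> e"
  shows "\<exists>P. rim_moves e (maya p) (- int (num_parts p)) P"
proof (rule rim_moves_exists[OF first_gap_maya[OF assms(1)] _ assms(2)])
  show "finite {x \<in> maya p. - int (num_parts p) < x}"
    using finite_maya_above[OF assms(1), of "- int (num_parts p)"] by (rule finite_subset[rotated]) auto
qed

lemma card_moved:
  assumes "rim_moves e M \<gamma> P"
  shows "card (fst ` P) = card (snd ` P)"
  using card_image[OF inj_on_fst_rim_moves[OF assms]] card_image[OF inj_on_snd_rim_moves[OF assms]] by simp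

text \<open>Uniqueness of the move set determines the sequence of moves, and so evaluates the
  descriptions by which the sequence and \<open>triangle\<close> are defined.\<close>

lemma rim_triangle:
  assumes p: "is_partition p" "p \<noteq> empty_partition" and e: "1 \<le> e"
    and P: "rim_moves e (maya p) (- int (num_parts p)) P"
  shows "int (rim e p) = rim_length P" "is_partition (triangle e p)" "maya (triangle e p) = moved (maya p) P"
proof -
  define r where "r = num_parts p"
  have P': "rim_moves e (maya p) (- int r) P" using P r_def by simp
  let ?A = "beta_set r p"
  define Q where "Q = shift r -` P"
  have "x \<in> range (shift r)" if "x \<in> P" for x
  proof -
    obtain b c where x: "x = (b, c)" by force
    have "- int r \<le> c" "c < b" using rim_movesD(1,2)[OF P'] that x by auto
    then have "x = shift r (nat (b + int r), nat (c + int r))" using x unfolding shift_def by simp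
    then show ?thesis by blast
  qed
  then have im: "shift r ` Q = P" unfolding Q_def by auto
  have finQ: "finite Q" unfolding Q_def by (rule finite_vimageI[OF rim_moves_finite[OF P'] inj_shift])
  have Qm: "(int b - int r, int c - int r) \<in> P" if "(b, c) \<in> Q" for b c
    using that unfolding Q_def shift_def by simp
  obtain ps where ps: "sorted_wrt descends ps" "set ps = Q"
    using descending_list_of_set[OF finQ] rim_movesD(2)[OF P' Qm] rim_moves_disjoint[OF P' Qm Qm] by force
  obtain x where "x \<in> maya p" "- int r < x" using bead_above_first_gap[OF p] r_def by blast
  then have "P \<noteq> {}" using rim_moves_cover[OF P'] by blast
  then have "ps \<noteq> []" using im ps(2) by auto
  then have seq: "is_rim_seq e ?A ps"
    by (rule rim_moves_is_rim_seq[OF p(1) r_def]) (use ps im P' in auto)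
  have uniq: "qs = ps" if "is_rim_seq e ?A qs" for qs
  proof -
    note s = is_rim_seq_rim_moves[OF p(1) r_def that]
    have "shift r ` set qs = P"
      by (rule rim_moves_unique[OF s(3) P'])
    then have "set qs = set ps" using im ps(2) inj_image_eq_iff[OF inj_shift] by metis
    then show ?thesis
      by (intro sorted_wrt_set_unique[of descends, OF _ s(2) ps(1)]) (auto simp: descends_def)
  qed
  have rs: "rim_seq e p = ps" unfolding rim_seq_def r_def[symmetric] using seq uniq by (rule the_equality)
  have dist: "distinct ps"
    by (rule distinct_sorted_wrt[OF _ ps(1)]) (auto simp: descends_def)
  have "int (rim e p) = (\<Sum>(b, c)\<in>Q. int (b - c))"
    unfolding rim_def rs using sum_list_distinct_conv_sum_set[OF dist, of "\<lambda>(b, c). b - c"] ps(2)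
    by (simp add: split_beta)
  also have "\<dots> = (\<Sum>(b, c)\<in>Q. (int b - int r) - (int c - int r))"
    by (rule sum.cong) (use rim_movesD(2)[OF P' Qm] in force)+
  also have "\<dots> = (\<Sum>x\<in>shift r ` Q. fst x - snd x)"
    by (subst sum.reindex[OF inj_on_subset[OF inj_shift]]) (auto simp: shift_def split_beta)
  finally show "int (rim e p) = rim_length P" unfolding rim_length_def im by (simp add: split_beta)
  obtain q where q: "is_partition q" "maya q = moved (maya p) P"
  proof (rule partition_of_moved_maya[OF p(1), of "fst ` P" "snd ` P"])
    show "finite (fst ` P)" "finite (snd ` P)" using rim_moves_finite[OF P'] by auto
    show "fst ` P \<subseteq> maya p" "snd ` P \<inter> maya p = {}" using rim_movesD(3,4)[OF P'] by auto
    show "card (fst ` P) = card (snd ` P)" by (rule card_moved[OF P'])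
  qed (use moved_def in auto)
  have "- int r \<le> - int (num_parts q)"
  proof (rule ccontr)
    assume "\<not> ?thesis"
    then have "- int (num_parts q) \<in> maya q"
      using moved_below[OF P', of "- int (num_parts q)"] q(2) first_gap_maya[OF p(1)]
      unfolding first_gap_def r_def by auto
    then show False using first_gap_maya[OF q(1)] unfolding first_gap_def by blast
  qed
  then have qr: "num_parts q \<le> r" by simp
  have inj: "inj (\<lambda>n. int n - int r)" by (simp add: inj_def)
  have projections: "fst ` P = (\<lambda>n. int n - int r) ` fst ` Q" "snd ` P = (\<lambda>n. int n - int r) ` snd ` Q"
    by (simp_all add: im[symmetric] image_image shift_def split_beta)
  have beta: "beta_set r q = ?A - fst ` set ps \<union> snd ` set ps"
  proof (rule set_eqI)
    fix n
    have "n \<in> fst ` Q \<longleftrightarrow> int n - int r \<in> fst ` P" "n \<in> snd ` Q \<longleftrightarrow> int n - int r \<in> snd ` P"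
      unfolding projections by (simp_all only: inj_image_mem_iff[OF inj])
    then show "n \<in> beta_set r q \<longleftrightarrow> n \<in> ?A - fst ` set ps \<union> snd ` set ps"
      using beta_set_iff_maya[OF q(1) qr, of n] beta_set_iff_maya[OF p(1), of r n] r_def q(2) ps(2)
      unfolding moved_def by simp
  qed
  have "triangle e p = q" unfolding triangle_def Let_def rs r_def[symmetric]
  proof (rule the_equality)
    show "is_partition q \<and> num_parts q \<le> r \<and> beta_set r q = ?A - fst ` set ps \<union> snd ` set ps"
      using q(1) qr beta by blast
    fix q' assume q': "is_partition q' \<and> num_parts q' \<le> r \<and>
      beta_set r q' = ?A - fst ` set ps \<union> snd ` set ps"
    show "q' = q" by (rule beta_set_inj[OF _ q(1) _ qr]) (use q' beta in simp_all)
  qed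
  then show "is_partition (triangle e p)" "maya (triangle e p) = moved (maya p) P" using q by auto
qed

section \<open>How one step changes the first gap and the rim\<close>

text \<open>The number written \<open>\<epsilon>\<close> in the combinatorics of Mullineux symbols: 1 if the rim ends with a
  change of runner, and 0 otherwise.\<close>

definition excess :: "nat \<Rightarrow> int \<Rightarrow> int" where
  "excess e a = (if int e dvd a then 0 else 1)"

text \<open>If \<open>\<gamma> = - num_parts \<mu>\<close>, this is one less than the number of parts prescribed for the
  Mullineux image of \<open>\<mu>\<close>, and hence the position of the last bead of the conjugate of that image.\<close>

definition rim_end :: "nat \<Rightarrow> int \<Rightarrow> (int \<times> int) set \<Rightarrow> int" where
  "rim_end e \<gamma> P = \<gamma> + rim_length P + excess e (rim_length P) - 1"

lemma first_gap_moved_ge: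
  assumes "first_gap M \<gamma>" "rim_moves e M \<gamma> P" "first_gap (moved M P) \<gamma>1"
  shows "\<gamma> \<le> \<gamma>1"
  using assms(1,3) moved_below[OF assms(2), of \<gamma>1] unfolding first_gap_def by (meson linorder_not_le)

text \<open>A run of \<open>e\<close> beads that appears above the new first gap contains a filled gap \<open>c\<close>. The
  positions just below \<open>c\<close> are empty, so the run starts at \<open>c\<close>; and the next position \<open>c + e\<close> of
  its runner was occupied before the move, so \<open>e\<close> consecutive beads started at \<open>c + 1\<close> already.\<close>

lemma moved_run_free:
  assumes fg: "first_gap M \<gamma>" and P: "rim_moves e M \<gamma> P" and rf: "run_free e M \<gamma>"
    and fg1: "first_gap (moved M P) \<gamma>1"
  shows "run_free e (moved M P) \<gamma>1"
  unfolding run_free_def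
proof (intro allI impI, rule ccontr)
  let ?N = "moved M P"
  fix x assume x: "\<gamma>1 < x" and "\<nexists>y. x \<le> y \<and> y < x + int e \<and> y \<notin> ?N"
  then have run: "\<And>y. x \<le> y \<Longrightarrow> y < x + int e \<Longrightarrow> y \<in> ?N" by blast
  have gx: "\<gamma> < x" using first_gap_moved_ge[OF fg P fg1] x by simp
  then obtain y where y: "x \<le> y" "y < x + int e" "y \<notin> M" using rf unfolding run_free_def by blast
  then obtain b where b: "(b, y) \<in> P" using run[OF y(1,2)] unfolding moved_iff by blast
  have "y < b" using rim_movesD(2)[OF P b] .
  have "x + int e \<le> b" using run[of b] moved_fst[OF P b] y(1) \<open>y < b\<close> by force
  have "y = x"
  proof (rule ccontr)
    assume "y \<noteq> x"
    then have y1: "x \<le> y - 1" "y - 1 \<in> ?N" using y run[of "y - 1"] by auto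
    consider "y - 1 \<in> M" "\<And>c. (y - 1, c) \<notin> P" | b' where "(b', y - 1) \<in> P"
      using y1(2) unfolding moved_iff by blast
    then show False
    proof cases
      case 1
      have "\<gamma> < y - 1" using y1 gx by simp
      from rim_moves_cover[OF P 1(1) this] obtain b' c' where
        bc: "(b', c') \<in> P" "c' < y - 1" "y - 1 \<le> b'" .
      then have "b' \<noteq> y - 1" using 1(2) by blast
      then show False using rim_moves_disjoint[OF P b bc(1)] bc \<open>y < b\<close> by auto
    next
      case 2
      then show False using rim_moves_disjoint[OF P b 2] rim_movesD(2)[OF P 2] \<open>y < b\<close> by auto
    qed
  qed
  then have xb: "(b, x) \<in> P" using b by simp
  have dvd: "int e dvd b - x" using rim_movesD(5)[OF P xb] gx by auto
  have "z \<in> M" if z: "x + 1 \<le> z" "z < x + 1 + int e" for z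
  proof (cases "z = x + int e")
    case False
    then have "x < z" "z < b" "z \<in> ?N" using z \<open>x + int e \<le> b\<close> run[of z] by auto
    then show ?thesis using moved_inside[OF P xb] by blast
  next
    case True
    then have "int e dvd b - z" using dvd by (metis diff_diff_eq dvd_diff dvd_refl)
    then show ?thesis
      using True \<open>x + int e \<le> b\<close> rim_movesD(3)[OF P xb] rim_movesD(6)[OF P xb, of z] z by (cases "z = b") auto
  qed
  then show False using rf gx unfolding run_free_def by (meson less_add_one order_less_trans)
qed

text \<open>The first gap moves exactly when \<open>\<gamma>\<close> is filled. It cannot move far: regularity leaves a gap
  among the \<open>e\<close> positions after \<open>\<gamma>\<close>, and this gap survives or is replaced by the position of a
  bead that has moved away.\<close>

lemma first_gap_moved_bounds:
  assumes fg: "first_gap M \<gamma>" and P: "rim_moves e M \<gamma> P" and rf: "run_free e M \<gamma>"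
    and fg1: "first_gap (moved M P) \<gamma>1"
  shows "excess e (rim_length P) \<le> \<gamma>1 - \<gamma>" "\<gamma>1 - \<gamma> < int e + excess e (rim_length P)"
proof -
  let ?N = "moved M P"
  have le: "\<gamma>1 \<le> z" if "z \<notin> ?N" for z using fg1 that unfolding first_gap_def by force
  have ge: "\<gamma> \<le> \<gamma>1" by (rule first_gap_moved_ge[OF fg P fg1])
  obtain y where y: "\<gamma> + 1 \<le> y" "y < \<gamma> + 1 + int e" "y \<notin> M"
    using rf unfolding run_free_def by (meson less_add_one)
  show "excess e (rim_length P) \<le> \<gamma>1 - \<gamma>"
  proof (cases "int e dvd rim_length P")
    case False
    then obtain b0 where "(b0, \<gamma>) \<in> P" using rim_not_dvdE[OF P] by blast
    then have "\<gamma> \<in> ?N" by (rule moved_snd)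
    then have "\<gamma>1 \<noteq> \<gamma>" using fg1 unfolding first_gap_def by blast
    then show ?thesis using ge unfolding excess_def by simp
  qed (use ge excess_def in simp)
  show "\<gamma>1 - \<gamma> < int e + excess e (rim_length P)"
  proof (cases "int e dvd rim_length P")
    case False
    then obtain b0 where b0: "(b0, \<gamma>) \<in> P" using rim_not_dvdE[OF P] by blast
    have "\<gamma>1 \<le> \<gamma> + int e"
    proof (cases "y \<in> ?N")
      case True
      then obtain b where b: "(b, y) \<in> P" using y(3) unfolding moved_iff by blast
      have "b0 < y" using rim_moves_disjoint[OF P b0 b] rim_movesD(2)[OF P b] y(1) by auto
      then show ?thesis using le[OF moved_fst[OF P b0]] y(2) by simp
    next
      case False
      then show ?thesis using le y(2) by force
    qed
    then show ?thesis using False unfolding excess_def by simp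
  next
    case True
    have "\<gamma>1 < \<gamma> + int e"
    proof (cases "\<gamma> \<in> ?N")
      case False
      then show ?thesis using le[OF False] y by simp
    next
      case in_N: True
      have "\<gamma> \<notin> M" using fg unfolding first_gap_def by blast
      then obtain b where b: "(b, \<gamma>) \<in> P" using in_N unfolding moved_iff by blast
      have d: "int e dvd b - \<gamma>" using True rim_length_dvd_iff[OF P] b by blast
      have "\<gamma> < b" using rim_movesD(2)[OF P b] .
      then have eb: "\<gamma> + int e \<le> b" using d zdvd_imp_le[of "int e" "b - \<gamma>"] by simp
      have "int e dvd b - (\<gamma> + int e)" using d by (metis diff_diff_eq dvd_diff dvd_refl)
      then have "\<gamma> + int e \<in> M"
        using rim_movesD(3)[OF P b] rim_movesD(6)[OF P b, of "\<gamma> + int e"] eb y by (cases "\<gamma> + int e = b") auto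
      then have "y < \<gamma> + int e" using y by (cases "y = \<gamma> + int e") auto
      moreover have "y \<notin> ?N" using moved_inside[OF P b, of y] y eb \<open>y < \<gamma> + int e\<close> by simp
      ultimately show ?thesis using le by force
    qed
    then show ?thesis using True unfolding excess_def by simp
  qed
qed

text \<open>A counter that reads the display from the top down. Above \<open>\<gamma>\<close> its value at \<open>x\<close> is \<open>x\<close> plus the
  number of positions above \<open>x\<close> covered by the intervals \<open>(c, b]\<close>. Inside an interval it is
  congruent to the runner in use and outside it is congruent to \<open>x\<close>, which turns it into an
  automaton that knows nothing of the moves: it drops by one at each gap it is congruent to.\<close>

definition scan :: "nat \<Rightarrow> int \<Rightarrow> (int \<times> int) set \<Rightarrow> int \<Rightarrow> int" where
  "scan e \<gamma> P x = (if \<gamma> \<le> x then x + (\<Sum>(b, c)\<in>P. max 0 (b - max c x)) else rim_end e \<gamma> P)"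

lemma scan_first_gap:
  assumes "rim_moves e M \<gamma> P"
  shows "scan e \<gamma> P \<gamma> = \<gamma> + rim_length P"
proof -
  have "(\<Sum>(b, c)\<in>P. max 0 (b - max c \<gamma>)) = (\<Sum>(b, c)\<in>P. b - c)"
    by (rule sum.cong) (use rim_movesD(1,2)[OF assms] in \<open>force simp: max_def\<close>)+
  then show ?thesis unfolding scan_def rim_length_def by simp
qed

lemma scan_top:
  assumes "\<And>b c. (b, c) \<in> P \<Longrightarrow> b \<le> x" "\<gamma> \<le> x"
  shows "scan e \<gamma> P x = x"
proof -
  have "(\<Sum>(b, c)\<in>P. max 0 (b - max c x)) = 0"
    by (rule sum.neutral) (use assms(1) in \<open>force simp: max_def\<close>)
  then show ?thesis using assms(2) unfolding scan_def by simp
qed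

lemma scan_active_dvd:
  assumes P: "rim_moves e M \<gamma> P" and bc: "(b, c) \<in> P" "c \<le> x" "x \<le> b"
  shows "int e dvd scan e \<gamma> P x - b"
proof -
  have "\<gamma> \<le> x" using rim_movesD(1)[OF P bc(1)] bc(2) by simp
  have "(\<Sum>(b, c)\<in>P. max 0 (b - max c x)) = (b - x) + (\<Sum>(b, c)\<in>P - {(b, c)}. max 0 (b - max c x))"
    using sum.remove[OF rim_moves_finite[OF P] bc(1), of "\<lambda>(b, c). max 0 (b - max c x)"] bc(2,3) by simp
  moreover have "int e dvd (\<Sum>(b, c)\<in>P - {(b, c)}. max 0 (b - max c x))"
  proof (rule dvd_sum)
    fix p assume "p \<in> P - {(b, c)}"
    then obtain b' c' where p: "p = (b', c')" and m: "(b', c') \<in> P" "(b', c') \<noteq> (b, c)" by (cases p) blast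
    then consider "b < c'" | "b' < c" using rim_moves_disjoint[OF P bc(1) m(1)] by auto
    then show "int e dvd (case p of (b', c') \<Rightarrow> max 0 (b' - max c' x))"
    proof cases
      case 1
      then have "int e dvd b' - c'" "c' < b'"
        using rim_movesD(2,5)[OF P m(1)] rim_movesD(1,2)[OF P bc(1)] by auto
      then show ?thesis using 1 bc(3) p by simp
    next
      case 2
      then show ?thesis using bc(2) p by simp
    qed
  qed
  ultimately show ?thesis unfolding scan_def using \<open>\<gamma> \<le> x\<close> by simp
qed

lemma scan_inactive_dvd:
  assumes P: "rim_moves e M \<gamma> P" and x: "\<gamma> < x" "\<And>b c. (b, c) \<in> P \<Longrightarrow> \<not> (c < x \<and> x \<le> b)"
  shows "int e dvd scan e \<gamma> P x - x"
proof -
  have "int e dvd (\<Sum>(b, c)\<in>P. max 0 (b - max c x))"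
  proof (rule dvd_sum, clarify)
    fix b c assume m: "(b, c) \<in> P"
    then consider "x \<le> c" | "b < x" using x(2) by force
    then show "int e dvd max 0 (b - max c x)"
    proof cases
      case 1
      then have "int e dvd b - c" using rim_movesD(5)[OF P m] x(1) by auto
      then show ?thesis using 1 rim_movesD(2)[OF P m] by simp
    qed simp
  qed
  then show ?thesis unfolding scan_def using x(1) by simp
qed

lemma scan_step_active:
  assumes P: "rim_moves e M \<gamma> P" and bc: "(b, c) \<in> P" "c < x" "x \<le> b"
  shows "scan e \<gamma> P (x - 1) = scan e \<gamma> P x"
proof -
  have g: "\<gamma> \<le> x - 1" using rim_movesD(1)[OF P bc(1)] bc(2) by simp
  have split: "(\<Sum>(b, c)\<in>P. max 0 (b - max c y)) =
    max 0 (b - max c y) + (\<Sum>(b, c)\<in>P - {(b, c)}. max 0 (b - max c y))" for y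
    using sum.remove[OF rim_moves_finite[OF P] bc(1), of "\<lambda>(b, c). max 0 (b - max c y)"] by simp
  have "(\<Sum>(b, c)\<in>P - {(b, c)}. max 0 (b - max c (x - 1))) = (\<Sum>(b, c)\<in>P - {(b, c)}. max 0 (b - max c x))"
  proof (rule sum.cong[OF refl])
    fix p assume "p \<in> P - {(b, c)}"
    then obtain b' c' where p: "p = (b', c')" and m: "(b', c') \<in> P" "(b', c') \<noteq> (b, c)" by (cases p) blast
    then consider "b < c'" | "b' < c" using rim_moves_disjoint[OF P bc(1) m(1)] by auto
    then show "(case p of (b', c') \<Rightarrow> max 0 (b' - max c' (x - 1))) = (case p of (b', c') \<Rightarrow> max 0 (b' - max c' x))"
      by cases (use bc(2,3) p in auto)
  qed
  then show ?thesis unfolding scan_def split using g bc(2,3) by simp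
qed

lemma scan_step_inactive:
  assumes P: "rim_moves e M \<gamma> P" and x: "\<gamma> < x" "\<And>b c. (b, c) \<in> P \<Longrightarrow> \<not> (c < x \<and> x \<le> b)"
  shows "scan e \<gamma> P (x - 1) = scan e \<gamma> P x - 1"
proof -
  have "(\<Sum>(b, c)\<in>P. max 0 (b - max c (x - 1))) = (\<Sum>(b, c)\<in>P. max 0 (b - max c x))"
  proof (rule sum.cong[OF refl], clarify)
    fix b c assume "(b, c) \<in> P"
    then consider "x \<le> c" | "b < x" using x(2) by force
    then show "max 0 (b - max c (x - 1)) = max 0 (b - max c x)" by cases auto
  qed
  then show ?thesis unfolding scan_def using x(1) by simp
qed

text \<open>Outside the intervals all positions are gaps congruent to the counter. Inside an interval the
  gaps on the runner in use are excluded by the definition of a move. At \<open>\<gamma>\<close> itself the rule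
  accounts for the correction by \<open>excess\<close> in \<open>rim_end\<close>.\<close>

lemma scan_step:
  assumes fg: "first_gap M \<gamma>" and P: "rim_moves e M \<gamma> P"
  shows "scan e \<gamma> P (x - 1) = scan e \<gamma> P x - (if x \<notin> M \<and> int e dvd scan e \<gamma> P x - x then 1 else 0)"
proof -
  consider "x < \<gamma>" | "x = \<gamma>" | "\<gamma> < x" by linarith
  then show ?thesis
  proof cases
    case 1
    then have "x \<in> M" using fg unfolding first_gap_def by blast
    then show ?thesis using 1 unfolding scan_def by simp
  next
    case 2
    have "\<gamma> \<notin> M" using fg unfolding first_gap_def by blast
    moreover have "scan e \<gamma> P (\<gamma> - 1) = rim_end e \<gamma> P" unfolding scan_def by simp
    ultimately show ?thesis unfolding 2 scan_first_gap[OF P] rim_end_def excess_def by simp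
  next
    case 3
    show ?thesis
    proof (cases "\<exists>b c. (b, c) \<in> P \<and> c < x \<and> x \<le> b")
      case True
      then obtain b c where bc: "(b, c) \<in> P" "c < x" "x \<le> b" by blast
      have "\<not> int e dvd scan e \<gamma> P x - x" if "x \<notin> M"
      proof
        assume "int e dvd scan e \<gamma> P x - x"
        moreover have "int e dvd scan e \<gamma> P x - b" using scan_active_dvd[OF P bc(1)] bc(2,3) by simp
        ultimately have "int e dvd (scan e \<gamma> P x - x) - (scan e \<gamma> P x - b)" by (rule dvd_diff)
        then have "int e dvd b - x" by simp
        moreover have "x \<noteq> b" using that rim_movesD(3)[OF P bc(1)] by blast
        ultimately show False using rim_movesD(6)[OF P bc(1), of x] bc that by simp
      qed
      then show ?thesis using scan_step_active[OF P bc] by auto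
    next
      case False
      then have i: "\<And>b c. (b, c) \<in> P \<Longrightarrow> \<not> (c < x \<and> x \<le> b)" by blast
      have "x \<notin> M" using rim_moves_cover[OF P _ 3] i by blast
      then show ?thesis using scan_step_inactive[OF P 3 i] scan_inactive_dvd[OF P 3 i] by simp
    qed
  qed
qed

lemma dvd_in_window:
  assumes "int e dvd d" "0 \<le> d" "d < int e"
  shows "d = 0"
  using assms zdvd_not_zless by force

text \<open>Run the counters of a display and of the display after the moves side by side. They start
  equal. At each \<open>b\<close>, which has become a gap, only the second one can drop; at each \<open>c\<close>, which has
  become a bead, only the first one drops. Elsewhere the two read the same symbols, and congruence
  modulo \<open>e\<close> keeps their distance within a window of \<open>e\<close> values.\<close>

lemma scan_comparison:
  assumes fg: "first_gap M \<gamma>" and P: "rim_moves e M \<gamma> P" and e: "1 \<le> e"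
    and fg1: "first_gap (moved M P) \<gamma>1" and Q: "rim_moves e (moved M P) \<gamma>1 Q"
    and u: "\<And>b c. (b, c) \<in> P \<union> Q \<Longrightarrow> b \<le> u" "\<gamma>1 \<le> u"
    and x: "\<gamma> \<le> x" "x \<le> u"
  shows "if \<exists>b c. (b, c) \<in> P \<and> c \<le> x \<and> x < b
    then 1 \<le> scan e \<gamma> P x - scan e \<gamma>1 Q x \<and> scan e \<gamma> P x - scan e \<gamma>1 Q x \<le> int e
    else 0 \<le> scan e \<gamma> P x - scan e \<gamma>1 Q x \<and> scan e \<gamma> P x - scan e \<gamma>1 Q x < int e"
  using x(2,1)
proof (induction x rule: int_le_induct)
  case base
  have "scan e \<gamma> P u = u" "scan e \<gamma>1 Q u = u"
    by (rule scan_top; use u base in blast)+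
  moreover have "\<not> (\<exists>b c. (b, c) \<in> P \<and> c \<le> u \<and> u < b)" using u(1) by force
  ultimately show ?case using e by auto
next
  case (step x)
  then have gx: "\<gamma> < x" by simp
  let ?N = "moved M P" and ?S = "scan e \<gamma> P" and ?T = "scan e \<gamma>1 Q"
  define held where "held x \<longleftrightarrow> (\<exists>b c. (b, c) \<in> P \<and> c \<le> x \<and> x < b)" for x
  have IH: "if held x then 1 \<le> ?S x - ?T x \<and> ?S x - ?T x \<le> int e
      else 0 \<le> ?S x - ?T x \<and> ?S x - ?T x < int e"
    using step unfolding held_def by simp
  note S = scan_step[OF fg P, of x] and T = scan_step[OF fg1 Q, of x]
  have T_dvd: "int e dvd ?T x - x \<longleftrightarrow> ?S x - ?T x = 0" if "int e dvd ?S x - x" "\<not> held x"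
  proof
    assume "int e dvd ?T x - x"
    then have "int e dvd (?S x - x) - (?T x - x)" using that(1) dvd_diff by blast
    then show "?S x - ?T x = 0" using IH that(2) by (intro dvd_in_window) auto
  qed (use that in simp)
  have "if held (x - 1) then 1 \<le> ?S (x - 1) - ?T (x - 1) \<and> ?S (x - 1) - ?T (x - 1) \<le> int e
      else 0 \<le> ?S (x - 1) - ?T (x - 1) \<and> ?S (x - 1) - ?T (x - 1) < int e"
  proof -
    consider (bead) c where "(x, c) \<in> P" | (gap) b where "(b, x) \<in> P"
      | (neither) "\<And>c. (x, c) \<notin> P" "\<And>b. (b, x) \<notin> P" by blast
    then show ?thesis
    proof cases
      case bead
      note D = rim_movesD[OF P bead]
      have h1: "held (x - 1)" unfolding held_def using bead D(2) by (intro exI[of _ x] exI[of _ c]) simp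
      have h: "\<not> held x"
        unfolding held_def using rim_moves_meet(1)[OF P bead, of _ _ x] D(2) by force
      have "int e dvd ?S x - x" using scan_active_dvd[OF P bead, of x] D(2) by simp
      moreover have "x \<notin> ?N" by (rule moved_fst[OF P bead])
      ultimately show ?thesis using S T T_dvd h h1 IH D(3) by (auto split: if_splits)
    next
      case gap
      note D = rim_movesD[OF P gap]
      have h: "held x" unfolding held_def using gap D(2) by blast
      have h1: "\<not> held (x - 1)"
      proof
        assume "held (x - 1)"
        then obtain b' c' where m: "(b', c') \<in> P" "c' \<le> x - 1" "x - 1 < b'" unfolding held_def by blast
        then show False using rim_moves_disjoint[OF P gap m(1)] D(2) by auto
      qed
      have "int e dvd b - x" using D(5) gx by auto
      moreover have "int e dvd ?S x - b" using scan_active_dvd[OF P gap, of x] D(2) by simp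
      ultimately have "int e dvd (?S x - b) + (b - x)" using dvd_add by blast
      then have "int e dvd ?S x - x" by simp
      moreover have "x \<in> ?N" using gap by (rule moved_snd)
      ultimately show ?thesis using S T h h1 IH D(4) by simp
    next
      case neither
      have N: "x \<in> ?N \<longleftrightarrow> x \<in> M" using neither unfolding moved_iff by blast
      have hh: "held (x - 1) \<longleftrightarrow> held x"
      proof
        assume "held (x - 1)"
        then obtain b c where m: "(b, c) \<in> P" "c \<le> x - 1" "x - 1 < b" unfolding held_def by blast
        then have "b \<noteq> x" using neither by blast
        then show "held x" unfolding held_def using m by (intro exI[of _ b] exI[of _ c]) simp
      next
        assume "held x"
        then obtain b c where m: "(b, c) \<in> P" "c \<le> x" "x < b" unfolding held_def by blast
        then have "c \<noteq> x" using neither by blast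
        then show "held (x - 1)" unfolding held_def using m by (intro exI[of _ b] exI[of _ c]) simp
      qed
      show ?thesis
      proof (cases "held x")
        case True
        then obtain b c where m: "(b, c) \<in> P" "c \<le> x" "x < b" unfolding held_def by blast
        then have "c < x" using neither by (cases "c = x") auto
        then have Sx: "?S (x - 1) = ?S x" using scan_step_active[OF P m(1)] m by simp
        then have nd: "x \<notin> M \<Longrightarrow> \<not> int e dvd ?S x - x" using S by auto
        have "?S x - ?T x \<noteq> int e" if "x \<notin> M" "int e dvd ?T x - x"
        proof
          assume "?S x - ?T x = int e"
          then have "?S x - x = (?T x - x) + int e" by simp
          then have "int e dvd ?S x - x" using that(2) by (metis dvd_add dvd_refl)
          then show False using nd that by blast
        qed
        then show ?thesis using T N Sx hh True IH by auto
      next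
        case False
        have i: "\<not> (c < x \<and> x \<le> b)" if "(b, c) \<in> P" for b c
          using False that neither(1)[of c] unfolding held_def by (metis le_less less_imp_le)
        have "x \<notin> M" using rim_moves_cover[OF P _ gx] i by blast
        then show ?thesis
          using scan_step_inactive[OF P gx i] scan_inactive_dvd[OF P gx i] T N hh False IH T_dvd
          by (auto split: if_splits)
      qed
    qed
  qed
  then show ?case unfolding held_def .
qed

text \<open>The counterpart of the bounds for the first gap. Together the two say that the
  numbers of parts of \<open>\<mu>\<close> and of its Mullineux image drop within the same bounds in one step, which is why a preimage with exchanged roles exists.\<close>

lemma rim_end_bounds:
  assumes fg: "first_gap M \<gamma>" and P: "rim_moves e M \<gamma> P" and e: "1 \<le> e"
    and fg1: "first_gap (moved M P) \<gamma>1" and Q: "rim_moves e (moved M P) \<gamma>1 Q"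
  shows "excess e (rim_length P) \<le> rim_end e \<gamma> P - rim_end e \<gamma>1 Q"
    and "rim_end e \<gamma> P - rim_end e \<gamma>1 Q < int e + excess e (rim_length P)"
proof -
  let ?S = "scan e \<gamma> P" and ?T = "scan e \<gamma>1 Q"
  have g: "\<gamma> \<le> \<gamma>1" by (rule first_gap_moved_ge[OF fg P fg1])
  define F where "F = insert \<gamma>1 (fst ` (P \<union> Q))"
  have "finite F" unfolding F_def using rim_moves_finite[OF P] rim_moves_finite[OF Q] by simp
  then have F: "\<And>z. z \<in> F \<Longrightarrow> z \<le> Max F" by simp
  have u: "\<And>b c. (b, c) \<in> P \<union> Q \<Longrightarrow> b \<le> Max F" "\<gamma>1 \<le> Max F"
    using F unfolding F_def by (metis fst_conv image_eqI insertCI, blast)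
  have cmp: "if \<exists>b c. (b, c) \<in> P \<and> c \<le> \<gamma> \<and> \<gamma> < b
    then 1 \<le> ?S \<gamma> - ?T \<gamma> \<and> ?S \<gamma> - ?T \<gamma> \<le> int e
    else 0 \<le> ?S \<gamma> - ?T \<gamma> \<and> ?S \<gamma> - ?T \<gamma> < int e"
    by (rule scan_comparison[OF fg P e fg1 Q u]) (use g u in auto)
  have ends: "?S (\<gamma> - 1) = rim_end e \<gamma> P" "?T (\<gamma> - 1) = rim_end e \<gamma>1 Q"
    using g unfolding scan_def by auto
  note S = scan_step[OF fg P, of \<gamma>, unfolded ends] and T = scan_step[OF fg1 Q, of \<gamma>, unfolded ends]
  have gM: "\<gamma> \<notin> M" using fg unfolding first_gap_def by blast
  have sg: "?S \<gamma> - \<gamma> = rim_length P" using scan_first_gap[OF P] by simp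
  have "excess e (rim_length P) \<le> rim_end e \<gamma> P - rim_end e \<gamma>1 Q \<and>
    rim_end e \<gamma> P - rim_end e \<gamma>1 Q < int e + excess e (rim_length P)"
  proof (cases "\<exists>b. (b, \<gamma>) \<in> P")
    case True
    then obtain b where b: "(b, \<gamma>) \<in> P" by blast
    have "\<gamma> < b" using rim_movesD(2)[OF P b] .
    then have "\<exists>b c. (b, c) \<in> P \<and> c \<le> \<gamma> \<and> \<gamma> < b" using b by blast
    then have "1 \<le> ?S \<gamma> - ?T \<gamma>" "?S \<gamma> - ?T \<gamma> \<le> int e" using cmp by simp_all
    moreover have "\<gamma> \<in> moved M P" using b by (rule moved_snd)
    ultimately show ?thesis using S T gM sg unfolding excess_def by auto
  next
    case False
    then have d: "int e dvd rim_length P" using rim_not_dvdE[OF P] by blast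
    have "\<not> (\<exists>b c. (b, c) \<in> P \<and> c \<le> \<gamma> \<and> \<gamma> < b)" using False rim_movesD(1)[OF P] by (metis order_antisym)
    then have c: "0 \<le> ?S \<gamma> - ?T \<gamma>" "?S \<gamma> - ?T \<gamma> < int e" using cmp by (simp_all only: if_False)
    have "\<gamma> \<notin> moved M P" using False gM unfolding moved_iff by blast
    moreover have "int e dvd ?T \<gamma> - \<gamma>" if "?S \<gamma> = ?T \<gamma>" using that sg d by simp
    moreover have "?S \<gamma> = ?T \<gamma>" if "int e dvd ?T \<gamma> - \<gamma>"
    proof -
      have "int e dvd (?S \<gamma> - \<gamma>) - (?T \<gamma> - \<gamma>)" using that sg d dvd_diff by metis
      then have "?S \<gamma> - ?T \<gamma> = 0" using c by (intro dvd_in_window) auto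
      then show ?thesis by simp
    qed
    ultimately show ?thesis using c S T gM sg d unfolding excess_def
      by (cases "?S \<gamma> = ?T \<gamma>") (auto split: if_splits)
  qed
  then show "excess e (rim_length P) \<le> rim_end e \<gamma> P - rim_end e \<gamma>1 Q"
    and "rim_end e \<gamma> P - rim_end e \<gamma>1 Q < int e + excess e (rim_length P)" by auto
qed

section \<open>Undoing a step\<close>

text \<open>The moves described from their result \<open>N\<close>: the beads \<open>c\<close> of \<open>N\<close> are to be moved up to the
  gaps \<open>b\<close>.\<close>

definition backward_moves :: "nat \<Rightarrow> int set \<Rightarrow> int \<Rightarrow> (int \<times> int) set \<Rightarrow> bool" where
  "backward_moves e N \<gamma> P \<longleftrightarrow> finite P \<and>
    (\<forall>b c. (b, c) \<in> P \<longrightarrow> \<gamma> \<le> c \<and> c < b \<and> c \<in> N \<and> b \<notin> N \<and> (int e dvd b - c \<or> c = \<gamma>) \<and>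
       (\<forall>x. c < x \<and> x < b \<and> int e dvd b - x \<longrightarrow> x \<in> N)) \<and>
    (\<forall>b c b' c'. (b, c) \<in> P \<longrightarrow> (b', c') \<in> P \<longrightarrow> (b, c) = (b', c') \<or> b < c' \<or> b' < c) \<and>
    (\<forall>x\<in>N. \<gamma> \<le> x \<longrightarrow> (\<exists>b c. (b, c) \<in> P \<and> c \<le> x \<and> x < b))"

lemma backward_movesD:
  assumes "backward_moves e N \<gamma> P"
  shows "finite P"
    and "(b, c) \<in> P \<Longrightarrow> \<gamma> \<le> c \<and> c < b \<and> c \<in> N \<and> b \<notin> N \<and> (int e dvd b - c \<or> c = \<gamma>) \<and>
       (\<forall>x. c < x \<and> x < b \<and> int e dvd b - x \<longrightarrow> x \<in> N)"
    and "(b, c) \<in> P \<Longrightarrow> (b', c') \<in> P \<Longrightarrow> (b, c) = (b', c') \<or> b < c' \<or> b' < c"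
    and "x \<in> N \<Longrightarrow> \<gamma> \<le> x \<Longrightarrow> \<exists>b c. (b, c) \<in> P \<and> c \<le> x \<and> x < b"
  using assms unfolding backward_moves_def by blast+

lemma greedy_upwards:
  fixes N :: "int set"
  assumes fin: "finite {x \<in> N. l \<le> x}" and e: "1 \<le> e"
  shows "\<exists>P. backward_moves e N l P \<and> (\<forall>b c. (b, c) \<in> P \<longrightarrow> int e dvd b - c)"
proof -
  define B where "B = uminus ` {x \<in> N. l \<le> x}"
  have B: "- x \<in> B \<longleftrightarrow> x \<in> N \<and> l \<le> x" for x unfolding B_def by force
  have "finite B" unfolding B_def using fin by simp
  from greedy_intervals[OF this e] obtain R where "greedy e B R" by blast
  note R = greedyD[OF this]
  define P where "P = (\<lambda>(x, y). (- y, - x)) ` R"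
  have P: "(b, c) \<in> P \<longleftrightarrow> (- c, - b) \<in> R" for b c
    unfolding P_def by force
  have D: "l \<le> c \<and> c < b \<and> c \<in> N \<and> b \<notin> N" "int e dvd b - c"
    "\<forall>x. c < x \<and> x < b \<and> int e dvd b - x \<longrightarrow> x \<in> N" if bc: "(b, c) \<in> P" for b c
  proof -
    note D = R(2)[OF bc[unfolded P]]
    show "l \<le> c \<and> c < b \<and> c \<in> N \<and> b \<notin> N" using D B[of c] B[of b] by auto
    show d: "int e dvd b - c" using D by simp
    show "\<forall>x. c < x \<and> x < b \<and> int e dvd b - x \<longrightarrow> x \<in> N"
    proof (intro allI impI)
      fix x assume x: "c < x \<and> x < b \<and> int e dvd b - x"
      then have "int e dvd (b - c) - (b - x)" using d dvd_diff by blast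
      then have "int e dvd - c - - x" by (simp add: dvd_diff_commute)
      then show "x \<in> N" using D B[of x] x by auto
    qed
  qed
  have dis: "(b, c) = (b', c') \<or> b < c' \<or> b' < c" if "(b, c) \<in> P" "(b', c') \<in> P" for b c b' c'
    using R(3)[of "- c" "- b" "- c'" "- b'"] that P by auto
  have cov: "\<exists>b c. (b, c) \<in> P \<and> c \<le> x \<and> x < b" if x: "x \<in> N" "l \<le> x" for x
  proof -
    obtain y z where "(y, z) \<in> R" "z < - x" "- x \<le> y" using x R(4)[of "- x"] B by blast
    then show ?thesis using P[of "- z" "- y"] by (intro exI[of _ "- z"] exI[of _ "- y"]) auto
  qed
  have "finite P" unfolding P_def using R(1) by simp
  then have "backward_moves e N l P" unfolding backward_moves_def using D dis cov by blast
  then show ?thesis using D(2) by blast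
qed

text \<open>If \<open>e\<close> divides \<open>a\<close>, the upward greedy procedure starts at \<open>\<gamma>\<close>. Otherwise the bead at \<open>\<gamma>\<close> is
  first moved to the first gap on the runner of \<open>\<gamma> + a\<close>, and the procedure starts there. So the
  size of the rim is controlled only modulo \<open>e\<close>.\<close>

lemma backward_moves_exist:
  assumes fin: "finite {x \<in> N. \<gamma> \<le> x}" and e: "1 \<le> e" and cut: "\<not> int e dvd a \<Longrightarrow> \<gamma> \<in> N"
  shows "\<exists>P. backward_moves e N \<gamma> P \<and>
    (if int e dvd a then \<forall>b c. (b, c) \<in> P \<longrightarrow> int e dvd b - c
     else \<exists>b0. (b0, \<gamma>) \<in> P \<and> int e dvd \<gamma> + a - b0)"
proof (cases "int e dvd a")
  case True
  then show ?thesis using greedy_upwards[OF fin e] by auto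
next
  case False
  define g where "g n = \<gamma> + (a mod int e) + int e * int n" for n
  have mod0: "0 < a mod int e" "a mod int e < int e"
    using False e pos_mod_sign[of "int e" a] pos_mod_bound[of "int e" a] by (auto simp: dvd_eq_mod_eq_0 order_less_le)
  have "\<exists>n. g n \<notin> N"
  proof (rule ccontr)
    assume "\<nexists>n. g n \<notin> N"
    then have "range g \<subseteq> {x \<in> N. \<gamma> \<le> x}" using mod0 unfolding g_def by auto
    moreover have "inj g" unfolding g_def using e by (auto simp: inj_on_def)
    ultimately show False using fin by (meson finite_imageD finite_subset infinite_UNIV_nat)
  qed
  define m where "m = (LEAST n. g n \<notin> N)"
  have m: "g m \<notin> N" unfolding m_def using \<open>\<exists>n. g n \<notin> N\<close> by (rule LeastI_ex)
  \<comment> \<open>The first gap at or above \<open>\<gamma>\<close> on the runner of \<open>\<gamma> + a\<close>.\<close>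
  define b0 where "b0 = g m"
  have b0: "\<gamma> < b0" "b0 \<notin> N" using m mod0 unfolding b0_def g_def by (auto simp: add_pos_nonneg)
  have ab: "\<gamma> + a - b0 = int e * (a div int e - int m)"
    unfolding b0_def g_def by (simp add: algebra_simps minus_mult_div_eq_mod[symmetric])
  have nd: "\<not> int e dvd b0 - \<gamma>"
  proof
    assume "int e dvd b0 - \<gamma>"
    then have "int e dvd (\<gamma> + a - b0) + (b0 - \<gamma>)" using ab by (intro dvd_add) auto
    then show False using False by simp
  qed
  have run0: "x \<in> N" if x: "\<gamma> < x" "x < b0" "int e dvd b0 - x" for x
  proof -
    obtain k where k: "b0 - x = int e * k" using x(3) by blast
    have "0 < int e * k" using k x(2) by linarith
    then have "0 < k" using e by (simp add: zero_less_mult_iff)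
    have "int e * k < a mod int e + int e * int m" using k x(1) unfolding b0_def g_def by linarith
    then have "int e * k < int e * (int m + 1)" using mod0 by (simp add: algebra_simps)
    then have "k \<le> int m" using e by (simp add: mult_less_cancel_left)
    define n where "n = m - nat k"
    have n: "int n = int m - k" "n < m" using \<open>0 < k\<close> \<open>k \<le> int m\<close> unfolding n_def by auto
    have "x = b0 - int e * k" using k by simp
    then have "x = g n" unfolding b0_def g_def n(1) by (simp add: algebra_simps)
    then show ?thesis using not_less_Least[of n "\<lambda>n. g n \<notin> N"] n(2) unfolding m_def by blast
  qed
  have "finite {x \<in> N. b0 \<le> x}" using fin by (rule finite_subset[rotated]) (use b0(1) in auto)
  from greedy_upwards[OF this e] obtain P where P': "backward_moves e N b0 P"
    "\<forall>b c. (b, c) \<in> P \<longrightarrow> int e dvd b - c" by blast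
  note P = backward_movesD[OF P'(1)]
  have above: "b0 < c" if "(b, c) \<in> P" for b c
    using P(2)[OF that] b0(2) by (cases "c = b0") auto
  have "backward_moves e N \<gamma> (insert (b0, \<gamma>) P)" unfolding backward_moves_def
  proof (intro conjI allI impI ballI)
    show "finite (insert (b0, \<gamma>) P)" using P(1) by simp
    fix b c assume m: "(b, c) \<in> insert (b0, \<gamma>) P"
    then consider "b = b0" "c = \<gamma>" | "(b, c) \<in> P" by blast
    note cs = this
    show "\<gamma> \<le> c" by (rule cs) (use above b0 in force)+
    show "c < b" by (rule cs) (use P(2) b0 in force)+
    show "c \<in> N" by (rule cs) (use P(2) cut False in blast)+
    show "b \<notin> N" by (rule cs) (use P(2) b0 in blast)+
    show "int e dvd b - c \<or> c = \<gamma>" by (rule cs) (use P'(2) in blast)+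
    show "x \<in> N" if "c < x \<and> x < b \<and> int e dvd b - x" for x
      by (rule cs) (use P(2) run0 that in blast)+
    fix b' c' assume m': "(b', c') \<in> insert (b0, \<gamma>) P"
    show "(b, c) = (b', c') \<or> b < c' \<or> b' < c"
      using m m' above[of b c] above[of b' c'] P(3)[of b c b' c'] by blast
  next
    fix x assume x: "x \<in> N" "\<gamma> \<le> x"
    show "\<exists>b c. (b, c) \<in> insert (b0, \<gamma>) P \<and> c \<le> x \<and> x < b"
    proof (cases "b0 \<le> x")
      case True
      then show ?thesis using P(4)[OF x(1)] by blast
    next
      case False
      then show ?thesis using x by (intro exI[of _ b0] exI[of _ \<gamma>]) simp
    qed
  qed
  moreover have "int e dvd \<gamma> + a - b0" unfolding ab by simp
  ultimately show ?thesis using False by auto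
qed

lemma forward_of_backward_moves:
  assumes P: "backward_moves e N \<gamma> P" and below: "\<And>x. x < \<gamma> \<Longrightarrow> x \<in> N"
  defines "M \<equiv> N - snd ` P \<union> fst ` P"
  shows "first_gap M \<gamma>" "rim_moves e M \<gamma> P" "moved M P = N"
proof -
  have D: "\<gamma> \<le> c" "c < b" "c \<in> N" "b \<notin> N" "int e dvd b - c \<or> c = \<gamma>"
    "\<And>x. c < x \<Longrightarrow> x < b \<Longrightarrow> int e dvd b - x \<Longrightarrow> x \<in> N" if "(b, c) \<in> P" for b c
    using P that unfolding backward_moves_def by blast+
  have dis: "(b, c) = (b', c') \<or> b < c' \<or> b' < c" if "(b, c) \<in> P" "(b', c') \<in> P" for b c b' c'
    using P that unfolding backward_moves_def by blast
  have cov: "\<exists>b c. (b, c) \<in> P \<and> c \<le> x \<and> x < b" if "x \<in> N" "\<gamma> \<le> x" for x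
    using P that unfolding backward_moves_def by blast
  have M: "x \<in> M \<longleftrightarrow> (x \<in> N \<and> (\<forall>b. (b, x) \<notin> P)) \<or> (\<exists>c. (x, c) \<in> P)" for x
    unfolding M_def by force
  show "first_gap M \<gamma>" unfolding first_gap_def
  proof (intro conjI allI impI)
    show "x \<in> M" if "x < \<gamma>" for x using below[OF that] D(1)[of _ x] that M by (meson linorder_not_le)
    have "\<gamma> \<notin> N \<or> (\<exists>b. (b, \<gamma>) \<in> P)" using cov[of \<gamma>] D(1) by (metis order_antisym order_refl)
    moreover have "(\<gamma>, c) \<notin> P" for c using D(1,2)[of \<gamma> c] by force
    ultimately show "\<gamma> \<notin> M" using M by blast
  qed
  show "moved M P = N" unfolding moved_def M_def using D(3,4) by force
  show "rim_moves e M \<gamma> P" unfolding rim_moves_def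
  proof (intro conjI allI impI ballI)
    show "finite P" using P unfolding backward_moves_def by blast
    fix b c assume m: "(b, c) \<in> P"
    show "\<gamma> \<le> c" "c < b" "int e dvd b - c \<or> c = \<gamma>" using D(1,2,5)[OF m] by auto
    show "b \<in> M" using M m by blast
    show "c \<notin> M" using M[of c] m D(3)[OF m] D(4)[of c] by blast
    show "x \<in> M" if x: "c < x \<and> x < b \<and> int e dvd b - x" for x
    proof -
      have "(b', x) \<notin> P" for b' using dis[OF m, of b' x] D(2)[of b' x] x by force
      then show ?thesis using M D(6)[OF m, of x] x by blast
    qed
    fix b' c' assume "(b', c') \<in> P"
    then show "(b, c) = (b', c') \<or> b < c' \<or> b' < c" using dis m by blast
  next
    fix x assume x: "x \<in> M" "\<gamma> < x"
    consider c where "(x, c) \<in> P" | "x \<in> N" "\<And>b. (b, x) \<notin> P" using x(1) M by blast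
    then show "\<exists>(b, c)\<in>P. c < x \<and> x \<le> b"
    proof cases
      case 1
      then show ?thesis using D(2) by (intro bexI[of _ "(x, c)"]) auto
    next
      case 2
      then obtain b c where bc: "(b, c) \<in> P" "c \<le> x" "x < b" using cov[of x] x(2) by auto
      then have "c \<noteq> x" using 2 by blast
      then show ?thesis using bc by (intro bexI[of _ "(b, c)"]) auto
    qed
  qed
qed

text \<open>A run of \<open>e\<close> beads lies in a single interval \<open>(c, b]\<close>. Where it does not contain \<open>b\<close> it is
  also a run after the moves, hence lies below the new first gap, which is then too far from
  \<open>\<gamma>\<close>. If it ends at \<open>b\<close>, shift it down by one position.\<close>

lemma run_free_before_moves:
  assumes fg: "first_gap M \<gamma>" and P: "rim_moves e M \<gamma> P" and e: "1 \<le> e"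
    and fg1: "first_gap (moved M P) \<gamma>1" and rf: "run_free e (moved M P) \<gamma>1"
    and near: "\<gamma>1 - \<gamma> < int e + excess e (rim_length P)"
  shows "run_free e M \<gamma>"
proof -
  let ?N = "moved M P"
  have below: "z \<in> ?N" if "z < \<gamma>1" for z using fg1 that unfolding first_gap_def by blast
  have ge: "\<gamma>1 \<le> z" if "z \<notin> ?N" for z using below that by force
  have gM: "\<gamma> \<notin> M" using fg unfolding first_gap_def by blast
  have low: "\<exists>b. (b, \<gamma>) \<in> P" if "\<gamma> < \<gamma>1"
    using below[OF that] gM unfolding moved_iff by blast
  have inside: False if bc: "(b, c) \<in> P" "c < x" "x + int e \<le> b"
    and run: "\<And>y. x \<le> y \<Longrightarrow> y < x + int e \<Longrightarrow> y \<in> M" for b c x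
  proof -
    have N: "y \<in> ?N" if "x \<le> y" "y < x + int e" for y
      using moved_inside[OF P bc(1), of y] bc(2,3) run[OF that] that by simp
    then have "\<not> \<gamma>1 < x" using rf unfolding run_free_def by blast
    then have "x + int e \<le> \<gamma>1" using N[of \<gamma>1] fg1 unfolding first_gap_def by force
    have gx: "\<gamma> < x" using rim_movesD(1)[OF P bc(1)] bc(2) by simp
    then obtain b' where b': "(b', \<gamma>) \<in> P" using low \<open>x + int e \<le> \<gamma>1\<close> e by auto
    have "x \<le> b'" using ge[OF moved_fst[OF P b']] \<open>x + int e \<le> \<gamma>1\<close> e by simp
    then have "\<gamma> = c" using rim_moves_meet(2)[OF P b' bc(1), of x] gx bc(2,3) e by simp
    then show False using near gx \<open>x + int e \<le> \<gamma>1\<close> unfolding excess_def by (simp split: if_splits)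
  qed
  show ?thesis unfolding run_free_def
  proof (intro allI impI, rule ccontr)
    fix x assume x: "\<gamma> < x" and "\<nexists>y. x \<le> y \<and> y < x + int e \<and> y \<notin> M"
    then have run: "\<And>y. x \<le> y \<Longrightarrow> y < x + int e \<Longrightarrow> y \<in> M" by blast
    have "x \<in> M" using run e by simp
    from rim_moves_cover[OF P this x] obtain b c where bc: "(b, c) \<in> P" "c < x" "x \<le> b" .
    note D = rim_movesD[OF P bc(1)]
    let ?z = "x + int e - 1"
    have "?z \<in> M" "\<gamma> < ?z" using run[of ?z] e x by auto
    from rim_moves_cover[OF P this] obtain b' c' where bc': "(b', c') \<in> P" "c' < ?z" "?z \<le> b'" .
    have "?z \<le> b"
    proof (rule ccontr)
      assume "\<not> ?z \<le> b"
      then have "b < c'" using rim_moves_disjoint[OF P bc(1) bc'(1)] bc bc' e by auto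
      then have "c' \<in> M" using run[of c'] bc(3) bc'(2) by simp
      then show False using rim_movesD(4)[OF P bc'(1)] by blast
    qed
    show False
    proof (cases "x + int e \<le> b")
      case True
      then show False using inside[OF bc(1,2)] run by blast
    next
      case False
      then have b: "b = ?z" using \<open>?z \<le> b\<close> by simp
      show False
      proof (cases "c < x - 1")
        case True
        have "x - 1 \<in> M" using D(6)[of "x - 1"] True b e by simp
        then have "y \<in> M" if "x - 1 \<le> y" "y < x - 1 + int e" for y
          using run[of y] that by (cases "y = x - 1") auto
        then show False using inside[OF bc(1) True] b by simp
      next
        case False
        then have c: "c = x - 1" using bc(2) by simp
        have be: "b = c + int e" using b c by simp
        have N: "y \<in> ?N" if "c \<le> y" "y < c + int e" for y
        proof (cases "y = c")
          case True
          then show ?thesis using bc(1) by (blast intro: moved_snd)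
        next
          case False
          then show ?thesis using moved_inside[OF P bc(1), of y] run[of y] that c be by simp
        qed
        then have "\<not> \<gamma>1 < c" using rf unfolding run_free_def by blast
        then have "b \<le> \<gamma>1" using N[of \<gamma>1] fg1 be unfolding first_gap_def by force
        moreover have "\<gamma>1 \<le> b" by (rule ge[OF moved_fst[OF P bc(1)]])
        ultimately have b1: "\<gamma>1 = b" by simp
        then obtain b' where b': "(b', \<gamma>) \<in> P" using low D(1,2) by auto
        have "b \<le> b'" using ge[OF moved_fst[OF P b']] b1 by simp
        then have "b' = b" "\<gamma> = c" using rim_moves_meet[OF P b' bc(1), of c] D(1,2) by auto
        then have "\<not> int e dvd rim_length P" using near b1 be unfolding excess_def by auto
        then obtain b0 where b0: "(b0, \<gamma>) \<in> P" "\<not> int e dvd b0 - \<gamma>" using rim_not_dvdE[OF P] by blast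
        have "b0 = b" using rim_moves_snd_inj[OF P b' b0(1)] \<open>b' = b\<close> by simp
        then show False using b0(2) \<open>\<gamma> = c\<close> be by simp
      qed
    qed
  qed
qed

text \<open>The backward construction gives the right size of the rim modulo \<open>e\<close>. The bounds on
  \<open>rim_end\<close> confine both the prescribed size and the actual one to the same window of \<open>e\<close>
  values, so they agree.\<close>

lemma moves_reversible:
  assumes fg1: "first_gap N \<gamma>1" and rf: "run_free e N \<gamma>1" and e: "1 \<le> e"
    and fin: "finite {x \<in> N. \<gamma> \<le> x}" and Q: "rim_moves e N \<gamma>1 Q"
    and gap: "excess e a \<le> \<gamma>1 - \<gamma>" "\<gamma>1 - \<gamma> < int e + excess e a"
    and ends: "excess e a \<le> \<gamma> + a + excess e a - 1 - rim_end e \<gamma>1 Q"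
      "\<gamma> + a + excess e a - 1 - rim_end e \<gamma>1 Q < int e + excess e a"
  shows "\<exists>M P. first_gap M \<gamma> \<and> rim_moves e M \<gamma> P \<and> moved M P = N \<and> run_free e M \<gamma> \<and> rim_length P = a"
proof -
  have gle: "\<gamma> \<le> \<gamma>1" using gap(1) unfolding excess_def by (auto split: if_splits)
  have below: "x \<in> N" if "x < \<gamma>" for x using fg1 gle that unfolding first_gap_def by auto
  have cut: "\<gamma> \<in> N" if "\<not> int e dvd a"
    using fg1 gap(1) that unfolding first_gap_def excess_def by auto
  obtain P where P: "backward_moves e N \<gamma> P"
    "if int e dvd a then \<forall>b c. (b, c) \<in> P \<longrightarrow> int e dvd b - c
     else \<exists>b0. (b0, \<gamma>) \<in> P \<and> int e dvd \<gamma> + a - b0"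
    using backward_moves_exist[OF fin e cut] by blast
  define M where "M = N - snd ` P \<union> fst ` P"
  have F: "first_gap M \<gamma>" "rim_moves e M \<gamma> P" "moved M P = N"
    unfolding M_def using forward_of_backward_moves[OF P(1)] below by auto
  have d: "int e dvd rim_length P - a"
  proof (cases "int e dvd a")
    case True
    then have "int e dvd rim_length P" using rim_length_dvd_iff[OF F(2)] P(2) by simp
    then show ?thesis using True by simp
  next
    case False
    then obtain b0 where b0: "(b0, \<gamma>) \<in> P" "int e dvd \<gamma> + a - b0" using P(2) by auto
    have "\<not> int e dvd b0 - \<gamma>"
    proof
      assume "int e dvd b0 - \<gamma>"
      then have "int e dvd (\<gamma> + a - b0) + (b0 - \<gamma>)" using b0(2) dvd_add by blast
      then show False using False by simp
    qed
    then have "int e dvd \<gamma> + rim_length P - b0" using rim_cut_sum(1)[OF F(2) b0(1)] by blast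
    then have "int e dvd (\<gamma> + rim_length P - b0) - (\<gamma> + a - b0)" using b0(2) dvd_diff by blast
    then show ?thesis by simp
  qed
  have same: "excess e (rim_length P) = excess e a"
  proof -
    have "int e dvd rim_length P \<longleftrightarrow> int e dvd a"
      using d by (metis diff_add_cancel dvd_add_right_iff)
    then show ?thesis unfolding excess_def by simp
  qed
  have "run_free e M \<gamma>"
    by (rule run_free_before_moves[OF F(1,2) e]) (use F(3) fg1 rf gap(2) same in auto)
  moreover have "rim_length P = a"
  proof -
    note B = rim_end_bounds[OF F(1,2) e, of \<gamma>1 Q, unfolded F(3), OF fg1 Q]
    have "\<bar>rim_length P - a\<bar> < int e" using B ends unfolding same unfolding rim_end_def[of e \<gamma> P] same by linarith
    then show ?thesis using d dvd_imp_le_int[of "rim_length P - a" "int e"] by force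
  qed
  ultimately show ?thesis using F by blast
qed

text \<open>Where a filled gap \<open>c\<close> came from is determined by the result: the next gap on its runner, or
  on the runner prescribed by the size of the rim. So two preimages cannot differ at a lowest
  position.\<close>

lemma moves_injective:
  assumes fg: "first_gap M1 \<gamma>" "first_gap M2 \<gamma>" and P1: "rim_moves e M1 \<gamma> P1" and P2: "rim_moves e M2 \<gamma> P2"
    and N: "moved M1 P1 = moved M2 P2" and len: "rim_length P1 = rim_length P2"
  shows "M1 = M2"
proof -
  have target_le: "\<not> b1 < b2" if P1: "rim_moves e M1 \<gamma> P1" and P2: "rim_moves e M2 \<gamma> P2"
    and N: "moved M1 P1 = moved M2 P2" and len: "rim_length P1 = rim_length P2"
    and m1: "(b1, c) \<in> P1" and m2: "(b2, c) \<in> P2" for M1 P1 M2 P2 b1 b2 c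
  proof
    assume "b1 < b2"
    have "int e dvd b2 - b1"
    proof (cases "int e dvd rim_length P1")
      case True
      then have "int e dvd b1 - c" "int e dvd b2 - c"
        using rim_length_dvd_iff[OF P1] rim_length_dvd_iff[OF P2] len m1 m2 by auto
      then have "int e dvd (b2 - c) - (b1 - c)" using dvd_diff by blast
      then show ?thesis by simp
    next
      case False
      show ?thesis
      proof (cases "c = \<gamma>")
        case True
        obtain x where x: "(x, \<gamma>) \<in> P1" "int e dvd \<gamma> + rim_length P1 - x"
          using rim_not_dvdE[OF P1 False] by blast
        obtain y where y: "(y, \<gamma>) \<in> P2" "int e dvd \<gamma> + rim_length P1 - y"
          using rim_not_dvdE[OF P2] False len by metis
        have "x = b1" "y = b2" using rim_moves_snd_inj[OF P1] rim_moves_snd_inj[OF P2] x y m1 m2 True by blast+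
        then have "int e dvd (\<gamma> + rim_length P1 - b1) - (\<gamma> + rim_length P1 - b2)" using x y dvd_diff by blast
        then show ?thesis by simp
      next
        case False
        then have "int e dvd b1 - c" "int e dvd b2 - c"
          using rim_movesD(5)[OF P1 m1] rim_movesD(5)[OF P2 m2] by auto
        then have "int e dvd (b2 - c) - (b1 - c)" using dvd_diff by blast
        then show ?thesis by simp
      qed
    qed
    moreover have "c < b1" using rim_movesD(2)[OF P1 m1] .
    ultimately have "b1 \<in> M2" "b1 \<in> moved M2 P2"
      using rim_movesD(6)[OF P2 m2, of b1] moved_inside[OF P2 m2, of b1] \<open>b1 < b2\<close> by auto
    then show False using moved_fst[OF P1 m1] N by simp
  qed
  have target: "b1 = b2" if "(b1, c) \<in> P1" "(b2, c) \<in> P2" for b1 b2 c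
    using target_le[OF P1 P2 N len that] target_le[OF P2 P1 N[symmetric] len[symmetric] that(2,1)] by simp
  have lowest: False if fg: "first_gap M1 \<gamma>" "first_gap M2 \<gamma>"
    and P1: "rim_moves e M1 \<gamma> P1" and P2: "rim_moves e M2 \<gamma> P2"
    and N: "moved M1 P1 = moved M2 P2"
    and target: "\<And>b1 b2 c. (b1, c) \<in> P1 \<Longrightarrow> (b2, c) \<in> P2 \<Longrightarrow> b1 = b2"
    and agree: "\<And>y. y < x \<Longrightarrow> y \<in> M1 \<longleftrightarrow> y \<in> M2" and x: "x \<in> M1" "x \<notin> M2" for M1 M2 P1 P2 x
  proof -
    have gx: "\<gamma> < x" using fg x unfolding first_gap_def by (metis linorder_neqE)
    show False
    proof (cases "x \<in> moved M1 P1")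
      case False
      then obtain c where c: "(x, c) \<in> P1" using x(1) unfolding moved_iff by blast
      have "c \<notin> M2" using rim_movesD(2,4)[OF P1 c] agree[of c] by blast
      moreover have "c \<in> moved M2 P2" using moved_snd[OF c, of M1] N by simp
      ultimately obtain b where "(b, c) \<in> P2" unfolding moved_iff by blast
      then show False using target[OF c] rim_movesD(3)[OF P2] x(2) by blast
    next
      case True
      then have "x \<in> moved M2 P2" using N by simp
      then obtain b2 where b2: "(b2, x) \<in> P2" using x(2) unfolding moved_iff by blast
      from rim_moves_cover[OF P1 x(1) gx] obtain b c where bc: "(b, c) \<in> P1" "c < x" "x \<le> b" .
      have "c \<notin> M2" using rim_movesD(4)[OF P1 bc(1)] agree[OF bc(2)] by blast
      moreover have "c \<in> moved M2 P2" using moved_snd[OF bc(1), of M1] N by simp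
      ultimately obtain b' where b': "(b', c) \<in> P2" unfolding moved_iff by blast
      then have "(b, c) \<in> P2" using target[OF bc(1) b'] by simp
      then show False using rim_moves_disjoint[OF P2 _ b2, of b c] rim_movesD(2)[OF P2 b2] bc by auto
    qed
  qed
  show ?thesis
  proof (rule ccontr)
    assume "M1 \<noteq> M2"
    define d where "d n \<longleftrightarrow> (\<gamma> + int n \<in> M1) \<noteq> (\<gamma> + int n \<in> M2)" for n
    obtain x where x: "(x \<in> M1) \<noteq> (x \<in> M2)" using \<open>M1 \<noteq> M2\<close> by blast
    then have "\<gamma> \<le> x" using fg unfolding first_gap_def by force
    then have "d (nat (x - \<gamma>))" using x unfolding d_def by simp
    define n where "n = (LEAST n. d n)"
    have n: "d n" unfolding n_def by (rule LeastI) fact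
    have agree: "y \<in> M1 \<longleftrightarrow> y \<in> M2" if "y < \<gamma> + int n" for y
    proof (cases "y < \<gamma>")
      case True
      then show ?thesis using fg unfolding first_gap_def by blast
    next
      case False
      then have "\<not> d (nat (y - \<gamma>))" using not_less_Least[of "nat (y - \<gamma>)" d] that unfolding n_def by simp
      then show ?thesis using False unfolding d_def by simp
    qed
    consider "\<gamma> + int n \<in> M1" "\<gamma> + int n \<notin> M2" | "\<gamma> + int n \<in> M2" "\<gamma> + int n \<notin> M1"
      using n unfolding d_def by blast
    then show False
    proof cases
      case 1
      show False by (rule lowest[OF fg P1 P2 N target agree 1])
    next
      case 2
      show False by (rule lowest[OF fg(2,1) P2 P1 N[symmetric] target[symmetric] agree[symmetric] 2])
    qed
  qed
qed

section \<open>Existence and uniqueness of the Mullineux image\<close>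

text \<open>Sum over the beads that are present in the display with \<open>n\<close> beads.\<close>

definition wsum :: "int \<Rightarrow> (int \<Rightarrow> int) \<Rightarrow> int set \<Rightarrow> int" where
  "wsum n f M = (\<Sum>x | x \<in> M \<and> - n \<le> x. f x)"

lemma wsum_exchange:
  assumes fin: "finite {x \<in> M. - n \<le> x}" and XY: "finite X" "finite Y" "X \<subseteq> M" "Y \<inter> M = {}"
    and ge: "\<And>x. x \<in> X \<union> Y \<Longrightarrow> - n \<le> x"
  shows "wsum n f (M - X \<union> Y) = wsum n f M - sum f X + sum f Y"
proof -
  let ?W = "{x \<in> M. - n \<le> x}"
  have "{x. x \<in> M - X \<union> Y \<and> - n \<le> x} = (?W - X) \<union> Y" using ge by auto
  then have "wsum n f (M - X \<union> Y) = sum f ((?W - X) \<union> Y)" unfolding wsum_def by simp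
  also have "\<dots> = sum f (?W - X) + sum f Y"
    using XY fin by (intro sum.union_disjoint) auto
  also have "sum f (?W - X) = sum f ?W - sum f X"
    using XY(3) ge fin by (intro sum_diff) auto
  finally show ?thesis unfolding wsum_def by simp
qed

lemma wsum_moved:
  assumes P: "rim_moves e M \<gamma> P" and fin: "finite {x \<in> M. - n \<le> x}" and n: "- n \<le> \<gamma>"
  shows "wsum n f (moved M P) = wsum n f M - (\<Sum>(b, c)\<in>P. f b - f c)"
proof -
  have "- n \<le> x" if "x \<in> fst ` P \<union> snd ` P" for x
    using that rim_movesD(1,2)[OF P] n by force
  moreover have "fst ` P \<subseteq> M" "snd ` P \<inter> M = {}" using rim_movesD(3,4)[OF P] by auto
  ultimately have "wsum n f (moved M P) = wsum n f M - sum f (fst ` P) + sum f (snd ` P)"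
    unfolding moved_def using rim_moves_finite[OF P] fin by (intro wsum_exchange) auto
  also have "sum f (fst ` P) = (\<Sum>(b, c)\<in>P. f b)"
    by (subst sum.reindex[OF inj_on_fst_rim_moves[OF P]]) (simp add: split_beta)
  also have "sum f (snd ` P) = (\<Sum>(b, c)\<in>P. f c)"
    by (subst sum.reindex[OF inj_on_snd_rim_moves[OF P]]) (simp add: split_beta)
  finally show ?thesis by (simp add: sum_subtractf split_beta)
qed

lemma wsum_flip_moved:
  assumes fg: "first_gap M \<gamma>" and P: "rim_moves e M \<gamma> P" and n: "\<And>x. x \<in> M \<Longrightarrow> x < n"
  shows "wsum n f (flip (moved M P)) = wsum n f (flip M) - (\<Sum>(b, c)\<in>P. f (- 1 - c) - f (- 1 - b))"
proof -
  let ?r = "\<lambda>x :: int. - 1 - x"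
  have inj: "inj ?r" by (simp add: inj_def)
  have "{x \<in> flip M. - n \<le> x} \<subseteq> {- n..- 1 - \<gamma>}"
    using fg unfolding flip_def first_gap_def by force
  then have fin: "finite {x \<in> flip M. - n \<le> x}" using finite_subset by blast
  have r_mem: "x \<in> ?r ` A \<longleftrightarrow> - 1 - x \<in> A" for x A by force
  have "flip (moved M P) = flip M - ?r ` (snd ` P) \<union> ?r ` (fst ` P)"
  proof (rule set_eqI)
    fix x
    have "y \<in> fst ` P \<Longrightarrow> y \<in> M" "y \<in> snd ` P \<Longrightarrow> y \<notin> M" for y using rim_movesD(3,4)[OF P] by auto
    then show "x \<in> flip (moved M P) \<longleftrightarrow> x \<in> flip M - ?r ` (snd ` P) \<union> ?r ` (fst ` P)"
      unfolding flip_def moved_def Un_iff Diff_iff r_mem mem_Collect_eq by blast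
  qed
  moreover have "- n \<le> x" if "x \<in> ?r ` (snd ` P) \<union> ?r ` (fst ` P)" for x
    using that rim_movesD(2,3)[OF P] n by force
  moreover have "?r ` (snd ` P) \<subseteq> flip M" "?r ` (fst ` P) \<inter> flip M = {}"
    using rim_movesD(3,4)[OF P] unfolding flip_def by auto
  ultimately have "wsum n f (flip (moved M P)) =
      wsum n f (flip M) - sum f (?r ` (snd ` P)) + sum f (?r ` (fst ` P))"
    using rim_moves_finite[OF P] fin by (simp only:) (intro wsum_exchange, auto)
  also have "sum f (?r ` (fst ` P)) = (\<Sum>(b, c)\<in>P. f (- 1 - b))"
    by (subst sum.reindex[OF inj_on_subset[OF inj]], simp, subst sum.reindex[OF inj_on_fst_rim_moves[OF P]])
      (simp add: split_beta)
  also have "sum f (?r ` (snd ` P)) = (\<Sum>(b, c)\<in>P. f (- 1 - c))"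
    by (subst sum.reindex[OF inj_on_subset[OF inj]], simp, subst sum.reindex[OF inj_on_snd_rim_moves[OF P]])
      (simp add: split_beta)
  finally show ?thesis by (simp add: sum_subtractf split_beta)
qed

lemma rim_length_nonneg:
  assumes "rim_moves e M \<gamma> P"
  shows "0 \<le> rim_length P"
  unfolding rim_length_def by (rule sum_nonneg) (use rim_movesD(2)[OF assms] in force)

lemma rim_length_pos:
  assumes P: "rim_moves e M \<gamma> P" and "x \<in> M" "\<gamma> < x"
  shows "0 < rim_length P"
proof -
  have "P \<noteq> {}" using rim_moves_cover[OF P assms(2,3)] by blast
  then show ?thesis unfolding rim_length_def
    by (intro sum_pos) (use rim_moves_finite[OF P] rim_movesD(2)[OF P] in force)+
qed

lemma is_partition_empty: "is_partition empty_partition"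
  unfolding is_partition_def empty_partition_def by (simp add: antimono_def)

lemma num_parts_empty: "num_parts empty_partition = 0"
  using partition_empty_iff[OF is_partition_empty] by simp

lemma maya_empty: "maya empty_partition = {..<0}"
proof (intro equalityI subsetI)
  fix x :: int assume "x \<in> {..<0}"
  then have "x = int (empty_partition (nat (- 1 - x))) - int (nat (- 1 - x)) - 1"
    unfolding empty_partition_def by simp
  then show "x \<in> maya empty_partition" unfolding maya_def by blast
qed (auto simp: maya_def empty_partition_def)

lemma rim_moves_empty:
  assumes "rim_moves e (maya empty_partition) 0 P"
  shows "P = {}"
proof (rule ccontr)
  assume "P \<noteq> {}"
  then obtain b c where "(b, c) \<in> P" by auto
  from rim_movesD(1,2,3)[OF assms this] show False unfolding maya_empty by simp
qed

definition rim_data :: "nat \<Rightarrow> (nat \<Rightarrow> nat) \<Rightarrow> (int \<times> int) set \<Rightarrow> bool" where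
  "rim_data e p P \<longleftrightarrow> is_partition p \<and> rim_moves e (maya p) (- int (num_parts p)) P"

lemma rim_data_exists: "is_partition p \<Longrightarrow> 1 \<le> e \<Longrightarrow> \<exists>P. rim_data e p P"
  unfolding rim_data_def using rim_moves_maya_exists by blast

lemma rim_data_pos:
  assumes "rim_data e p P" "p \<noteq> empty_partition"
  shows "0 < rim_length P"
proof -
  obtain x where "x \<in> maya p" "- int (num_parts p) < x"
    using bead_above_first_gap assms unfolding rim_data_def by blast
  then show ?thesis using rim_length_pos assms(1) unfolding rim_data_def by blast
qed

lemma rim_data_empty:
  assumes "rim_data e empty_partition P"
  shows "rim_length P = 0"
  using rim_moves_empty assms unfolding rim_data_def num_parts_empty by (force simp: rim_length_def)

lemma rim_data_triangle:
  assumes P: "rim_data e p P" and ne: "p \<noteq> empty_partition" and e: "1 \<le> e"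
  shows "int (rim e p) = rim_length P" "is_partition (triangle e p)" "maya (triangle e p) = moved (maya p) P"
    "first_gap (moved (maya p) P) (- int (num_parts (triangle e p)))"
    "num_parts (triangle e p) \<le> num_parts p"
proof -
  have p: "is_partition p" and P': "rim_moves e (maya p) (- int (num_parts p)) P"
    using P unfolding rim_data_def by auto
  note T = rim_triangle[OF p ne e P']
  show "int (rim e p) = rim_length P" "is_partition (triangle e p)" "maya (triangle e p) = moved (maya p) P"
    by (fact T)+
  show fg: "first_gap (moved (maya p) P) (- int (num_parts (triangle e p)))"
    using first_gap_maya[OF T(2)] T(3) by simp
  show "num_parts (triangle e p) \<le> num_parts p"
    using first_gap_moved_ge[OF first_gap_maya[OF p] P' fg] by simp
qed

lemma triangle_regular:
  assumes P: "rim_data e p P" and ne: "p \<noteq> empty_partition" and e: "1 \<le> e" and reg: "regular e p"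
  shows "regular e (triangle e p)"
proof -
  have p: "is_partition p" and P': "rim_moves e (maya p) (- int (num_parts p)) P"
    using P unfolding rim_data_def by auto
  note T = rim_data_triangle[OF P ne e]
  show ?thesis
    using moved_run_free[OF first_gap_maya[OF p] P' _ T(4)] reg regular_iff_run_free[OF p e]
      regular_iff_run_free[OF T(2) e] T(3) by simp
qed

text \<open>The bounds for \<open>p\<close> and the induction hypothesis, with the two kinds of bounds exchanged, are
  exactly the hypotheses under which a step can be undone. The induction is on the sum of the
  bead positions in a display with a fixed number \<open>R\<close> of beads, which drops by the size of the rim.\<close>

lemma mullineux_exists:
  assumes "is_partition p" "regular e p" and e: "1 \<le> e" and "num_parts p \<le> R" and P: "rim_data e p P"
  shows "\<exists>q Q. mullineux_graph e p q \<and> rim_data e q Q \<and> regular e q \<and> rim_length Q = rim_length P \<and>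
    int (num_parts q) + int (num_parts p) = rim_length P + excess e (rim_length P)"
  using assms(1,2,4,5)
proof (induction "nat (wsum (int R) (\<lambda>x. x + int R) (maya p))" arbitrary: p P rule: less_induct)
  case less
  note p = less(2) and reg = less(3) and R = less(4) and P = less(5)
  show ?case
  proof (cases "p = empty_partition")
    case True
    have "regular e empty_partition" unfolding regular_def empty_partition_def by simp
    moreover have "rim_length P = 0" using P rim_data_empty unfolding True by blast
    ultimately show ?thesis
      using mullineux_graph.empty[of e] P unfolding True
      by (intro exI[of _ empty_partition] exI[of _ P]) (simp add: num_parts_empty excess_def)
  next
    case False
    define a where "a = rim_length P"
    have P': "rim_moves e (maya p) (- int (num_parts p)) P" using P unfolding rim_data_def by auto
    note T = rim_data_triangle[OF P False e]
    let ?t = "triangle e p"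
    have regt: "regular e ?t" by (rule triangle_regular[OF P False e reg])
    obtain S where S: "rim_data e ?t S" using rim_data_exists[OF T(2) e] by blast
    then have S': "rim_moves e (moved (maya p) P) (- int (num_parts ?t)) S" unfolding rim_data_def T(3) by blast
    have "wsum (int R) (\<lambda>x. x + int R) (maya ?t) = wsum (int R) (\<lambda>x. x + int R) (maya p) - a"
      using wsum_moved[OF P' finite_maya_above[OF p], of "int R" "\<lambda>x. x + int R"] R
      unfolding T(3) a_def rim_length_def by simp
    moreover have "0 < a" unfolding a_def by (rule rim_data_pos[OF P False])
    moreover have "0 \<le> wsum (int R) (\<lambda>x. x + int R) (maya ?t)"
      unfolding wsum_def by (rule sum_nonneg) auto
    ultimately have "nat (wsum (int R) (\<lambda>x. x + int R) (maya ?t)) < nat (wsum (int R) (\<lambda>x. x + int R) (maya p))"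
      by linarith
    from less(1)[OF this T(2) regt _ S] T(5) R obtain q1 Q1 where
      q1: "mullineux_graph e ?t q1" "rim_data e q1 Q1" "regular e q1" "rim_length Q1 = rim_length S"
        "int (num_parts q1) + int (num_parts ?t) = rim_length S + excess e (rim_length S)"
      by auto
    have q1p: "is_partition q1" and Q1': "rim_moves e (maya q1) (- int (num_parts q1)) Q1"
      using q1(2) unfolding rim_data_def by auto
    define \<gamma> where "\<gamma> = int (num_parts p) - a - excess e a"
    note A = first_gap_moved_bounds[OF first_gap_maya[OF p] P' _ T(4), folded a_def]
    note B = rim_end_bounds[OF first_gap_maya[OF p] P' e T(4) S', folded a_def, unfolded rim_end_def, folded a_def]
    have rf: "run_free e (maya p) (- int (num_parts p))" using regular_iff_run_free[OF p e] reg by simp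
    have rf1: "run_free e (maya q1) (- int (num_parts q1))" using regular_iff_run_free[OF q1p e] q1(3) by simp
    have "\<exists>M P. first_gap M \<gamma> \<and> rim_moves e M \<gamma> P \<and> moved M P = maya q1 \<and> run_free e M \<gamma> \<and> rim_length P = a"
    \<comment> \<open>Here the two kinds of bounds trade places: the first gap for the image is governed by \<open>rim_end\<close> of \<open>p\<close>.\<close>
    proof (rule moves_reversible[OF first_gap_maya[OF q1p] rf1 e finite_maya_above[OF q1p] Q1'])
      show "excess e a \<le> - int (num_parts q1) - \<gamma>" "- int (num_parts q1) - \<gamma> < int e + excess e a"
        using B q1(5) unfolding \<gamma>_def by linarith+
      show "excess e a \<le> \<gamma> + a + excess e a - 1 - rim_end e (- int (num_parts q1)) Q1"
        "\<gamma> + a + excess e a - 1 - rim_end e (- int (num_parts q1)) Q1 < int e + excess e a"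
        using A[OF rf] q1(5) unfolding \<gamma>_def rim_end_def q1(4) by linarith+
    qed
    then obtain M Q where M: "first_gap M \<gamma>" "rim_moves e M \<gamma> Q" "moved M Q = maya q1" "run_free e M \<gamma>"
      "rim_length Q = a" by blast
    obtain q where q: "is_partition q" "maya q = maya q1 - snd ` Q \<union> fst ` Q"
    proof (rule partition_of_moved_maya[OF q1p, of "snd ` Q" "fst ` Q"])
      show "finite (snd ` Q)" "finite (fst ` Q)" using rim_moves_finite[OF M(2)] by auto
      show "snd ` Q \<subseteq> maya q1" unfolding M(3)[symmetric] moved_def by blast
      show "fst ` Q \<inter> maya q1 = {}" unfolding M(3)[symmetric] using moved_fst[OF M(2)] by auto
      show "card (snd ` Q) = card (fst ` Q)" using card_moved[OF M(2)] by simp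
    qed
    have "maya q1 - snd ` Q \<union> fst ` Q = M"
      unfolding M(3)[symmetric] moved_def using rim_movesD(3,4)[OF M(2)] by force
    then have qM: "maya q = M" using q(2) by simp
    have \<gamma>: "\<gamma> = - int (num_parts q)"
      using first_gap_unique[OF M(1)] first_gap_maya[OF q(1)] qM by simp
    have Q: "rim_data e q Q" unfolding rim_data_def using q(1) M(2) qM \<gamma> by simp
    have regq: "regular e q" using regular_iff_run_free[OF q(1) e] M(4) qM \<gamma> by simp
    have neq: "q \<noteq> empty_partition" using rim_data_empty Q M(5) \<open>0 < a\<close> by force
    note Tq = rim_data_triangle[OF Q neq e]
    have tq: "triangle e q = q1" by (rule maya_inj[OF Tq(2) q1p]) (use Tq(3) qM M(3) in simp)
    have num: "int (num_parts q) + int (num_parts p) = a + excess e a" using \<gamma> \<gamma>_def by simp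
    have rims: "int (rim e p) = a" "int (rim e q) = a" using T(1) Tq(1) M(5) a_def by auto
    have "e dvd rim e p \<longleftrightarrow> int e dvd a" unfolding rims(1)[symmetric] by simp
    then have "num_parts q + num_parts p = (if e dvd rim e p then rim e p else rim e p + 1)"
      using num rims(1) unfolding excess_def by (auto split: if_splits)
    then have "mullineux_graph e p q"
      using rims tq p reg False q1(1) q(1) regq neq by (intro mullineux_graph.step[of p e q1 q]) auto
    then show ?thesis using Q regq M(5) num unfolding a_def by blast
  qed
qed

lemma mullineux_graph_unique:
  assumes e: "1 \<le> e"
  shows "mullineux_graph e p q \<Longrightarrow> mullineux_graph e p q' \<Longrightarrow> q = q'"
proof (induction arbitrary: q' rule: mullineux_graph.induct)
  case empty
  then show ?case by (cases rule: mullineux_graph.cases) auto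
next
  case outer: (step p \<rho> q)
  from outer.prems show ?case
  proof (cases rule: mullineux_graph.cases)
    case empty
    then show ?thesis using outer.hyps by simp
  next
    case inner: (step \<rho>')
    have \<rho>: "triangle e q = triangle e q'" using outer.IH[OF inner(4)] outer.hyps inner by simp
    have num: "num_parts q = num_parts q'" and len: "rim e q = rim e q'"
      using outer.hyps inner by linarith+
    obtain Q where Q: "rim_data e q Q" using rim_data_exists[OF _ e] outer.hyps by blast
    obtain Q' where Q': "rim_data e q' Q'" using rim_data_exists[OF _ e] inner by blast
    have ne: "q \<noteq> empty_partition" "q' \<noteq> empty_partition" using outer.hyps inner by auto
    note T = rim_data_triangle[OF Q ne(1) e] and T' = rim_data_triangle[OF Q' ne(2) e]
    have part: "is_partition q" "is_partition q'" and moves: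
      "rim_moves e (maya q) (- int (num_parts q)) Q" "rim_moves e (maya q') (- int (num_parts q)) Q'"
      using Q Q' num unfolding rim_data_def by auto
    have gaps: "first_gap (maya q) (- int (num_parts q))" "first_gap (maya q') (- int (num_parts q))"
      unfolding num[symmetric] using first_gap_maya[OF part(1)] first_gap_maya[OF part(2)] num by simp_all
    have "maya q = maya q'"
      by (rule moves_injective[OF gaps moves]) (use T T' \<rho> len in simp_all)
    then show ?thesis by (rule maya_inj[OF part])
  qed
qed

lemma mullineux_graph_mullineux:
  assumes "is_partition p" "regular e p" "1 \<le> e"
  shows "mullineux_graph e p (mullineux e p)"
proof -
  obtain P where "rim_data e p P" using rim_data_exists assms by blast
  then obtain q where "mullineux_graph e p q" using mullineux_exists[OF assms order_refl] by blast
  then show ?thesis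
    unfolding mullineux_def using mullineux_graph_unique[OF assms(3)] by (metis the_equality)
qed

section \<open>Sums over beads that a partition shares with its Mullineux image\<close>

lemma mullineux_graph_partition:
  "mullineux_graph e p q \<Longrightarrow> is_partition p \<and> is_partition q"
  by (induction rule: mullineux_graph.induct) (auto simp: is_partition_empty)

text \<open>What the recursion says about one step, in terms of beads.\<close>

lemma mullineux_step_moves:
  assumes e: "1 \<le> e" and p: "is_partition p" "p \<noteq> empty_partition"
    and q: "is_partition q" "q \<noteq> empty_partition"
    and num: "num_parts q + num_parts p = (if e dvd rim e p then rim e p else rim e p + 1)"
    and len: "rim e q = rim e p"
  shows "\<exists>P Q. rim_moves e (maya p) (- int (num_parts p)) P \<and> rim_moves e (maya q) (- int (num_parts q)) Q \<and>
    maya (triangle e p) = moved (maya p) P \<and> maya (triangle e q) = moved (maya q) Q \<and>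
    rim_length Q = rim_length P \<and>
    int (num_parts q) + int (num_parts p) = rim_length P + excess e (rim_length P) \<and>
    num_parts (triangle e p) \<le> num_parts p \<and>
    (\<forall>n. (\<forall>x\<in>maya q. x < n) \<longrightarrow> (\<forall>x\<in>maya (triangle e q). x < n))"
proof -
  obtain P where P: "rim_data e p P" using rim_data_exists[OF p(1) e] by blast
  obtain Q where Q: "rim_data e q Q" using rim_data_exists[OF q(1) e] by blast
  note T = rim_data_triangle[OF P p(2) e] and T' = rim_data_triangle[OF Q q(2) e]
  have "e dvd rim e p \<longleftrightarrow> int e dvd rim_length P" unfolding T(1)[symmetric] by simp
  then have "int (num_parts q) + int (num_parts p) = rim_length P + excess e (rim_length P)"
    using num T(1) unfolding excess_def by (auto split: if_splits)
  moreover have "rim_length Q = rim_length P" using T(1) T'(1) len by simp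
  moreover have "x < n" if "\<forall>x\<in>maya q. x < n" "x \<in> maya (triangle e q)" for x n
  proof -
    have "x \<in> maya q \<or> (\<exists>b. (b, x) \<in> Q)" using that(2) unfolding T'(3) moved_iff by blast
    moreover have "x < b \<and> b \<in> maya q" if "(b, x) \<in> Q" for b
      using Q rim_movesD(2,3) that unfolding rim_data_def by blast
    ultimately show ?thesis using that(1) by force
  qed
  ultimately show ?thesis
    using P Q T(5) unfolding rim_data_def by (intro exI[of _ P] exI[of _ Q] conjI T(3) T'(3)) auto
qed

lemma finite_flip_maya_above:
  assumes "is_partition q"
  shows "finite {x \<in> flip (maya q). l \<le> x}"
  using finite_maya_above[OF is_partition_conjugate[OF assms]] maya_conjugate[OF assms] by simp

text \<open>On the side of \<open>p\<close> one step acts like a move from \<open>\<gamma> + a\<close> to \<open>\<gamma>\<close>, where \<open>a\<close> is the size of the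
  rim. On the side of \<open>q\<close>, conjugated, it acts like a move of length \<open>a\<close> from the last bead; that
  is the same move if \<open>e\<close> does not divide \<open>a\<close>, and a move of \<open>a / e\<close> periods otherwise. Functions
  that are constant on runners give equality of cores, functions with increment 1 equality of
  residue contents.\<close>

lemma wsum_mullineux:
  assumes e: "1 \<le> e" and f: "\<And>x. f (x + int e) = f x + w"
  shows "mullineux_graph e p q \<Longrightarrow> int (num_parts p) \<le> n \<Longrightarrow> (\<And>x. x \<in> maya q \<Longrightarrow> x < n) \<Longrightarrow>
    wsum n f (maya p) = wsum n f (flip (maya q))"
proof (induction rule: mullineux_graph.induct)
  case empty
  have "flip (maya empty_partition) = maya empty_partition" unfolding maya_empty flip_def by auto
  then show ?case by simp
next
  case (step p \<rho> q)
  obtain P Q where P: "rim_moves e (maya p) (- int (num_parts p)) P"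
    and Q: "rim_moves e (maya q) (- int (num_parts q)) Q"
    and T: "maya (triangle e p) = moved (maya p) P" "maya (triangle e q) = moved (maya q) Q"
    and len: "rim_length Q = rim_length P"
    and num: "int (num_parts q) + int (num_parts p) = rim_length P + excess e (rim_length P)"
    and bounds: "num_parts (triangle e p) \<le> num_parts p"
      "\<forall>n. (\<forall>x\<in>maya q. x < n) \<longrightarrow> (\<forall>x\<in>maya (triangle e q). x < n)"
    using mullineux_step_moves[OF e, of p q] step.hyps by blast
  let ?a = "rim_length P" and ?\<gamma> = "- int (num_parts p)"
  have n: "- n \<le> ?\<gamma>" "\<And>x. x \<in> maya q \<Longrightarrow> x < n" using step.prems by auto
  have "\<forall>x\<in>maya \<rho>. x < n" using bounds(2) n(2) unfolding step.hyps(10) by blast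
  then have IH: "wsum n f (maya (triangle e p)) = wsum n f (flip (maya \<rho>))"
    using step.IH step.prems(1) bounds(1) by simp
  have "wsum n f (maya (triangle e p)) = wsum n f (maya p) - (f (?\<gamma> + ?a) - f ?\<gamma>)"
    using wsum_moved[OF P finite_maya_above[OF step.hyps(1)] n(1)] rim_sum[OF P, of f w] f T(1) by simp
  moreover have "wsum n f (flip (maya \<rho>)) = wsum n f (flip (maya q)) - (f (?\<gamma> + ?a) - f ?\<gamma>)"
  proof -
    define h where "h x = - f (- 1 - x)" for x
    have h: "h (x + int e) = h x + w" for x
      using f[of "- 1 - x - int e"] unfolding h_def by (simp add: algebra_simps)
    note S = rim_sum[of e "maya q" _ Q h w, OF Q h, unfolded len]
    have "(\<Sum>(b, c)\<in>Q. f (- 1 - c) - f (- 1 - b)) = (\<Sum>(b, c)\<in>Q. h b - h c)"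
      unfolding h_def by (simp add: split_beta)
    also have "\<dots> = f (int (num_parts q) - 1) - f (int (num_parts q) - 1 - ?a)"
      unfolding S unfolding h_def by (simp add: algebra_simps)
    also have "\<dots> = f (?\<gamma> + ?a) - f ?\<gamma>"
    proof (cases "int e dvd ?a")
      case False
      then have "int (num_parts q) - 1 = ?\<gamma> + ?a" using num unfolding excess_def by simp
      then show ?thesis by simp
    next
      case True
      then obtain k where k: "?a = int e * k" by blast
      have "0 \<le> k" using rim_length_nonneg[OF P] e unfolding k by (simp add: zero_le_mult_iff)
      then obtain m where a: "?a = int e * int m" using k zero_le_imp_eq_int by blast
      have q: "int (num_parts q) - 1 = (?\<gamma> - 1) + int e * int m"
        using True num unfolding excess_def a by simp
      have "f (int (num_parts q) - 1) = f (?\<gamma> - 1) + w * int m"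
        unfolding q by (rule shift_mult) (rule f)
      moreover have "f (?\<gamma> + ?a) = f ?\<gamma> + w * int m" unfolding a by (rule shift_mult) (rule f)
      moreover have e1: "int (num_parts q) - 1 - ?a = ?\<gamma> - 1" using q a by simp
      ultimately show ?thesis unfolding e1 by linarith
    qed
    finally show ?thesis
      using wsum_flip_moved[OF first_gap_maya[OF step.hyps(5)] Q n(2), of f] T(2) step.hyps(10) by simp
  qed
  ultimately show ?case using IH by simp
qed

section \<open>Counting positions on one runner\<close>

text \<open>The rounded-up quotient of \<open>x - p\<close> by \<open>e\<close>. Differences of it count the positions congruent to
  \<open>p\<close> in half-open intervals; the positive and the negative part count those at or above \<open>p\<close> and
  those below \<open>p\<close>.\<close>

definition runner_index :: "nat \<Rightarrow> int \<Rightarrow> int \<Rightarrow> int" where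
  "runner_index e p x = - ((p - x) div int e)"

abbreviation runner_pos :: "nat \<Rightarrow> int \<Rightarrow> int \<Rightarrow> int" where
  "runner_pos e p x \<equiv> max 0 (runner_index e p x)"

abbreviation runner_neg :: "nat \<Rightarrow> int \<Rightarrow> int \<Rightarrow> int" where
  "runner_neg e p x \<equiv> min 0 (runner_index e p x)"

lemma runner_index_add: "1 \<le> e \<Longrightarrow> runner_index e p (x + int e) = runner_index e p x + 1"
proof -
  assume "1 \<le> e"
  then have "((p - (x + int e)) + int e) div int e = (p - (x + int e)) div int e + 1"
    by (intro div_add_self2) simp
  moreover have "(p - (x + int e)) + int e = p - x" by simp
  ultimately show ?thesis unfolding runner_index_def by simp
qed

lemma runner_index_self: "runner_index e p p = 0"
  unfolding runner_index_def by simp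

lemma runner_index_le_0_iff: "1 \<le> e \<Longrightarrow> runner_index e p x \<le> 0 \<longleftrightarrow> x \<le> p"
  unfolding runner_index_def using pos_imp_zdiv_nonneg_iff[of "int e" "p - x"] by simp

lemma runner_index_neg_iff: "1 \<le> e \<Longrightarrow> runner_index e p x < 0 \<longleftrightarrow> x \<le> p - int e"
  using runner_index_le_0_iff[of e p "x + int e"] runner_index_add[of e p x] by auto

lemma runner_index_Suc:
  assumes "1 \<le> e"
  shows "runner_index e p (x + 1) = runner_index e p x + (if int e dvd x - p then 1 else 0)"
proof -
  define q m where "q = (p - x) div int e" and "m = (p - x) mod int e"
  have px: "p - x = int e * q + m" unfolding q_def m_def by simp
  have m: "0 \<le> m" "m < int e" unfolding m_def using assms by auto
  have "int e dvd x - p \<longleftrightarrow> m = 0" unfolding m_def by (metis dvd_diff_commute dvd_eq_mod_eq_0)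
  moreover have "(p - (x + 1)) div int e = (if m = 0 then q - 1 else q)"
  proof (cases "m = 0")
    case True
    have "p - (x + 1) = int e * (q - 1) + (int e - 1)" using px True by (simp add: algebra_simps)
    then have "(p - (x + 1)) div int e = q - 1" by (rule int_div_pos_eq) (use assms in auto)
    then show ?thesis using True by simp
  next
    case False
    have "p - (x + 1) = int e * q + (m - 1)" using px by simp
    then have "(p - (x + 1)) div int e = q" by (rule int_div_pos_eq) (use False m in auto)
    then show ?thesis using False by simp
  qed
  ultimately show ?thesis unfolding runner_index_def using q_def by simp
qed

lemma runner_index_mono:
  assumes "1 \<le> e" "x \<le> y"
  shows "runner_index e p x \<le> runner_index e p y"
  using assms(2) by (induction y rule: int_ge_induct) (auto simp: runner_index_Suc[OF assms(1)])

lemma finite_window: "finite {q \<in> {x..<y :: int}. Q q}"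
  by (rule finite_subset[of _ "{x..<y}"]) auto

lemma card_window:
  fixes g :: "int \<Rightarrow> int"
  assumes "x \<le> y" and step: "\<And>y. g (y + 1) = g y + (if Q y then 1 else 0)"
  shows "g y - g x = int (card {q \<in> {x..<y}. Q q})"
  using assms(1)
proof (induction y rule: int_ge_induct)
  case (step y)
  let ?W = "{q \<in> {x..<y}. Q q}"
  have "{q \<in> {x..<y + 1}. Q q} = (if Q y then insert y ?W else ?W)"
    using step(1) by (auto simp: less_le)
  moreover have "card (insert y ?W) = Suc (card ?W)"
    by (rule card_insert_disjoint[OF finite_window]) simp
  ultimately have "int (card {q \<in> {x..<y + 1}. Q q}) = int (card ?W) + (if Q y then 1 else 0)"
    by (simp only: split: if_split) simp
  then show ?case using step(2) assms(2)[of y] by linarith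
qed simp

lemma runner_index_dvd_sign:
  assumes "1 \<le> e"
  shows "p \<le> y \<Longrightarrow> 0 \<le> runner_index e p y" "\<not> p \<le> y \<Longrightarrow> runner_index e p (y + 1) \<le> 0"
  using runner_index_mono[OF assms, of p y p] runner_index_self[of e p] runner_index_le_0_iff[OF assms]
  by auto

lemma card_runner_pos:
  assumes e: "1 \<le> e" and "x \<le> y"
  shows "runner_pos e p y - runner_pos e p x = int (card {q \<in> {x..<y}. int e dvd q - p \<and> p \<le> q})"
proof (rule card_window[OF assms(2)])
  fix y
  show "runner_pos e p (y + 1) = runner_pos e p y + (if int e dvd y - p \<and> p \<le> y then 1 else 0)"
    using runner_index_Suc[OF e, of p y] runner_index_dvd_sign[OF e, of p y]
    by (cases "p \<le> y") (auto split: if_splits)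
qed

lemma card_runner_neg:
  assumes e: "1 \<le> e" and "x \<le> y"
  shows "runner_neg e p y - runner_neg e p x = int (card {q \<in> {x..<y}. int e dvd q - p \<and> q < p})"
proof (rule card_window[OF assms(2)])
  fix y
  show "runner_neg e p (y + 1) = runner_neg e p y + (if int e dvd y - p \<and> y < p then 1 else 0)"
    using runner_index_Suc[OF e, of p y] runner_index_dvd_sign[OF e, of p y]
    by (cases "p \<le> y") (auto split: if_splits)
qed

section \<open>One step when a runner is empty\<close>

text \<open>The runner of \<open>p\<close> has all its beads pushed up against its first gap \<open>p\<close>.\<close>

definition empty_runner :: "nat \<Rightarrow> int \<Rightarrow> int set \<Rightarrow> bool" where
  "empty_runner e p M \<longleftrightarrow> (\<forall>x. int e dvd x - p \<longrightarrow> (x \<in> M \<longleftrightarrow> x < p))"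

lemma empty_runnerD: "empty_runner e p M \<Longrightarrow> int e dvd x - p \<Longrightarrow> x \<in> M \<longleftrightarrow> x < p"
  unfolding empty_runner_def by blast

lemma dvd_gap_ge:
  assumes "int e dvd d" "- int e < d"
  shows "0 \<le> (d :: int)"
  using assms zdvd_not_zless[of "- d" "int e"] by force

text \<open>The last bead \<open>p - e\<close> of the runner becomes its first gap \<open>e - 1 - p\<close>.\<close>

lemma empty_runner_flip:
  assumes e: "1 \<le> e" and M: "empty_runner e p (flip M)"
  shows "empty_runner e (int e - 1 - p) M"
  unfolding empty_runner_def
proof (intro allI impI)
  fix x assume x: "int e dvd x - (int e - 1 - p)"
  then have "int e dvd - (x - (int e - 1 - p) + int e)" using dvd_add dvd_refl dvd_minus_iff by blast
  then have d: "int e dvd (- 1 - x) - p" by (simp add: algebra_simps)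
  have "x \<in> M \<longleftrightarrow> - 1 - x \<notin> flip M" unfolding flip_def by simp
  also have "\<dots> \<longleftrightarrow> p \<le> - 1 - x" using empty_runnerD[OF M d] by auto
  also have "\<dots> \<longleftrightarrow> x < int e - 1 - p"
    using dvd_gap_ge[OF d] e by auto
  finally show "x \<in> M \<longleftrightarrow> x < int e - 1 - p" .
qed

lemma first_gap_le_empty_runner:
  assumes "first_gap M \<gamma>" "empty_runner e p M"
  shows "\<gamma> \<le> p"
  using assms empty_runnerD[OF assms(2), of p] unfolding first_gap_def by force

lemma sum_card_intervals:
  fixes I :: "int \<times> int \<Rightarrow> int set"
  assumes "finite P" and fin: "\<And>b c. (b, c) \<in> P \<Longrightarrow> finite (I (b, c))"
    and disj: "\<And>u v. u \<in> P \<Longrightarrow> v \<in> P \<Longrightarrow> u \<noteq> v \<Longrightarrow> I u \<inter> I v = {}"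
  shows "(\<Sum>u\<in>P. int (card (I u))) = int (card (\<Union>u\<in>P. I u))"
proof -
  have "card (\<Union>u\<in>P. I u) = (\<Sum>u\<in>P. card (I u))"
    by (rule card_UN_disjoint) (use assms in auto)
  then show ?thesis by simp
qed

text \<open>The positions of the runner in \<open>[\<gamma>, p)\<close> are beads, hence covered by the intervals \<open>(c, b]\<close>; each
  is therefore jumped over exactly once, except when it is itself the starting point \<open>b\<close> of a move.\<close>

lemma sum_runner_neg:
  assumes fg: "first_gap M \<gamma>" and P: "rim_moves e M \<gamma> P" and e: "1 \<le> e" and M: "empty_runner e p M"
  shows "(\<Sum>(b, c)\<in>P. runner_neg e p b - runner_neg e p c) =
    - runner_index e p \<gamma> - int (card {b \<in> fst ` P. int e dvd b - p})"
proof -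
  define I where "I u = {q \<in> {snd u..<fst u}. int e dvd q - p \<and> q < p}" for u :: "int \<times> int"
  have "(\<Sum>(b, c)\<in>P. runner_neg e p b - runner_neg e p c) = (\<Sum>u\<in>P. int (card (I u)))"
    by (rule sum.cong) (use card_runner_neg[OF e] rim_movesD(2)[OF P] in \<open>force simp: I_def less_imp_le\<close>)+
  also have "\<dots> = int (card (\<Union>u\<in>P. I u))"
  proof (rule sum_card_intervals)
    show "finite P" by (rule rim_moves_finite[OF P])
    show "finite (I (b, c))" for b c unfolding I_def by (rule finite_window)
    show "I u \<inter> I v = {}" if "u \<in> P" "v \<in> P" "u \<noteq> v" for u v
      using rim_moves_disjoint[OF P, of "fst u" "snd u" "fst v" "snd v"] that unfolding I_def by auto
  qed
  also have "(\<Union>u\<in>P. I u) = {q \<in> {\<gamma>..<p}. int e dvd q - p \<and> q < p} - {b \<in> fst ` P. int e dvd b - p}"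
  proof (intro equalityI subsetI)
    fix q assume "q \<in> (\<Union>u\<in>P. I u)"
    then obtain b c where m: "(b, c) \<in> P" "c \<le> q" "q < b" "int e dvd q - p" "q < p" unfolding I_def by auto
    have "q \<notin> fst ` P"
    proof
      assume "q \<in> fst ` P"
      then obtain c' where "(q, c') \<in> P" by auto
      then show False using rim_moves_disjoint[OF P m(1), of q c'] rim_movesD(2)[OF P, of q c'] m by auto
    qed
    then show "q \<in> {q \<in> {\<gamma>..<p}. int e dvd q - p \<and> q < p} - {b \<in> fst ` P. int e dvd b - p}"
      using m rim_movesD(1)[OF P m(1)] by auto
  next
    fix q assume q: "q \<in> {q \<in> {\<gamma>..<p}. int e dvd q - p \<and> q < p} - {b \<in> fst ` P. int e dvd b - p}"
    then have "q \<in> M" using empty_runnerD[OF M] by auto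
    moreover have "\<gamma> < q" using q \<open>q \<in> M\<close> fg unfolding first_gap_def by (cases "q = \<gamma>") auto
    ultimately obtain b c where bc: "(b, c) \<in> P" "c < q" "q \<le> b" using rim_moves_cover[OF P] by blast
    then have "q \<noteq> b" using q by force
    then show "q \<in> (\<Union>u\<in>P. I u)" using bc q unfolding I_def by force
  qed
  also have "int (card ({q \<in> {\<gamma>..<p}. int e dvd q - p \<and> q < p} - {b \<in> fst ` P. int e dvd b - p})) =
      int (card {q \<in> {\<gamma>..<p}. int e dvd q - p \<and> q < p}) - int (card {b \<in> fst ` P. int e dvd b - p})"
  proof -
    have sub: "{b \<in> fst ` P. int e dvd b - p} \<subseteq> {q \<in> {\<gamma>..<p}. int e dvd q - p \<and> q < p}"
    proof
      fix b assume "b \<in> {b \<in> fst ` P. int e dvd b - p}"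
      then obtain c where bc: "(b, c) \<in> P" "int e dvd b - p" by auto
      then show "b \<in> {q \<in> {\<gamma>..<p}. int e dvd q - p \<and> q < p}"
        using rim_movesD(1,2,3)[OF P bc(1)] empty_runnerD[OF M bc(2)] by auto
    qed
    have fin: "finite {q \<in> {\<gamma>..<p}. int e dvd q - p \<and> q < p}" by (rule finite_window)
    show ?thesis using card_Diff_subset[OF finite_subset[OF sub fin] sub] card_mono[OF fin sub] by simp
  qed
  also have "int (card {q \<in> {\<gamma>..<p}. int e dvd q - p \<and> q < p}) = - runner_index e p \<gamma>"
    using card_runner_neg[OF e first_gap_le_empty_runner[OF fg M], of p] runner_index_self
      runner_index_le_0_iff[OF e, of p \<gamma>] first_gap_le_empty_runner[OF fg M] by simp
  finally show ?thesis .
qed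

lemma max_min_zero: "max 0 x = x - min 0 (x :: int)"
  by simp

lemma sum_runner_pos:
  assumes fg: "first_gap M \<gamma>" and P: "rim_moves e M \<gamma> P" and e: "1 \<le> e" and M: "empty_runner e p M"
  shows "(\<Sum>(b, c)\<in>P. runner_pos e p b - runner_pos e p c) =
    runner_index e p (\<gamma> + rim_length P) + int (card {b \<in> fst ` P. int e dvd b - p})"
proof -
  have "(\<Sum>(b, c)\<in>P. runner_pos e p b - runner_pos e p c) =
    (\<Sum>(b, c)\<in>P. runner_index e p b - runner_index e p c) - (\<Sum>(b, c)\<in>P. runner_neg e p b - runner_neg e p c)"
    unfolding max_min_zero by (simp add: sum_subtractf split_beta)
  then show ?thesis
    using sum_runner_neg[OF assms] rim_sum[OF P, of "runner_index e p" 1] runner_index_add[OF e] by simp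
qed

text \<open>For the conjugate no exception occurs: the positions of the runner at or above \<open>p\<close> are gaps of
  the conjugate, hence beads on the other side, and each one below the last bead \<open>- 1 - \<gamma>\<close> is
  jumped over exactly once.\<close>

lemma sum_runner_pos_flip:
  assumes fg: "first_gap M \<gamma>" and P: "rim_moves e M \<gamma> P" and e: "1 \<le> e" and M: "empty_runner e p (flip M)"
  shows "(\<Sum>(b, c)\<in>P. runner_pos e p (- 1 - c) - runner_pos e p (- 1 - b)) = runner_pos e p (- 1 - \<gamma>)"
proof -
  define I where "I u = {q \<in> {- 1 - fst u..<- 1 - snd u}. int e dvd q - p \<and> p \<le> q}" for u :: "int \<times> int"
  have "(\<Sum>(b, c)\<in>P. runner_pos e p (- 1 - c) - runner_pos e p (- 1 - b)) = (\<Sum>u\<in>P. int (card (I u)))"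
  proof (rule sum.cong[OF refl])
    fix u assume "u \<in> P"
    then obtain b c where u: "u = (b, c)" "(b, c) \<in> P" by (cases u) auto
    then have "- 1 - b \<le> - 1 - c" using rim_movesD(2)[OF P] by force
    from card_runner_pos[OF e this, of p] show
      "(case u of (b, c) \<Rightarrow> runner_pos e p (- 1 - c) - runner_pos e p (- 1 - b)) = int (card (I u))"
      unfolding I_def u(1) by simp
  qed
  also have "\<dots> = int (card (\<Union>u\<in>P. I u))"
  proof (rule sum_card_intervals)
    show "finite P" by (rule rim_moves_finite[OF P])
    show "finite (I (b, c))" for b c unfolding I_def by (rule finite_window)
    show "I u \<inter> I v = {}" if "u \<in> P" "v \<in> P" "u \<noteq> v" for u v
      using rim_moves_disjoint[OF P, of "fst u" "snd u" "fst v" "snd v"] that unfolding I_def by auto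
  qed
  also have "(\<Union>u\<in>P. I u) = {q \<in> {p..<- 1 - \<gamma>}. int e dvd q - p \<and> p \<le> q}"
  proof (intro equalityI subsetI)
    fix q assume "q \<in> (\<Union>u\<in>P. I u)"
    then obtain b c where m: "(b, c) \<in> P" "- 1 - b \<le> q" "q < - 1 - c" "int e dvd q - p" "p \<le> q"
      unfolding I_def by auto
    then show "q \<in> {q \<in> {p..<- 1 - \<gamma>}. int e dvd q - p \<and> p \<le> q}" using rim_movesD(1)[OF P m(1)] by auto
  next
    fix q assume q: "q \<in> {q \<in> {p..<- 1 - \<gamma>}. int e dvd q - p \<and> p \<le> q}"
    then have "q \<notin> flip M" using empty_runnerD[OF M] by auto
    then have "- 1 - q \<in> M" "\<gamma> < - 1 - q" using q unfolding flip_def by auto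
    from rim_moves_cover[OF P this] obtain b c where bc: "(b, c) \<in> P" "c < - 1 - q" "- 1 - q \<le> b" .
    then have "q \<in> I (b, c)" using q unfolding I_def by auto
    then show "q \<in> (\<Union>u\<in>P. I u)" using bc(1) by blast
  qed
  also have "int (card {q \<in> {p..<- 1 - \<gamma>}. int e dvd q - p \<and> p \<le> q}) = runner_pos e p (- 1 - \<gamma>)"
  proof (cases "p \<le> - 1 - \<gamma>")
    case True
    then show ?thesis using card_runner_pos[OF e True, of p] runner_index_self by simp
  next
    case False
    then have "{q \<in> {p..<- 1 - \<gamma>}. int e dvd q - p \<and> p \<le> q} = {}" by auto
    moreover have "runner_index e p (- 1 - \<gamma>) \<le> 0" using runner_index_le_0_iff[OF e] False by simp
    ultimately show ?thesis by (simp only: card.empty)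
  qed
  finally show ?thesis .
qed

text \<open>Here the moves jump over no position of the runner at or above \<open>p\<close>: the total count,
  determined by the size of the rim, is used up by the positions below \<open>p\<close>. But the top move,
  starting from a bead above \<open>p\<close>, would have to jump over one.\<close>

lemma rim_cut_on_runner:
  assumes fg: "first_gap M \<gamma>" and P: "rim_moves e M \<gamma> P" and e: "1 \<le> e" and M: "empty_runner e p M"
    and nd: "\<not> int e dvd rim_length P" and last: "\<gamma> + rim_length P = p - int e"
    and x: "x \<in> M"
  shows "x < p"
proof (rule ccontr)
  assume "\<not> x < p"
  obtain b0 where b0: "(b0, \<gamma>) \<in> P" "\<not> int e dvd b0 - \<gamma>" "int e dvd \<gamma> + rim_length P - b0"
    using rim_not_dvdE[OF P nd] .
  have \<gamma>p: "\<gamma> \<le> p" by (rule first_gap_le_empty_runner[OF fg M])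
  have "int e dvd - ((\<gamma> + rim_length P - b0) + int e)" using b0(3) dvd_add dvd_refl dvd_minus_iff by blast
  then have b0p: "int e dvd b0 - p" unfolding last by (simp add: algebra_simps)
  \<comment> \<open>Only \<open>b0\<close> starts on the runner, which accounts for one position missing from the count below \<open>p\<close>.\<close>
  have "{b \<in> fst ` P. int e dvd b - p} = {b0}"
  proof (intro equalityI subsetI)
    fix b assume "b \<in> {b \<in> fst ` P. int e dvd b - p}"
    then obtain c where bc: "(b, c) \<in> P" and bp: "int e dvd b - p" by auto
    note D = rim_movesD[OF P bc]
    have "b < p" using empty_runnerD[OF M bp] D(3) by simp
    have "c = \<gamma>"
    proof (rule ccontr)
      assume "c \<noteq> \<gamma>"
      then have "int e dvd (b - p) - (b - c)" using D(5) bp dvd_diff by blast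
      then have "int e dvd c - p" by simp
      then show False using empty_runnerD[OF M, of c] D(2,4) \<open>b < p\<close> by simp
    qed
    then show "b \<in> {b0}" using rim_moves_snd_inj[OF P b0(1)] bc by simp
  qed (use b0(1) b0p in force)
  moreover have "runner_index e p (p - int e) = - 1"
    using runner_index_add[OF e, of p "p - int e"] runner_index_self[of e p] by simp
  ultimately have zero: "(\<Sum>(b, c)\<in>P. runner_pos e p b - runner_pos e p c) = 0"
    using sum_runner_pos[OF fg P e M] unfolding last by simp
  have nonneg: "0 \<le> (case u of (b, c) \<Rightarrow> runner_pos e p b - runner_pos e p c)" if "u \<in> P" for u
    using that rim_movesD(2)[OF P, of "fst u" "snd u"] runner_index_mono[OF e, of "snd u" "fst u" p]
    by (auto simp: split_beta)
  have each: "runner_pos e p b = runner_pos e p c" if "(b, c) \<in> P" for b c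
    using sum_nonneg_eq_0_iff[OF rim_moves_finite[OF P] nonneg] zero that by force
  have "x \<noteq> p" using empty_runnerD[OF M, of p] x by auto
  then have "p < x" using \<open>\<not> x < p\<close> by simp
  then obtain b c where bc: "(b, c) \<in> P" "c < x" "x \<le> b" using rim_moves_cover[OF P x] \<gamma>p by auto
  have "0 < runner_index e p b" using runner_index_le_0_iff[OF e, of p b] bc(3) \<open>p < x\<close> by auto
  then have c: "runner_index e p c = runner_index e p b" using each[OF bc(1)] by auto
  have "c \<noteq> \<gamma>" using c \<open>0 < runner_index e p b\<close> runner_index_le_0_iff[OF e, of p \<gamma>] \<gamma>p by auto
  then have "int e dvd b - c" "c < b" using rim_movesD(2,5)[OF P bc(1)] by auto
  then have "c + int e \<le> b" using zdvd_imp_le[of "int e" "b - c"] by simp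
  then show False using runner_index_mono[OF e, of "c + int e" b p] runner_index_add[OF e] c by simp
qed

text \<open>A move along the runner of \<open>p\<close> would go from a bead below \<open>p\<close> to a gap at or above \<open>p\<close>. So only
  the move that changes runners can touch it.\<close>

lemma empty_runner_moved:
  assumes P: "rim_moves e M \<gamma> P" and M: "empty_runner e p M"
    and cut: "\<not> int e dvd rim_length P \<Longrightarrow> \<not> int e dvd \<gamma> + rim_length P - p \<and> \<not> int e dvd \<gamma> - p"
  shows "empty_runner e p (moved M P)" "{b \<in> fst ` P. int e dvd b - p} = {}"
proof -
  have both: "\<not> int e dvd b - p \<and> \<not> int e dvd c - p" if bc: "(b, c) \<in> P" for b c
  proof (cases "int e dvd b - c")
    case True
    note D = rim_movesD[OF P bc]
    have eq: "int e dvd b - p \<longleftrightarrow> int e dvd c - p"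
      using True by (metis diff_add_cancel diff_diff_eq2 dvd_add_right_iff add_diff_eq add.commute)
    have "\<not> int e dvd b - p"
    proof
      assume "int e dvd b - p"
      then have "b < p" "\<not> c < p" using eq empty_runnerD[OF M] D(3,4) by auto
      then show False using D(2) by simp
    qed
    then show ?thesis using eq by simp
  next
    case False
    then have c: "c = \<gamma>" and nd: "\<not> int e dvd rim_length P"
      using rim_movesD(5)[OF P bc] rim_length_dvd_iff[OF P] bc by auto
    have d: "int e dvd \<gamma> + rim_length P - b" using rim_cut_sum(1)[OF P] bc False c by blast
    have "\<not> int e dvd b - p"
    proof
      assume "int e dvd b - p"
      then have "int e dvd (\<gamma> + rim_length P - b) + (b - p)" using d dvd_add by blast
      moreover have "(\<gamma> + rim_length P - b) + (b - p) = \<gamma> + rim_length P - p" by simp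
      ultimately show False using cut[OF nd] by metis
    qed
    then show ?thesis using cut[OF nd] c by simp
  qed
  show "{b \<in> fst ` P. int e dvd b - p} = {}" using both by auto
  show "empty_runner e p (moved M P)" unfolding empty_runner_def
  proof (intro allI impI)
    fix x assume "int e dvd x - p"
    then have "x \<in> moved M P \<longleftrightarrow> x \<in> M" using both unfolding moved_iff by blast
    then show "x \<in> moved M P \<longleftrightarrow> x < p" using empty_runnerD[OF M \<open>int e dvd x - p\<close>] by simp
  qed
qed

section \<open>The comparison\<close>

text \<open>The rounded-up quotient increases from \<open>z\<close> to \<open>z + 1\<close> only if \<open>z\<close> is on the runner; then it goes
  from \<open>- 1\<close> to \<open>0\<close>, and the positive part does not see the difference.\<close>

lemma runner_end_agreement:
  assumes e: "1 \<le> e" and ge: "p - int e \<le> z" and on: "int e dvd z - p \<Longrightarrow> z = p - int e"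
  shows "runner_index e p (z + 1) = runner_pos e p z"
proof (cases "int e dvd z - p")
  case True
  then have z: "z = p - int e" by (rule on)
  have "runner_index e p (p - int e) = - 1"
    using runner_index_add[OF e, of p "p - int e"] runner_index_self[of e p] by simp
  then show ?thesis using runner_index_Suc[OF e, of p z] True z by simp
next
  case False
  then have "z \<noteq> p - int e" by auto
  then have "0 \<le> runner_index e p z" using runner_index_neg_iff[OF e, of p z] ge by linarith
  then show ?thesis using runner_index_Suc[OF e, of p z] False by simp
qed

lemma wsum_runner_pos_zero:
  assumes "1 \<le> e" "\<And>x. x \<in> M \<Longrightarrow> x \<le> p"
  shows "wsum n (runner_pos e p) M = 0"
  unfolding wsum_def using assms runner_index_le_0_iff by (intro sum.neutral) fastforce

lemma wsum_runner_neg_full: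
  assumes e: "1 \<le> e" and full: "\<And>x. x \<le> p - int e \<Longrightarrow> x \<in> M" and fin: "finite {x \<in> M. - n \<le> x}"
  shows "wsum n (runner_neg e p) M = (\<Sum>x\<in>{- n..p - int e}. runner_neg e p x)"
  unfolding wsum_def
proof (rule sum.mono_neutral_right)
  show "finite {x. x \<in> M \<and> - n \<le> x}" using fin by simp
  show "{- n..p - int e} \<subseteq> {x. x \<in> M \<and> - n \<le> x}" using full by auto
  show "\<forall>x\<in>{x. x \<in> M \<and> - n \<le> x} - {- n..p - int e}. runner_neg e p x = 0"
    using runner_index_neg_iff[OF e, of p] by fastforce
qed

lemma wsum_runner_split:
  "wsum n (runner_index e p) M = wsum n (runner_pos e p) M + wsum n (runner_neg e p) M"
  unfolding wsum_def sum.distrib[symmetric] by (rule sum.cong) auto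

text \<open>In the generic case (III) the runner stays empty at \<open>p\<close> on both sides, and the sums drop by
  equal amounts. If the move that changes runners takes a bead from the runner (I), the last
  bead of the conjugate is at \<open>p - e\<close>, and neither side has beads above \<open>p\<close>. If it puts a bead on
  the runner (II), the image is in case (I), so neither side has gaps at or below \<open>p - e\<close>; the
  sums then differ from sums with increment 1 by the same constant.\<close>

lemma mullineux_wsum_runner_pos:
  assumes e: "1 \<le> e"
  shows "mullineux_graph e \<mu> \<nu> \<Longrightarrow> int (num_parts \<mu>) \<le> n \<Longrightarrow> (\<And>x. x \<in> maya \<nu> \<Longrightarrow> x < n) \<Longrightarrow>
    empty_runner e p (maya \<mu>) \<Longrightarrow> empty_runner e p (flip (maya \<nu>)) \<Longrightarrow>
    wsum n (runner_pos e p) (maya \<mu>) = wsum n (runner_pos e p) (flip (maya \<nu>))"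
proof (induction rule: mullineux_graph.induct)
  case empty
  have "flip (maya empty_partition) = maya empty_partition" unfolding maya_empty flip_def by auto
  then show ?case by simp
next
  case (step \<mu> \<rho> \<nu>)
  let ?M = "maya \<mu>" and ?N = "maya \<nu>"
  define \<gamma> \<gamma>' where "\<gamma> = - int (num_parts \<mu>)" and "\<gamma>' = - int (num_parts \<nu>)"
  obtain P Q where P: "rim_moves e ?M \<gamma> P" and Q: "rim_moves e ?N \<gamma>' Q"
    and T: "maya (triangle e \<mu>) = moved ?M P" "maya (triangle e \<nu>) = moved ?N Q"
    and len: "rim_length Q = rim_length P"
    and num: "int (num_parts \<nu>) + int (num_parts \<mu>) = rim_length P + excess e (rim_length P)"
    and bounds: "num_parts (triangle e \<mu>) \<le> num_parts \<mu>"
      "\<forall>n. (\<forall>x\<in>?N. x < n) \<longrightarrow> (\<forall>x\<in>maya (triangle e \<nu>). x < n)"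
    using mullineux_step_moves[OF e, of \<mu> \<nu>] step.hyps unfolding \<gamma>_def \<gamma>'_def by blast
  define a where "a = rim_length P"
  define z where "z = - 1 - \<gamma>'"
  have part: "is_partition \<mu>" "is_partition \<nu>" by (fact step.hyps)+
  have fg: "first_gap ?M \<gamma>" and fg': "first_gap ?N \<gamma>'"
    unfolding \<gamma>_def \<gamma>'_def using first_gap_maya part by auto
  have M: "empty_runner e p ?M" and N: "empty_runner e p (flip ?N)" by (fact step.prems)+
  have n: "- n \<le> \<gamma>" "\<And>x. x \<in> ?N \<Longrightarrow> x < n" using step.prems unfolding \<gamma>_def by auto
  have za: "z = \<gamma> + a + excess e a - 1" using num unfolding z_def \<gamma>_def \<gamma>'_def a_def by simp
  \<comment> \<open>The image itself has an empty runner too, so that results about one display apply to it.\<close>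
  have N': "empty_runner e (int e - 1 - p) ?N" by (rule empty_runner_flip[OF e N])
  have z_last: "z \<in> flip ?N" "\<And>x. x \<in> flip ?N \<Longrightarrow> x \<le> z"
    using fg' unfolding z_def flip_def first_gap_def by (auto, force)
  have bead: "p - int e \<in> flip ?N" using empty_runnerD[OF N, of "p - int e"] e by simp
  have z_ge: "p - int e \<le> z" by (rule z_last(2)[OF bead])
  \<comment> \<open>The last bead \<open>z\<close> of the conjugate can be on the runner only as the last bead of the runner.\<close>
  have z_on: "z = p - int e" if "int e dvd z - p"
  proof -
    have "z < p" using empty_runnerD[OF N that] z_last(1) by simp
    moreover have "int e dvd (z - p) + int e" using that dvd_add dvd_refl by blast
    ultimately have "(z - p) + int e = 0" using z_ge by (intro dvd_in_window[of e]) auto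
    then show ?thesis by simp
  qed
  have split_eq: ?case if full: "\<And>x. x \<le> p - int e \<Longrightarrow> x \<in> ?M" "\<And>x. x \<le> p - int e \<Longrightarrow> x \<in> flip ?N"
  proof -
    have "mullineux_graph e \<mu> \<nu>" by (rule mullineux_graph.step[OF step.hyps])
    from wsum_mullineux[OF e _ this, of "runner_index e p" 1 n]
    have "wsum n (runner_index e p) ?M = wsum n (runner_index e p) (flip ?N)"
      using runner_index_add[OF e] step.prems by blast
    moreover have "wsum n (runner_neg e p) ?M = (\<Sum>x\<in>{- n..p - int e}. runner_neg e p x)"
      by (rule wsum_runner_neg_full[OF e full(1) finite_maya_above[OF part(1)]])
    moreover have "wsum n (runner_neg e p) (flip ?N) = (\<Sum>x\<in>{- n..p - int e}. runner_neg e p x)"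
      by (rule wsum_runner_neg_full[OF e full(2) finite_flip_maya_above[OF part(2)]])
    ultimately show ?thesis unfolding wsum_runner_split by simp
  qed
  consider (I) "\<not> int e dvd a" "int e dvd \<gamma> + a - p" | (II) "\<not> int e dvd a" "int e dvd \<gamma> - p"
    | (III) "\<not> int e dvd a \<Longrightarrow> \<not> int e dvd \<gamma> + a - p \<and> \<not> int e dvd \<gamma> - p" by blast
  then show ?case
  proof cases
    case I
    have z: "z = \<gamma> + a" using za I(1) unfolding excess_def by simp
    then have zp: "z = p - int e" using z_on I(2) by simp
    have "x < p" if "x \<in> ?M" for x
      by (rule rim_cut_on_runner[OF fg P e M _ _ that]) (use I z zp a_def in auto)
    then have "wsum n (runner_pos e p) ?M = 0" by (intro wsum_runner_pos_zero[OF e]) force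
    moreover have "wsum n (runner_pos e p) (flip ?N) = 0"
      by (intro wsum_runner_pos_zero[OF e]) (use z_last(2) zp in force)
    ultimately show ?thesis by simp
  next
    case II
    have "\<gamma> = p"
      using empty_runnerD[OF M II(2)] fg first_gap_le_empty_runner[OF fg M] unfolding first_gap_def by auto
    then have last: "\<gamma>' + rim_length Q = (int e - 1 - p) - int e"
      using za II(1) len unfolding z_def a_def excess_def by auto
    have low: "x < int e - 1 - p" if "x \<in> ?N" for x
      by (rule rim_cut_on_runner[OF fg' Q e N' _ last that]) (use II len a_def in auto)
    show ?thesis
    proof (rule split_eq)
      show "x \<in> ?M" if "x \<le> p - int e" for x
        using fg that e \<open>\<gamma> = p\<close> unfolding first_gap_def by auto
      show "x \<in> flip ?N" if "x \<le> p - int e" for x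
        using low[of "- 1 - x"] that unfolding flip_def by auto
    qed
  next
    case III
    have moved_M: "empty_runner e p (moved ?M P)" "{b \<in> fst ` P. int e dvd b - p} = {}"
      using empty_runner_moved[OF P M] III unfolding a_def by auto
    have cut': "\<not> int e dvd \<gamma>' + a - (int e - 1 - p) \<and> \<not> int e dvd \<gamma>' - (int e - 1 - p)" if "\<not> int e dvd a"
    proof -
      have \<gamma>': "\<gamma>' = - 1 - \<gamma> - a" using za that unfolding z_def excess_def by simp
      have eqs: "\<gamma>' + a - (int e - 1 - p) = - (\<gamma> - p) - int e"
        "\<gamma>' - (int e - 1 - p) = - (\<gamma> + a - p) - int e"
        unfolding \<gamma>' by simp_all
      have d: "int e dvd - x - int e \<longleftrightarrow> int e dvd x" for x
        by (metis dvd_diff_left_iff dvd_refl dvd_minus_iff)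
      show ?thesis unfolding eqs d using III[OF that] by blast
    qed
    have "empty_runner e (int e - 1 - p) (moved ?N Q)"
      using empty_runner_moved(1)[OF Q N'] cut' len unfolding a_def by simp
    moreover have "flip (flip (moved ?N Q)) = moved ?N Q" unfolding flip_def by simp
    ultimately have moved_N: "empty_runner e p (flip (moved ?N Q))"
      using empty_runner_flip[OF e, of "int e - 1 - p" "flip (moved ?N Q)"] by simp
    have "\<forall>x\<in>maya \<rho>. x < n" using bounds(2) n(2) unfolding step.hyps(10) by blast
    then have IH: "wsum n (runner_pos e p) (maya (triangle e \<mu>)) = wsum n (runner_pos e p) (flip (maya \<rho>))"
      using step.IH step.prems(1) bounds(1) moved_M(1) moved_N T step.hyps(10) by simp
    have "wsum n (runner_pos e p) (maya (triangle e \<mu>)) = wsum n (runner_pos e p) ?M - runner_index e p (\<gamma> + a)"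
      using wsum_moved[OF P finite_maya_above[OF part(1)] n(1), of "runner_pos e p"]
        sum_runner_pos[OF fg P e M] unfolding moved_M(2) T(1) a_def by simp
    moreover have "wsum n (runner_pos e p) (flip (maya \<rho>)) = wsum n (runner_pos e p) (flip ?N) - runner_pos e p z"
      using wsum_flip_moved[OF fg' Q n(2), of "runner_pos e p"] sum_runner_pos_flip[OF fg' Q e N]
        T(2) step.hyps(10) unfolding z_def by simp
    moreover have "runner_index e p (\<gamma> + a) = runner_pos e p z"
    proof (cases "int e dvd a")
      case True
      then have "\<gamma> + a = z + 1" using za unfolding excess_def by simp
      then show ?thesis using runner_end_agreement[OF e z_ge z_on] by simp
    next
      case False
      then have z: "z = \<gamma> + a" using za unfolding excess_def by simp
      then have nd: "\<not> int e dvd z - p" using III False by simp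
      then have "runner_index e p (z + 1) = runner_index e p z" using runner_index_Suc[OF e] by simp
      then show ?thesis using runner_end_agreement[OF e z_ge z_on] z by simp
    qed
    ultimately show ?thesis using IH by simp
  qed
qed

text \<open>A bead \<open>b\<close> contributes to \<open>L_stat\<close> the positions \<open>z = b - j * e\<close> above the first gap; the
  reflection of \<open>z\<close> within the interval from the gap to \<open>b\<close> turns them into the positions of the
  empty runner below \<open>b\<close>.\<close>

lemma k_empty_empty_runner:
  assumes e: "1 \<le> e" and p: "is_partition p" and k: "k_empty e k p"
  shows "\<exists>g. int e dvd g - int k \<and> empty_runner e g (maya p) \<and>
    (\<forall>n. int (num_parts p) \<le> n \<longrightarrow> int (L_stat e k p) = wsum n (runner_pos e g) (maya p))"
proof -
  define r d A where "r = num_parts p" and "d = (k + r) mod e" and "A = beta_set r p"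
  define c where "c = card (runner_beads e d A)"
  define D where "D = d + c * e"
  define g where "g = int D - int r"
  have R: "runner_beads e d A = (\<lambda>j. d + j * e) ` {..<c}"
    using k unfolding k_empty_def Let_def r_def[symmetric] d_def[symmetric] A_def[symmetric] c_def .
  have A: "m \<in> A \<longleftrightarrow> int m - int r \<in> maya p" for m
    unfolding A_def using beta_set_iff_maya[OF p, of r] r_def by simp
  have finA: "finite A" unfolding A_def beta_set_def by simp
  have de: "d < e" unfolding d_def using e by simp
  have below: "x \<in> maya p" if "x < - int r" for x
    using first_gap_maya[OF p] that unfolding first_gap_def r_def by blast
  have gk: "int e dvd g - int k"
  proof -
    have "int d = int (k + r) - int e * int ((k + r) div e)"
      unfolding d_def by (simp add: minus_mult_div_eq_mod[symmetric] zmod_int zdiv_int)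
    then have "g - int k = int e * (int c - int ((k + r) div e))"
      unfolding g_def D_def by (simp add: algebra_simps)
    then show ?thesis by simp
  qed
  have empt: "empty_runner e g (maya p)" unfolding empty_runner_def
  proof (intro allI impI)
    fix x assume x: "int e dvd x - g"
    show "x \<in> maya p \<longleftrightarrow> x < g"
    proof (cases "x < - int r")
      case True
      then show ?thesis using below unfolding g_def by simp
    next
      case False
      define m where "m = nat (x + int r)"
      have m: "x = int m - int r" using False unfolding m_def by simp
      have "int e dvd int m - int D" using x unfolding m g_def by simp
      then have "m mod e = D mod e" by (simp add: dvd_iff_mod_eq)
      then have md: "m mod e = d" unfolding D_def using de by simp
      have "x \<in> maya p \<longleftrightarrow> m \<in> runner_beads e d A" using A md unfolding m runner_beads_def by simp
      also have "\<dots> \<longleftrightarrow> m < D"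
      proof
        assume "m \<in> runner_beads e d A"
        then obtain j where "j < c" "m = d + j * e" unfolding R by blast
        then show "m < D" unfolding D_def using e by simp
      next
        assume "m < D"
        have mj: "m = d + (m div e) * e" using md by (metis mod_div_mult_eq)
        then have "(m div e) * e < c * e" using \<open>m < D\<close> unfolding D_def by linarith
        then have "m div e < c" by simp
        then show "m \<in> runner_beads e d A" unfolding R using mj by blast
      qed
      finally show ?thesis unfolding m g_def by simp
    qed
  qed
  define Z where "Z = {D<..Max (insert D A)}"
  have count: "count (X_mset e (mset_set A)) z = card {b \<in> A. \<exists>j. b = z + j * e}" for z
    unfolding count_X_mset by (simp add: filter_mset_mset_set finA)
  have zero: "card {b \<in> A. \<exists>j. b = z + j * e} = 0" if "D < z" "z \<notin> Z" for z
  proof -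
    have "b < z" if "b \<in> A" for b
    proof -
      have "b \<le> Max (insert D A)" using finA that by simp
      then show ?thesis using \<open>D < z\<close> \<open>z \<notin> Z\<close> unfolding Z_def by simp
    qed
    then have "{b \<in> A. \<exists>j. b = z + j * e} = {}" by force
    then show ?thesis by (simp only: card.empty)
  qed
  have "L_stat e k p = size {#z \<in># X_mset e (mset_set A). z > D#}"
    unfolding L_stat_def Let_def r_def[symmetric] d_def[symmetric] A_def[symmetric] c_def[symmetric] D_def ..
  also have "\<dots> = (\<Sum>z\<in>Z. count {#z \<in># X_mset e (mset_set A). z > D#} z)"
    unfolding size_multiset_overloaded_eq
  proof (rule sum.mono_neutral_left)
    show "finite Z" unfolding Z_def by simp
    show "set_mset {#z \<in># X_mset e (mset_set A). z > D#} \<subseteq> Z"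
    proof
      fix z assume "z \<in># {#z \<in># X_mset e (mset_set A). z > D#}"
      then have "D < z" and z: "z \<in># X_mset e (mset_set A)" by simp_all
      show "z \<in> Z"
      proof (rule ccontr)
        assume "z \<notin> Z"
        then have "count (X_mset e (mset_set A)) z = 0" unfolding count by (rule zero[OF \<open>D < z\<close>])
        then show False using z by (simp add: not_in_iff[symmetric])
      qed
    qed
  qed (auto simp: not_in_iff)
  also have "\<dots> = (\<Sum>z\<in>Z. card {b \<in> A. \<exists>j. b = z + j * e})"
    by (rule sum.cong) (auto simp: Z_def count)
  also have "\<dots> = (\<Sum>z\<in>Z. \<Sum>b\<in>A. if \<exists>j. b = z + j * e then 1 else 0)"
    using finA by (simp add: sum.If_cases Int_def)
  also have "\<dots> = (\<Sum>b\<in>A. \<Sum>z\<in>Z. if \<exists>j. b = z + j * e then 1 else 0)"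
    by (rule sum.swap)
  also have "\<dots> = (\<Sum>b\<in>A. card {z \<in> Z. \<exists>j. b = z + j * e})"
    by (simp add: sum.If_cases Int_def Z_def)
  finally have L: "L_stat e k p = (\<Sum>b\<in>A. card {z \<in> Z. \<exists>j. b = z + j * e})" .
  have summand: "int (card {z \<in> Z. \<exists>j. b = z + j * e}) = runner_pos e g (int b - int r)" if b: "b \<in> A" for b
  proof (cases "b \<le> D")
    case True
    then have "{z \<in> Z. \<exists>j. b = z + j * e} = {}" unfolding Z_def by auto
    moreover have "runner_index e g (int b - int r) \<le> 0"
      using runner_index_le_0_iff[OF e] True unfolding g_def by simp
    ultimately show ?thesis by (simp only: card.empty)
  next
    case False
    then have gb: "g \<le> int b - int r" unfolding g_def by simp
    have "bij_betw (\<lambda>z. g + int b - int z) {z \<in> Z. \<exists>j. b = z + j * e}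
      {q \<in> {g..<int b - int r}. int e dvd q - g \<and> g \<le> q}" (is "bij_betw ?h ?X ?Y")
    proof (rule bij_betw_imageI)
      show "inj_on ?h ?X" by (simp add: inj_on_def)
      show "?h ` ?X = ?Y"
      proof (intro equalityI subsetI)
        fix q assume "q \<in> ?h ` ?X"
        then obtain z j where "z \<in> Z" "b = z + j * e" "q = g + int b - int z" by blast
        then show "q \<in> ?Y" unfolding Z_def g_def by auto
      next
        fix q assume q: "q \<in> ?Y"
        then obtain i where i: "q - g = int e * i" by blast
        moreover have "0 \<le> q - g" using q by simp
        ultimately have "0 \<le> i" using e by (simp add: zero_le_mult_iff)
        then obtain j where j: "q = g + int e * int j" using i zero_le_imp_eq_int by (metis add.commute diff_add_cancel)
        have "int D + int e * int j < int b" using q unfolding j g_def by simp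
        then have lt: "D + j * e < b" by (metis mult.commute of_nat_add of_nat_less_iff of_nat_mult)
        have "b \<le> Max (insert D A)" using finA b by simp
        then have "b - j * e \<in> ?X" using lt unfolding Z_def by (auto intro!: exI[of _ j])
        moreover have "q = ?h (b - j * e)" using lt unfolding j by (simp add: of_nat_diff mult.commute)
        ultimately show "q \<in> ?h ` ?X" by blast
      qed
    qed
    then have "card ?X = card ?Y" by (rule bij_betw_same_card)
    then show ?thesis using card_runner_pos[OF e gb, of g] runner_index_self[of e g] by simp
  qed
  have "int (L_stat e k p) = wsum n (runner_pos e g) (maya p)" if n: "int (num_parts p) \<le> n" for n
  proof -
    have "int (L_stat e k p) = (\<Sum>b\<in>A. runner_pos e g (int b - int r))" unfolding L using summand by simp
    also have "\<dots> = (\<Sum>x\<in>(\<lambda>b. int b - int r) ` A. runner_pos e g x)"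
      by (subst sum.reindex) (auto simp: inj_on_def)
    also have "\<dots> = wsum n (runner_pos e g) (maya p)" unfolding wsum_def
    proof (rule sum.mono_neutral_left)
      show "finite {x. x \<in> maya p \<and> - n \<le> x}" using finite_maya_above[OF p] .
      show "(\<lambda>b. int b - int r) ` A \<subseteq> {x. x \<in> maya p \<and> - n \<le> x}" using A n r_def by auto
      show "\<forall>x\<in>{x. x \<in> maya p \<and> - n \<le> x} - (\<lambda>b. int b - int r) ` A. runner_pos e g x = 0"
      proof
        fix x assume x: "x \<in> {x. x \<in> maya p \<and> - n \<le> x} - (\<lambda>b. int b - int r) ` A"
        have "x < - int r"
        proof (rule ccontr)
          assume "\<not> x < - int r"
          then have m: "x = int (nat (x + int r)) - int r" by simp
          then have "nat (x + int r) \<in> A" using A[of "nat (x + int r)"] x by simp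
          then show False using m x by blast
        qed
        then have "x \<le> g" unfolding g_def by simp
        then show "runner_pos e g x = 0" using runner_index_le_0_iff[OF e] by simp
      qed
    qed
    finally show ?thesis .
  qed
  then show ?thesis using gk empt by blast
qed

text \<open>The number of beads on an empty runner determines its first gap.\<close>

lemma empty_runner_le:
  assumes M: "empty_runner e g M" and N: "empty_runner e h N"
    and gk: "int e dvd g - k" and hk: "int e dvd h - k" and g: "- n \<le> g" and fin: "finite {x \<in> N. - n \<le> x}"
    and eq: "wsum n (\<lambda>x. if int e dvd x - k then 1 else 0) M = wsum n (\<lambda>x. if int e dvd x - k then 1 else 0) N"
    and finM: "finite {x \<in> M. - n \<le> x}"
  shows "h \<le> g"
proof (rule ccontr)
  assume "\<not> h \<le> g"
  let ?B = "\<lambda>M. {x \<in> {x \<in> M. - n \<le> x}. int e dvd x - k}"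
  have same: "int e dvd x - g" "int e dvd x - h" if "int e dvd x - k" for x
    using dvd_diff[OF that gk] dvd_diff[OF that hk] by auto
  have card: "wsum n (\<lambda>x. if int e dvd x - k then 1 else 0) M = int (card (?B M))"
    if "finite {x \<in> M. - n \<le> x}" for M
    using that unfolding wsum_def by (simp add: sum.If_cases Int_def conj_ac)
  have "?B M \<subseteq> ?B N" using empty_runnerD[OF M] empty_runnerD[OF N] same \<open>\<not> h \<le> g\<close> by force
  moreover have "g \<in> ?B N" "g \<notin> ?B M"
    using empty_runnerD[OF M, of g] empty_runnerD[OF N, of g] same[OF gk] gk g \<open>\<not> h \<le> g\<close> by auto
  ultimately have "?B M \<subset> ?B N" by blast
  moreover have "finite (?B N)" using fin by (rule finite_subset[rotated]) auto
  ultimately have "card (?B M) < card (?B N)" by (intro psubset_card_mono)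
  then show False using eq card[OF finM] card[OF fin] by simp
qed

theorem theorem3p5:
  fixes e k :: nat and \<mu> :: "nat \<Rightarrow> nat"
  assumes "e \<ge> 2"
    and "k \<in> {0..e - 1}"
    and "is_partition \<mu>" and "regular e \<mu>"
    and "k_empty e k \<mu>"
    and "k_empty e k (conjugate (mullineux e \<mu>))"
  shows "L_stat e k \<mu> = L_stat e k (conjugate (mullineux e \<mu>))"
proof -
  let ?\<nu> = "mullineux e \<mu>"
  have e: "1 \<le> e" using assms(1) by simp
  have graph: "mullineux_graph e \<mu> ?\<nu>" by (rule mullineux_graph_mullineux[OF assms(3,4) e])
  have \<nu>: "is_partition ?\<nu>" using mullineux_graph_partition[OF graph] by blast
  have c\<nu>: "is_partition (conjugate ?\<nu>)" by (rule is_partition_conjugate[OF \<nu>])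
  have flip: "maya (conjugate ?\<nu>) = flip (maya ?\<nu>)" by (rule maya_conjugate[OF \<nu>])
  obtain g where g: "int e dvd g - int k" "empty_runner e g (maya \<mu>)"
    "\<And>n. int (num_parts \<mu>) \<le> n \<Longrightarrow> int (L_stat e k \<mu>) = wsum n (runner_pos e g) (maya \<mu>)"
    using k_empty_empty_runner[OF e assms(3,5)] by blast
  obtain h where h: "int e dvd h - int k" "empty_runner e h (maya (conjugate ?\<nu>))"
    "\<And>n. int (num_parts (conjugate ?\<nu>)) \<le> n \<Longrightarrow>
      int (L_stat e k (conjugate ?\<nu>)) = wsum n (runner_pos e h) (maya (conjugate ?\<nu>))"
    using k_empty_empty_runner[OF e c\<nu> assms(6)] by blast
  \<comment> \<open>Large enough for all bead sets involved.\<close>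
  define n where "n = int (num_parts \<mu>) + int (num_parts (conjugate ?\<nu>)) + int (?\<nu> 0)"
  have n: "int (num_parts \<mu>) \<le> n" "int (num_parts (conjugate ?\<nu>)) \<le> n" "\<And>x. x \<in> maya ?\<nu> \<Longrightarrow> x < n"
    using maya_less[OF \<nu>] unfolding n_def by force+
  have lower: "- n \<le> g" "- n \<le> h"
    using first_gap_le_empty_runner[OF first_gap_maya[OF assms(3)] g(2)]
      first_gap_le_empty_runner[OF first_gap_maya[OF c\<nu>] h(2)] n by auto
  have shifted: "int e dvd (x + int e) - int k \<longleftrightarrow> int e dvd x - int k" for x
    by (metis add_diff_eq add.commute dvd_add_right_iff dvd_refl)
  \<comment> \<open>Counting the beads on the runner shows that both partitions are empty at the same position.\<close>
  have "wsum n (\<lambda>x. if int e dvd x - int k then 1 else 0) (maya \<mu>) =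
      wsum n (\<lambda>x. if int e dvd x - int k then 1 else 0) (maya (conjugate ?\<nu>))"
    unfolding flip by (rule wsum_mullineux[OF e _ graph n(1,3), of _ 0]) (simp only: shifted add_0_right)
  then have "g = h"
    using empty_runner_le[OF g(2) h(2) g(1) h(1) lower(1)] empty_runner_le[OF h(2) g(2) h(1) g(1) lower(2)]
      finite_maya_above[OF assms(3)] finite_maya_above[OF c\<nu>] by (intro order_antisym) simp_all
  then have "int (L_stat e k \<mu>) = int (L_stat e k (conjugate ?\<nu>))"
    using mullineux_wsum_runner_pos[OF e graph n(1,3) g(2)] h(2) g(3)[OF n(1)] h(3)[OF n(2)] unfolding flip
    by simp
  then show ?thesis by simp
qed

end
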